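(* In $\overline{\mathbb{H}}^4$, consider all congruent ball packings and all horoball packings of at most two horoball types (each ideal vertex of the fundamental domain carrying at most one horoball, of arbitrary admissible type) generated by simply truncated Coxeter orthoschemes with parallel faces, i.e. by the orthoschemes with Schläfli symbols $\{4,4,3,3,\infty\}$, $\{4,4,3,4,\infty\}$, $\{6,3,3,3,\infty\}$, $\{6,3,3,4,\infty\}$, $\{6,3,3,5,\infty\}$, $\{6,3,4,3,\infty\}$. Among all these packings the densest is the horoball configuration $\mathcal{B}_{\{4,4,3,4,\infty\}}$ belonging to $\{4,4,3,4,\infty\}$, consisting of the images of the two maximal horoballs $\mathcal{B}_0^{opt}$ and $\mathcal{B}_3^{opt}$ centered at the two ideal vertices $A_0$ and $A_3$, and its density is $$\frac{5\sqrt{2}}{\pi^2}\approx 0.71645 .$$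
   Context: Simply truncated Coxeter orthoschemes with parallel faces. Let $\mathbb{R}^{n+1}$ carry the Lorentzian form $\langle x,y\rangle=-x^0y^0+x^1y^1+\dots+x^ny^n$, and use the projective (Beltrami–Cayley–Klein) model of $\mathbb{H}^n$ (curvature $-1$), with ideal points $\partial\mathbb{H}^n$ (null vectors), $\overline{\mathbb{H}}^n=\mathbb{H}^n\cup\partial\mathbb{H}^n$, and outer points (vectors of positive norm). For a symbol $\{m_1,\dots,m_n,\infty\}$ let $H^0,\dots,H^{n+1}$ be hyperplanes with outward unit normals $b^0,\dots,b^{n+1}$ satisfying $\langle b^i,b^i\rangle=1$, $\langle b^{i-1},b^i\rangle=-\cos(\pi/m_i)$ for $1\le i\le n$, $\langle b^n,b^{n+1}\rangle=-1$ (i.e. $H^n,H^{n+1}$ are parallel), and $\langle b^i,b^j\rangle=0$ for $|i-j|\ge 2$. The fundamental domain $\widehat{\mathcal S}=\mathcal F$ is the polytope bounded by $H^0,\dots,H^{n+1}$. For $0\le i\le n$, $A_i$ denotes the common point of the $H^j$ with $0\le j\le n$, $j\ne i$; $A_n$ is an outer point, $H^{n+1}$ is its polar hyperplane (the truncating hyperplane), and $A_{n-1}$ is ideal. $\Gamma$ is the discrete group generated by the reflections in $H^0,\dots,H^{n+1}$; the images of $\mathcal F$ under $\Gamma$ tile $\overline{\mathbb{H}}^n$. Here $n=4$. Packings. A congruent ball packing generated by $\mathcal F$ consists of the $\Gamma$-images of a ball $\mathcal B\subset\mathcal F$; its density is $\mathrm{vol}(\mathcal B)/\mathrm{vol}(\mathcal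 F)$. A horoball packing generated by $\mathcal F$ consists of the $\Gamma$-images of a nonempty family of horoballs $B_i$ centered at ideal vertices of $\mathcal F$ (at most one per ideal vertex, their sizes being independent of one another), such that no two horoballs have a common interior point (tangency is allowed) and no $B_i$ extends beyond a bounding hyperplane of $\mathcal F$ that does not contain its center. Its density is $\sum_i \mathrm{vol}(B_i\cap\mathcal F)/\mathrm{vol}(\mathcal F)$. Two horoballs are of the same type if their densities relative to $\mathcal F$ are equal, otherwise of different type. A maximal horoball $\mathcal{B}_i^{opt}$ at an ideal vertex $A_i$ is the largest horoball centered at $A_i$ that does not extend beyond a bounding hyperplane of $\mathcal F$ not containing $A_i$. The sign $\approx$ indicates a decimal approximation accurate to within one unit of the last displayed digit. *)

theory Defs
  imports "HOL-Analysis.Analysis"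
begin

text \<open>
  \<^typ>\<open>real \<times> 'a\<close> is Lorentzian \<open>(n+1)\<close>-space, \<open>n = DIM('a)\<close>, the first component being \<open>x\<^sup>0\<close>.
  In the projective (Beltrami--Cayley--Klein) model a point \<open>v :: 'a\<close> stands for the line
  spanned by \<open>(1, v)\<close>: hyperbolic space is \<open>ball 0 1\<close>, the ideal points form \<open>sphere 0 1\<close>.
\<close>

definition lorentz :: "real \<times> 'a::euclidean_space \<Rightarrow> real \<times> 'a \<Rightarrow> real" where
  "lorentz x y = - fst x * fst y + snd x \<bullet> snd y"

abbreviation lift :: "'a \<Rightarrow> real \<times> 'a" where
  "lift v \<equiv> (1, v)"

definition hyp_dist :: "'a::euclidean_space \<Rightarrow> 'a \<Rightarrow> real" where
  "hyp_dist v w = arcosh (- lorentz (lift v) (lift w) /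
     sqrt (lorentz (lift v) (lift v) * lorentz (lift w) (lift w)))"

definition hyp_ball :: "'a::euclidean_space \<Rightarrow> real \<Rightarrow> 'a set" where
  "hyp_ball c r = {v \<in> ball 0 1. hyp_dist c v \<le> r}"

text \<open>
  The horoball centred at the ideal point \<open>p\<close> with size \<open>r > 0\<close>: on a point \<open>x\<close> of the
  hyperboloid \<open>\<langle>x,x\<rangle> = -1\<close>, \<open>x\<^sup>0 > 0\<close>, the Busemann function at \<open>p\<close> is \<open>ln (- \<langle>x, (1,p)\<rangle>)\<close>
  (normalised to vanish at the origin of the model),
  and the horoball is its sublevel set at \<open>ln r\<close>. It grows with \<open>r\<close>.
\<close>

definition horoball :: "'a::euclidean_space \<Rightarrow> real \<Rightarrow> 'a set" where
  "horoball p r = {v \<in> ball 0 1.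
     - lorentz (lift v) (lift p) / sqrt (- lorentz (lift v) (lift v)) \<le> r}"

text \<open>Riemannian volume of curvature \<open>-1\<close>, expressed in the coordinates of the projective model.\<close>

definition hyp_measure :: "'a::euclidean_space measure" where
  "hyp_measure = density lborel (\<lambda>v. indicator (ball 0 1) v *
     ennreal ((1 - (norm v)\<^sup>2) powr (- (real DIM('a) + 1) / 2)))"

definition hyp_vol :: "'a::euclidean_space set \<Rightarrow> real" where
  "hyp_vol S = measure hyp_measure S"

text \<open>
  The list \<open>m = [m\<^sub>1, \<dots>, m\<^sub>n]\<close> represents the symbol \<open>{m\<^sub>1, \<dots>, m\<^sub>n, \<infinity>}\<close>. The Gram matrix determines
  the normals \<open>b 0, \<dots>, b (n+1)\<close> up to a Lorentz transformation, hence in particular only up to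
  a common sign; the last condition (the polytope has an interior point, lying on the
  negative side of all the hyperplanes) says that the normals are the outward ones.
\<close>

definition truncated_orthoscheme :: "nat list \<Rightarrow> (nat \<Rightarrow> real \<times> 'a::euclidean_space) \<Rightarrow> bool" where
  "truncated_orthoscheme m b \<longleftrightarrow> (let n = DIM('a) in
     length m = n \<and>
     (\<forall>i\<le>n + 1. lorentz (b i) (b i) = 1) \<and>
     (\<forall>i\<in>{1..n}. lorentz (b (i - 1)) (b i) = - cos (pi / real (m ! (i - 1)))) \<and>
     lorentz (b n) (b (n + 1)) = - 1 \<and>
     (\<forall>i\<le>n + 1. \<forall>j\<le>n + 1. i + 2 \<le> j \<longrightarrow> lorentz (b i) (b j) = 0) \<and>
     (\<exists>v\<in>ball 0 1. \<forall>i\<le>n + 1. lorentz (lift v) (b i) < 0))"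

definition polytope_of :: "(nat \<Rightarrow> real \<times> 'a::euclidean_space) \<Rightarrow> 'a set" where
  "polytope_of b = {v \<in> cball 0 1. \<forall>i\<le>DIM('a) + 1. lorentz (lift v) (b i) \<le> 0}"

definition ideal_vertices :: "(nat \<Rightarrow> real \<times> 'a::euclidean_space) \<Rightarrow> 'a set" where
  "ideal_vertices b = {v. v extreme_point_of polytope_of b \<and> norm v = 1}"

text \<open>The point \<open>A\<^sub>i\<close>, for those \<open>i\<close> for which it is a proper or ideal point (so not for \<open>i = n\<close>).\<close>

definition orthoscheme_vertex :: "(nat \<Rightarrow> real \<times> 'a::euclidean_space) \<Rightarrow> nat \<Rightarrow> 'a" where
  "orthoscheme_vertex b i =
     (THE v. v \<in> cball 0 1 \<and> (\<forall>j\<le>DIM('a). j \<noteq> i \<longrightarrow> lorentz (lift v) (b j) = 0))"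

definition lorentz_reflection :: "real \<times> 'a::euclidean_space \<Rightarrow> real \<times> 'a \<Rightarrow> real \<times> 'a" where
  "lorentz_reflection u x = x - (2 * lorentz x u) *\<^sub>R u"

text \<open>The generators are involutions, so no inverses are needed.\<close>

inductive_set reflection_group ::
    "(nat \<Rightarrow> real \<times> 'a::euclidean_space) \<Rightarrow> (real \<times> 'a \<Rightarrow> real \<times> 'a) set"
  for b :: "nat \<Rightarrow> real \<times> 'a" where
  id: "id \<in> reflection_group b"
| step: "g \<in> reflection_group b \<Longrightarrow> i \<le> DIM('a) + 1 \<Longrightarrow>
    lorentz_reflection (b i) \<circ> g \<in> reflection_group b"

definition klein_action :: "(real \<times> 'a::euclidean_space \<Rightarrow> real \<times> 'a) \<Rightarrow> 'a \<Rightarrow> 'a" where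
  "klein_action g v = (1 / fst (g (lift v))) *\<^sub>R snd (g (lift v))"

text \<open>
  The images of the ball do not overlap, since the images of the polytope form a tiling.
\<close>

definition ball_packing ::
    "(nat \<Rightarrow> real \<times> 'a::euclidean_space) \<Rightarrow> 'a \<Rightarrow> real \<Rightarrow> bool" where
  "ball_packing b c r \<longleftrightarrow> c \<in> ball 0 1 \<and> 0 < r \<and> hyp_ball c r \<subseteq> polytope_of b"

definition ball_packing_density ::
    "(nat \<Rightarrow> real \<times> 'a::euclidean_space) \<Rightarrow> 'a \<Rightarrow> real \<Rightarrow> real" where
  "ball_packing_density b c r = hyp_vol (hyp_ball c r) / hyp_vol (polytope_of b)"

definition admissible_horoball ::
    "(nat \<Rightarrow> real \<times> 'a::euclidean_space) \<Rightarrow> 'a \<Rightarrow> real \<Rightarrow> bool" where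
  "admissible_horoball b p r \<longleftrightarrow> 0 < r \<and>
     (\<forall>i\<le>DIM('a) + 1. lorentz (lift p) (b i) \<noteq> 0 \<longrightarrow>
        (\<forall>v\<in>horoball p r. lorentz (lift v) (b i) \<le> 0))"

definition maximal_horoball ::
    "(nat \<Rightarrow> real \<times> 'a::euclidean_space) \<Rightarrow> 'a \<Rightarrow> real \<Rightarrow> bool" where
  "maximal_horoball b p r \<longleftrightarrow> admissible_horoball b p r \<and>
     (\<forall>t. admissible_horoball b p t \<longrightarrow> horoball p t \<subseteq> horoball p r)"

text \<open>
  A family of horoballs with at most one horoball per ideal vertex is a partial function \<open>s\<close>:
  \<open>s p = Some r\<close> means that the ideal vertex \<open>p\<close> carries \<open>horoball p r\<close>.
  The non-overlapping condition concerns all the images under the group.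
\<close>

definition horoball_images ::
    "(nat \<Rightarrow> real \<times> 'a::euclidean_space) \<Rightarrow> ('a \<rightharpoonup> real) \<Rightarrow> 'a set set" where
  "horoball_images b s =
     {klein_action g ` horoball p r | g p r. g \<in> reflection_group b \<and> s p = Some r}"

definition horoball_packing ::
    "(nat \<Rightarrow> real \<times> 'a::euclidean_space) \<Rightarrow> ('a \<rightharpoonup> real) \<Rightarrow> bool" where
  "horoball_packing b s \<longleftrightarrow>
     dom s \<noteq> {} \<and> finite (dom s) \<and> dom s \<subseteq> ideal_vertices b \<and>
     (\<forall>p r. s p = Some r \<longrightarrow> admissible_horoball b p r) \<and>
     pairwise (\<lambda>X Y. interior X \<inter> interior Y = {}) (horoball_images b s)"

definition relative_density ::
    "(nat \<Rightarrow> real \<times> 'a::euclidean_space) \<Rightarrow> 'a \<Rightarrow> real \<Rightarrow> real" where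
  "relative_density b p r = hyp_vol (horoball p r \<inter> polytope_of b) / hyp_vol (polytope_of b)"

definition horoball_packing_density ::
    "(nat \<Rightarrow> real \<times> 'a::euclidean_space) \<Rightarrow> ('a \<rightharpoonup> real) \<Rightarrow> real" where
  "horoball_packing_density b s = (\<Sum>p\<in>dom s. relative_density b p (the (s p)))"

text \<open>Two horoballs are of the same type iff their relative densities agree.\<close>

definition horoball_types ::
    "(nat \<Rightarrow> real \<times> 'a::euclidean_space) \<Rightarrow> ('a \<rightharpoonup> real) \<Rightarrow> nat" where
  "horoball_types b s = card ((\<lambda>p. relative_density b p (the (s p))) ` dom s)"

text \<open>The two maximal horoballs at \<open>A\<^sub>0\<close> and \<open>A\<^sub>3\<close>.\<close>

definition optimal_configuration ::
    "(nat \<Rightarrow> real \<times> 'a::euclidean_space) \<Rightarrow> ('a \<rightharpoonup> real) \<Rightarrow> bool" where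
  "optimal_configuration b s \<longleftrightarrow>
     dom s = {orthoscheme_vertex b 0, orthoscheme_vertex b 3} \<and>
     (\<forall>p r. s p = Some r \<longrightarrow> maximal_horoball b p r)"

definition symbols4 :: "nat list set" where
  "symbols4 = {[4,4,3,3], [4,4,3,4], [6,3,3,3], [6,3,3,4], [6,3,3,5], [6,3,4,3]}"

end

theory Submission
  imports Defs
begin

text \<open>
  In the upper half-space model with the ideal vertex \<open>A\<^sub>3\<close> at infinity the walls through \<open>A\<^sub>3\<close> are vertical: \<open>H\<^sup>0, H\<^sup>1, H\<^sup>2\<close>
  bound a right triangle with legs \<open>c = cos (\<pi>/m\<^sub>3)\<close> and \<open>c tan (\<pi>/m\<^sub>1)\<close>, and the parallel walls \<open>H\<^sup>4, H\<^sup>5\<close> bound a slab of width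
  \<open>L = cos (\<pi>/m\<^sub>4)\<close>. The one remaining wall \<open>H\<^sup>3\<close> is a hemisphere of radius 1 about a vertex of this prism. So the polytope is
  the part of a vertical prism above the unit hemisphere, and its volume is the integral of \<open>(1 - |p|\<^sup>2) powr (-3/2) / 3\<close> over
  the base. The maximal horoball at \<open>A\<^sub>3\<close> is the part above height 1, of volume \<open>|base| / 3\<close>. Its density is therefore the
  reciprocal of a mean value of the convex function \<open>(1 - |p|\<^sup>2) powr (-3/2)\<close>, and since the mean of \<open>|p|\<^sup>2\<close> is at least
  \<open>2/9\<close> for all six symbols, it is at most \<open>(7/9) powr (3/2) < 0.69\<close> (\<open>relative_density_bound\<close>). A ball inside the polytope has at most
  the volume of this horoball (\<open>ball_volume_bound\<close>), so the same bound holds for ball packings.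

  For five of the symbols \<open>A\<^sub>3\<close> is the only ideal vertex. For \<open>{4,4,3,4,\<infinity>}\<close> the far corner of the prism lies on the unit sphere
  and is the second ideal vertex \<open>A\<^sub>0\<close>. There the volume integral can be evaluated: it is \<open>\<pi>\<^sup>2 / 144\<close>
  (\<open>nn_integral_prism_ideal_corner\<close>), by reduction to an arctangent integral that yields to integration over a parameter. Seen from \<open>A\<^sub>0\<close> the base is
  the fundamental simplex of the cubic tessellation. The maximal horoballs at \<open>A\<^sub>3\<close> and \<open>A\<^sub>0\<close> contribute the volumes \<open>sqrt 2 / 48\<close>
  and \<open>sqrt 2 / 72\<close>, which add up to the density \<open>5 sqrt 2 / \<pi>\<^sup>2\<close>. Every admissible horoball is contained in the maximal one
  with the same centre, so no family does better, and equality forces both to be maximal (\<open>horoball_packing_density_le\<close>).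

  That the images of the two maximal horoballs do not overlap is a matter of arithmetic. After rescaling by 1 or \<open>sqrt 2\<close> the
  normals span a lattice with integral inner products that the reflections preserve, and the two horoballs correspond to \<open>sqrt 2\<close>
  times primitive null vectors of this lattice. Two images of these vectors either coincide or have a negative integral inner product, and
  horoballs given by null vectors \<open>m\<close>, \<open>n\<close> have disjoint interiors as soon as \<open>\<langle>m, n\<rangle> \<le> -2\<close> (\<open>cusp_horoballs_disjoint\<close>).

  To compute hyperbolic volumes in such coordinates, the volume of a set is written as Lebesgue measure of a truncated cone in
  Lorentzian space. A change of frame acts linearly on cones, with a determinant that the Gram matrix of the frame determines
  (\<open>nn_integral_vec_at\<close>, \<open>emeasure_half_space\<close>).
\<close>

section \<open>Lebesgue measure under linear maps\<close>

text \<open>Such a map relabels coordinates, so the preimage of a box is a box with the same edge lengths.\<close>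
lemma lborel_distr_basis_bij:
  fixes T :: "'a::euclidean_space \<Rightarrow> 'b::euclidean_space"
  assumes T: "linear T" and bij: "bij_betw T Basis Basis"
  shows "distr lborel borel T = lborel"
proof (rule lborel_eqI[symmetric])
  have cont[measurable]: "T \<in> borel_measurable borel"
    using T by (simp add: borel_measurable_continuous_onI linear_continuous_on linear_conv_bounded_linear)
  have inner: "T x \<bullet> T b = x \<bullet> b" if b: "b \<in> Basis" for x b
  proof -
    have "T x = (\<Sum>i\<in>Basis. (x \<bullet> i) *\<^sub>R T i)"
      by (subst euclidean_representation[of x, symmetric], subst linear_sum[OF T])
         (simp add: linear_scale[OF T] o_def)
    then have "T x \<bullet> T b = (\<Sum>i\<in>Basis. (x \<bullet> i) * (T i \<bullet> T b))"
      by (simp add: inner_sum_left)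
    also have "\<dots> = (\<Sum>i\<in>Basis. (x \<bullet> i) * (if i = b then 1 else 0))"
    proof (rule sum.cong)
      fix i assume i: "i \<in> (Basis::'a set)"
      have "T i \<in> Basis" "T b \<in> Basis" using bij i b by (auto simp: bij_betw_def)
      moreover have "T i = T b \<longleftrightarrow> i = b"
        using bij i b by (auto simp: bij_betw_def inj_on_def)
      ultimately show "(x \<bullet> i) * (T i \<bullet> T b) = (x \<bullet> i) * (if i = b then 1 else 0)"
        by (simp add: inner_Basis)
    qed simp
    finally show ?thesis using b by (simp add: sum.delta mult_delta_right)
  qed
  fix l u :: 'b assume le: "\<And>b. b \<in> Basis \<Longrightarrow> l \<bullet> b \<le> u \<bullet> b"
  define l' where "l' = (\<Sum>b\<in>Basis. (l \<bullet> T b) *\<^sub>R (b::'a))"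
  define u' where "u' = (\<Sum>b\<in>Basis. (u \<bullet> T b) *\<^sub>R (b::'a))"
  have l': "l' \<bullet> b = l \<bullet> T b" and u': "u' \<bullet> b = u \<bullet> T b" if "b \<in> Basis" for b
    using that by (simp_all add: l'_def u'_def)
  have B: "Basis = T ` Basis" using bij by (simp add: bij_betw_def)
  have "T -` box l u = box l' u'"
    by (auto simp: box_def l' u' inner) (subst (asm) B, auto simp: inner l' u')+
  then have "emeasure (distr lborel borel T) (box l u) = emeasure lborel (box l' u')"
    by (simp add: emeasure_distr)
  also have "\<dots> = (\<Prod>b\<in>Basis. (u' - l') \<bullet> b)"
    by (rule emeasure_lborel_box) (use B le l' u' in auto)
  also have "(\<Prod>b\<in>Basis. (u' - l') \<bullet> b) = (\<Prod>b\<in>Basis. (u - l) \<bullet> T b)"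
    by (rule prod.cong) (simp_all add: inner_diff_left l' u')
  also have "\<dots> = (\<Prod>b\<in>Basis. (u - l) \<bullet> b)"
    using bij prod.reindex_bij_betw by blast
  finally show "emeasure (distr lborel borel T) (box l u) = (\<Prod>b\<in>Basis. (u - l) \<bullet> b)" .
qed simp

text \<open>
  Boxes determine Lebesgue measure, and the preimage of a box under an invertible map is an image under its inverse,
  whose measure the determinant controls.
\<close>
lemma nn_integral_linear_det:
  fixes f :: "real^'n::{finite,wellorder} \<Rightarrow> real^'n::_"
  assumes f: "linear f" and d: "det (matrix f) \<noteq> 0" and g: "g \<in> borel_measurable borel"
  shows "(\<integral>\<^sup>+x. g x \<partial>lborel) = ennreal \<bar>det (matrix f)\<bar> * (\<integral>\<^sup>+x. g (f x) \<partial>lborel)"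
proof -
  have fm[measurable]: "f \<in> borel_measurable borel"
    using f by (simp add: borel_measurable_continuous_onI linear_continuous_on linear_conv_bounded_linear)
  obtain h where h: "linear h" "\<And>x. h (f x) = x" "\<And>x. f (h x) = x"
    using f d by (metis det_nz_iff_inj linear_injective_isomorphism)
  have "lborel = density (distr lborel borel f) (\<lambda>_. ennreal \<bar>det (matrix f)\<bar>)"
  proof (rule lborel_eqI)
    fix l u :: "(real,'n) vec" assume le: "\<And>b. b \<in> Basis \<Longrightarrow> l \<bullet> b \<le> u \<bullet> b"
    have vim: "f -` box l u = h ` box l u"
      using h by (metis (no_types, opaque_lifting) image_eqI set_eq_iff vimage_eq imageE)
    have lm: "f -` box l u \<in> lmeasurable"
      unfolding vim by (rule measurable_linear_image[OF h(1)]) simp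
    have fin: "emeasure lborel (f -` box l u) = ennreal (measure lebesgue (f -` box l u))"
    proof -
      have "f -` box l u \<in> sets borel" using fm by (rule measurable_sets_borel) simp
      then have "emeasure lborel (f -` box l u) = emeasure lebesgue (f -` box l u)" by simp
      then show ?thesis using emeasure_eq_measure2[OF lm] by simp
    qed
    have img: "f ` (f -` box l u) = box l u" using h by (metis surj_def surj_image_vimage_eq)
    have "measure lebesgue (box l u) = \<bar>det (matrix f)\<bar> * measure lebesgue (f -` box l u)"
      using measure_linear_image[OF f lm] img by simp
    moreover have "emeasure (density (distr lborel borel f) (\<lambda>_. ennreal \<bar>det (matrix f)\<bar>)) (box l u)
       = ennreal \<bar>det (matrix f)\<bar> * emeasure lborel (f -` box l u)"
      by (simp add: emeasure_density nn_integral_cmult emeasure_distr)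
    ultimately have "emeasure (density (distr lborel borel f) (\<lambda>_. ennreal \<bar>det (matrix f)\<bar>)) (box l u)
       = ennreal (measure lebesgue (box l u))" 
      by (simp add: fin ennreal_mult)
    also have "measure lebesgue (box l u) = (\<Prod>b\<in>Basis. (u - l) \<bullet> b)"
      using le by (simp add: measure_lborel_box)
    finally show "emeasure (density (distr lborel borel f) (\<lambda>_. ennreal \<bar>det (matrix f)\<bar>)) (box l u)
       = ennreal (\<Prod>b\<in>Basis. (u - l) \<bullet> b)" .
  qed simp
  then have "(\<integral>\<^sup>+x. g x \<partial>lborel) = (\<integral>\<^sup>+x. g x \<partial>density (distr lborel borel f) (\<lambda>_. ennreal \<bar>det (matrix f)\<bar>))"
    by simp
  also have "\<dots> = ennreal \<bar>det (matrix f)\<bar> * (\<integral>\<^sup>+x. g (f x) \<partial>lborel)"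
    using g by (simp add: nn_integral_density nn_integral_distr nn_integral_cmult)
  finally show ?thesis .
qed

lemma exhaust_5: "x = 1 \<or> x = 2 \<or> x = 3 \<or> x = 4 \<or> x = 5" for x :: 5
proof (induct x)
  case (of_int z)
  then have "0 \<le> z" and "z < 5" by simp_all
  then have "z = 0 \<or> z = 1 \<or> z = 2 \<or> z = 3 \<or> z = 4" by arith
  then show ?case by auto
qed

lemma UNIV_5: "UNIV = {1, 2, 3, 4, 5::5}" using exhaust_5 by auto
lemma forall_5: "(\<forall>i::5. P i) \<longleftrightarrow> P 1 \<and> P 2 \<and> P 3 \<and> P 4 \<and> P 5" by (metis exhaust_5)
lemma sum_5: "sum f (UNIV::5 set) = f 1 + f 2 + f 3 + f 4 + f 5"
  unfolding UNIV_5 by (simp add: ac_simps)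

section \<open>Frames of Lorentzian space\<close>

lemma bij_betw_Basis:
  fixes T :: "'a::euclidean_space \<Rightarrow> 'b::euclidean_space"
  assumes "inj_on T Basis" "T ` Basis \<subseteq> Basis" "DIM('a) = DIM('b)"
  shows "bij_betw T Basis Basis"
  using assms by (simp add: bij_betw_def card_image card_subset_eq)

lemma lorentz_linear:
  "lorentz (x + y) z = lorentz x z + lorentz y z"
  "lorentz z (x + y) = lorentz z x + lorentz z y"
  "lorentz (x - y) z = lorentz x z - lorentz y z"
  "lorentz z (x - y) = lorentz z x - lorentz z y"
  "lorentz (- x) z = - lorentz x z"
  "lorentz z (- x) = - lorentz z x"
  "lorentz (a *\<^sub>R x) z = a * lorentz x z"
  "lorentz z (a *\<^sub>R x) = a * lorentz z x"
  "lorentz 0 z = 0"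
  "lorentz z 0 = 0"
  by (simp_all add: lorentz_def algebra_simps inner_simps)

lemma lorentz_commute: "lorentz x y = lorentz y x"
  by (simp add: lorentz_def algebra_simps inner_commute)

text \<open>
  Pairing \<open>x\<close> with its image under the time reversal \<open>(x\<^sup>0, v) \<mapsto> (-x\<^sup>0,
  v)\<close> gives its Euclidean norm.
\<close>
lemma lorentz_nondegenerate:
  assumes "\<And>y. lorentz x y = 0" shows "x = 0"
proof -
  have "lorentz x (- fst x, snd x) = 0" by (rule assms)
  then have "(fst x)\<^sup>2 + snd x \<bullet> snd x = 0" by (simp add: lorentz_def power2_eq_square)
  then have "fst x = 0 \<and> snd x = 0"
    by (metis add_nonneg_eq_0_iff inner_eq_zero_iff inner_ge_zero power2_eq_iff_nonneg zero_le_power2 zero_eq_power2)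
  then show ?thesis by (simp add: prod_eq_iff)
qed

definition minkowski_of_vec :: "real^5 \<Rightarrow> real \<times> (real^4)" where
  "minkowski_of_vec a = (a $ 1, \<chi> i. a $ (if i = 1 then 2 else if i = 2 then 3 else if i = 3 then 4 else 5))"

definition vec_of_minkowski :: "real \<times> (real^4) \<Rightarrow> real^5" where
  "vec_of_minkowski x = (\<chi> i. if i = 1 then fst x else if i = 2 then snd x $ 1 else if i = 3 then snd x $ 2
     else if i = 4 then snd x $ 3 else snd x $ 4)"

definition tuple_of_vec :: "real^5 \<Rightarrow> real \<times> real \<times> real \<times> real \<times> real" where
  "tuple_of_vec a = (a $ 1, a $ 2, a $ 3, a $ 4, a $ 5)"

lemma vec_minkowski_inverse:
  "vec_of_minkowski (minkowski_of_vec a) = a" "minkowski_of_vec (vec_of_minkowski x) = x"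
  by (auto simp: vec_of_minkowski_def minkowski_of_vec_def vec_eq_iff forall_5 forall_4 prod_eq_iff)

lemma linear_minkowski_of_vec: "linear minkowski_of_vec"
  by (rule linearI) (auto simp: minkowski_of_vec_def vec_eq_iff)

lemma linear_vec_of_minkowski: "linear vec_of_minkowski"
  by (rule linearI) (auto simp: vec_of_minkowski_def vec_eq_iff)

lemma linear_tuple_of_vec: "linear tuple_of_vec"
  by (rule linearI) (auto simp: tuple_of_vec_def)

lemma distr_minkowski_of_vec: "distr lborel borel minkowski_of_vec = lborel"
proof (intro lborel_distr_basis_bij linear_minkowski_of_vec bij_betw_Basis)
  show "inj_on minkowski_of_vec Basis" by (metis inj_onI vec_minkowski_inverse(1))
  have "minkowski_of_vec (axis i 1) \<in> Basis" for i
  proof -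
    have "minkowski_of_vec (axis 1 1) = (1, 0)" "minkowski_of_vec (axis 2 1) = (0, axis 1 1)"
      "minkowski_of_vec (axis 3 1) = (0, axis 2 1)" "minkowski_of_vec (axis 4 1) = (0, axis 3 1)"
      "minkowski_of_vec (axis 5 1) = (0, axis 4 1)"
      by (auto simp: minkowski_of_vec_def vec_eq_iff forall_4 axis_def)
    then show ?thesis using exhaust_5[of i] by (auto simp: Basis_prod_def Basis_vec_def)
  qed
  then show "minkowski_of_vec ` Basis \<subseteq> Basis" by (auto simp: Basis_vec_def)
qed simp

lemma distr_tuple_of_vec: "distr lborel borel tuple_of_vec = lborel"
proof (intro lborel_distr_basis_bij linear_tuple_of_vec bij_betw_Basis)
  show "inj_on tuple_of_vec Basis" by (auto simp: inj_on_def tuple_of_vec_def vec_eq_iff forall_5)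
  have "tuple_of_vec (axis i 1) \<in> Basis" for i
    using exhaust_5[of i] by (auto simp: Basis_prod_def tuple_of_vec_def axis_def zero_prod_def)
  then show "tuple_of_vec ` Basis \<subseteq> Basis" by (auto simp: Basis_vec_def)
qed simp

lemma lorentz_minkowski_of_vec:
  "lorentz (minkowski_of_vec a) (minkowski_of_vec b) = a \<bullet> (matrix (\<lambda>w. \<chi> i. if i = 1 then - w $ 1 else w $ i) *v b)"
proof -
  have l: "linear (\<lambda>w::real^5. \<chi> i. if i = 1 then - w $ 1 else w $ i)"
    by (rule linearI) (auto simp: vec_eq_iff)
  show ?thesis unfolding matrix_works[OF linear_matrix_vector_mul_eq[THEN iffD2, OF l]]
    by (simp add: lorentz_def minkowski_of_vec_def inner_vec_def sum_5 sum_4)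
qed

text \<open>
  Coordinates on Lorentzian space adapted to a point at infinity: the direction of the null vector \<open>N\<close> is
  the point at infinity of the upper half-space model, \<open>E\<close> is the origin of its boundary, and the
  \<open>F\<^sub>i\<close> are orthonormal horizontal directions. The value \<open>\<langle>E, N\<rangle> =
  -1/2\<close> turns the quadratic form into \<open>x\<^sup>2 + y\<^sup>2 + z\<^sup>2 - \<alpha> \<beta>\<close>.
\<close>
locale half_space_frame =
  fixes E F\<^sub>1 F\<^sub>2 F\<^sub>3 N :: "real \<times> (real^4)"
  assumes gram: "lorentz E E = 0" "lorentz N N = 0" "lorentz E N = -1/2"
    "lorentz F\<^sub>1 F\<^sub>1 = 1" "lorentz F\<^sub>2 F\<^sub>2 = 1" "lorentz F\<^sub>3 F\<^sub>3 = 1"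
    "lorentz F\<^sub>1 F\<^sub>2 = 0" "lorentz F\<^sub>1 F\<^sub>3 = 0" "lorentz F\<^sub>2 F\<^sub>3 = 0"
    "lorentz E F\<^sub>1 = 0" "lorentz E F\<^sub>2 = 0" "lorentz E F\<^sub>3 = 0"
    "lorentz N F\<^sub>1 = 0" "lorentz N F\<^sub>2 = 0" "lorentz N F\<^sub>3 = 0"
    and future: "fst N > 0"
begin

lemmas gram' = gram gram[THEN trans[OF lorentz_commute]]

definition vec_at :: "real \<times> real \<times> real \<times> real \<times> real \<Rightarrow> real \<times> (real^4)" where
  "vec_at = (\<lambda>(\<alpha>, x, y, z, \<beta>). \<alpha> *\<^sub>R E + x *\<^sub>R F\<^sub>1 + y *\<^sub>R F\<^sub>2 + z *\<^sub>R F\<^sub>3 + \<beta> *\<^sub>R N)"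

lemma lorentz_vec_at:
  "lorentz (vec_at (\<alpha>, x, y, z, \<beta>)) (vec_at (\<alpha>', x', y', z', \<beta>')) =
     x * x' + y * y' + z * z' - (\<alpha> * \<beta>' + \<alpha>' * \<beta>) / 2"
  by (simp add: vec_at_def lorentz_linear gram') (simp add: algebra_simps)

lemma linear_vec_at: "linear vec_at"
  by (rule linearI) (auto simp: vec_at_def algebra_simps split: prod.splits)

lemma vec_at_measurable[measurable]: "vec_at \<in> borel_measurable borel"
  using linear_vec_at by (simp add: borel_measurable_continuous_onI linear_continuous_on linear_conv_bounded_linear)

text \<open>
  If \<open>M\<close> is the matrix of the frame and \<open>J\<close>, \<open>G\<close> are the Gram matrices of the
  standard basis and of the frame, then \<open>M\<^sup>T J M = G\<close>. Since \<open>J\<^sup>2\<close> and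
  \<open>G\<^sup>2\<close> are diagonal, this yields \<open>|det M| = 1/2\<close> without expanding a determinant.
\<close>
lemma nn_integral_vec_at:
  assumes [measurable]: "g \<in> borel_measurable borel"
  shows "(\<integral>\<^sup>+x. g x \<partial>lborel) = ennreal (1/2) * (\<integral>\<^sup>+a. g (vec_at a) \<partial>lborel)"
    and "surj vec_at"
proof -
  define f where "f = vec_of_minkowski \<circ> vec_at \<circ> tuple_of_vec"
  have lf: "linear f" unfolding f_def
    by (intro linear_compose linear_vec_of_minkowski linear_vec_at linear_tuple_of_vec)
  have mf: "minkowski_of_vec (f w) = vec_at (tuple_of_vec w)" for w
    by (simp add: f_def vec_minkowski_inverse)
  define J where "J = matrix (\<lambda>w::real^5. \<chi> i. if i = 1 then - w $ 1 else w $ i)"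
  \<comment> \<open>\<open>G\<close> exchanges the two null directions up to the factor \<open>-1/2\<close>, and \<open>D\<close> is its square\<close>
  define G where "G = matrix (\<lambda>w::real^5. \<chi> i. if i = 1 then - w $ 5 / 2 else if i = 5 then - w $ 1 / 2 else w $ i)"
  define D where "D = matrix (\<lambda>w::real^5. \<chi> i. if i = 1 then w $ 1 / 4 else if i = 5 then w $ 5 / 4 else w $ i)"
  have lJ: "linear (\<lambda>w::real^5. \<chi> i. if i = 1 then - w $ 1 else w $ i)"
    and lG: "linear (\<lambda>w::real^5. \<chi> i. if i = 1 then - w $ 5 / 2 else if i = 5 then - w $ 1 / 2 else w $ i)"
    by (rule linearI; auto simp: vec_eq_iff field_simps)+
  have G: "transpose (matrix f) ** J ** matrix f = G"
  proof -
    have "x \<bullet> ((transpose (matrix f) ** J ** matrix f) *v y) = x \<bullet> (G *v y)" for x y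
    proof -
      have "x \<bullet> ((transpose (matrix f) ** J ** matrix f) *v y) = f x \<bullet> (J *v f y)"
        using dot_lmul_matrix[of "J *v f y" "matrix f" x]
        by (simp add: matrix_vector_mul_assoc[symmetric] inner_commute
            matrix_works[OF linear_matrix_vector_mul_eq[THEN iffD2, OF lf]])
      also have "\<dots> = lorentz (vec_at (tuple_of_vec x)) (vec_at (tuple_of_vec y))"
        unfolding J_def lorentz_minkowski_of_vec[symmetric] mf ..
      also have "\<dots> = x \<bullet> (G *v y)"
        unfolding G_def matrix_works[OF linear_matrix_vector_mul_eq[THEN iffD2, OF lG]]
        by (simp add: tuple_of_vec_def lorentz_vec_at inner_vec_def sum_5 field_simps)
      finally show ?thesis .
    qed
    then show ?thesis unfolding matrix_eq
      by (intro allI) (rule vector_eq_ldot[THEN iffD1], blast)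
  qed
  have GG: "G ** G = D" unfolding G_def D_def matrix_compose[OF lG lG, symmetric]
    by (rule arg_cong[of _ _ matrix]) (auto simp: fun_eq_iff vec_eq_iff)
  have JJ: "J ** J = mat 1" unfolding J_def matrix_compose[OF lJ lJ, symmetric] matrix_id_mat_1[symmetric]
    by (rule arg_cong[of _ _ matrix]) (auto simp: fun_eq_iff vec_eq_iff)
  have "det D = prod (\<lambda>i. D $ i $ i) UNIV"
    by (rule det_diagonal) (auto simp: D_def matrix_def axis_def)
  also have "\<dots> = 1/16" unfolding UNIV_5 by (simp add: D_def matrix_def axis_def)
  finally have "(det G)\<^sup>2 = 1/16" using GG by (simp add: det_mul[symmetric] power2_eq_square)
  moreover have "(det J)\<^sup>2 = 1" using JJ by (simp add: det_mul[symmetric] power2_eq_square)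
  moreover have "det G = (det (matrix f))\<^sup>2 * det J"
    unfolding G[symmetric] by (simp add: det_mul power2_eq_square)
  ultimately have "((det (matrix f))\<^sup>2)\<^sup>2 = 1/16"
    by (metis mult.right_neutral power_mult_distrib)
  then have "(det (matrix f))^4 = 1/16" by (simp flip: power_mult)
  then have "\<bar>det (matrix f)\<bar>^4 = (1/2)^4" by (simp add: power_divide)
  then have det: "\<bar>det (matrix f)\<bar> = 1/2" by (metis abs_ge_zero power_eq_imp_eq_base zero_less_numeral divide_nonneg_nonneg zero_le_numeral zero_le_one)
  have nz: "det (matrix f) \<noteq> 0" using det by auto
  have [measurable]: "minkowski_of_vec \<in> borel_measurable borel" "tuple_of_vec \<in> borel_measurable borel"
    using linear_minkowski_of_vec linear_tuple_of_vec
    by (simp_all add: borel_measurable_continuous_onI linear_continuous_on linear_conv_bounded_linear)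
  have "(\<integral>\<^sup>+x. g x \<partial>lborel) = (\<integral>\<^sup>+u. g (minkowski_of_vec u) \<partial>lborel)"
    by (subst distr_minkowski_of_vec[symmetric]) (simp add: nn_integral_distr)
  also have "\<dots> = ennreal (1/2) * (\<integral>\<^sup>+w. g (minkowski_of_vec (f w)) \<partial>lborel)"
    using nn_integral_linear_det[OF lf nz, of "\<lambda>u. g (minkowski_of_vec u)"] unfolding det by measurable
  also have "(\<integral>\<^sup>+w. g (minkowski_of_vec (f w)) \<partial>lborel) = (\<integral>\<^sup>+a. g (vec_at a) \<partial>distr lborel borel tuple_of_vec)"
    by (simp add: nn_integral_distr mf)
  finally show "(\<integral>\<^sup>+x. g x \<partial>lborel) = ennreal (1/2) * (\<integral>\<^sup>+a. g (vec_at a) \<partial>lborel)"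
    by (simp add: distr_tuple_of_vec)
  have "surj f" using det lf by (metis abs_zero det_nz_iff_inj linear_injective_imp_surjective zero_neq_one divide_eq_0_iff zero_neq_numeral)
  then show "surj vec_at" by (metis mf surj_def vec_minkowski_inverse(2))
qed

end

section \<open>Hyperbolic volume in half-space coordinates\<close>

lemma timelike_norm_less: "lorentz x x < 0 \<longleftrightarrow> norm (snd x) < \<bar>fst x\<bar>"
proof -
  have "lorentz x x < 0 \<longleftrightarrow> (norm (snd x))\<^sup>2 < (fst x)\<^sup>2"
    unfolding lorentz_def power2_norm_eq_inner by (simp add: power2_eq_square)
  then show ?thesis by (metis abs_norm_cancel power2_abs abs_le_square_iff linorder_not_le)
qed

lemma causal_norm_le: "lorentz x x \<le> 0 \<longleftrightarrow> norm (snd x) \<le> \<bar>fst x\<bar>"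
proof -
  have "lorentz x x \<le> 0 \<longleftrightarrow> (norm (snd x))\<^sup>2 \<le> (fst x)\<^sup>2"
    unfolding lorentz_def power2_norm_eq_inner by (simp add: power2_eq_square)
  then show ?thesis by (metis abs_norm_cancel power2_abs abs_le_square_iff)
qed

lemma lorentz_future_neg:
  assumes "lorentz x x < 0" "fst x > 0" "lorentz y y \<le> 0" "fst y > 0"
  shows "lorentz x y < 0"
proof -
  have "snd x \<bullet> snd y \<le> norm (snd x) * norm (snd y)" by (rule norm_cauchy_schwarz)
  also have "\<dots> \<le> norm (snd x) * fst y"
    using assms by (intro mult_left_mono) (auto simp: causal_norm_le)
  also have "\<dots> < fst x * fst y" using assms by (auto simp: timelike_norm_less)
  finally show ?thesis by (simp add: lorentz_def)
qed

text \<open>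
  The inner products with a future null or timelike vector tell the two components of the timelike cone apart.
\<close>
lemma future_iff:
  assumes "lorentz x x < 0" "lorentz y y \<le> 0" "fst y > 0"
  shows "fst x > 0 \<longleftrightarrow> lorentz x y < 0"
proof -
  have "fst x \<noteq> 0" using assms(1) by (auto simp: timelike_norm_less)
  moreover have "lorentz x y > 0" if "fst x < 0"
    using lorentz_future_neg[of "-x" y] that assms by (simp add: lorentz_linear)
  ultimately show ?thesis using lorentz_future_neg assms by (metis less_asym' linorder_neqE_linordered_idom)
qed

text \<open>
  The inverse of \<open>lift\<close> on rays: a vector of Lorentzian space is sent to the point of the projective
  model that it spans.
\<close>
definition proj :: "real \<times> 'a::real_vector \<Rightarrow> 'a" where
  "proj x = (1 / fst x) *\<^sub>R snd x"

lemma lift_proj: "fst x \<noteq> 0 \<Longrightarrow> lift (proj x) = (1 / fst x) *\<^sub>R x"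
  by (simp add: proj_def prod_eq_iff)

lemma lorentz_lift_proj: "fst x \<noteq> 0 \<Longrightarrow> lorentz (lift (proj x)) y = lorentz x y / fst x"
  by (simp add: lift_proj lorentz_linear)

lemma proj_scaleR: "c \<noteq> 0 \<Longrightarrow> proj (c *\<^sub>R x) = proj x"
  by (simp add: proj_def)

lemma proj_in_ball: "fst x > 0 \<Longrightarrow> proj x \<in> ball 0 1 \<longleftrightarrow> lorentz x x < 0"
  by (simp add: timelike_norm_less proj_def)

lemma proj_in_cball: "fst x > 0 \<Longrightarrow> proj x \<in> cball 0 1 \<longleftrightarrow> lorentz x x \<le> 0"
  by (simp add: causal_norm_le proj_def)

lemma borel_measurable_fst_snd[measurable]:
  "(fst :: 'a::topological_space \<times> 'b::topological_space \<Rightarrow> _) \<in> borel_measurable borel"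
  "(snd :: 'a \<times> 'b \<Rightarrow> _) \<in> borel_measurable borel"
  by (simp_all add: borel_measurable_continuous_onI continuous_on_fst continuous_on_snd)

lemma proj_measurable[measurable]: "(proj :: real \<times> (real^4) \<Rightarrow> _) \<in> borel_measurable borel"
  unfolding proj_def[abs_def] by measurable

lemma lorentz_measurable[measurable]:
  fixes f g :: "'b \<Rightarrow> real \<times> (real^4)"
  assumes [measurable]: "f \<in> borel_measurable M" "g \<in> borel_measurable M"
  shows "(\<lambda>x. lorentz (f x) (g x)) \<in> borel_measurable M"
  unfolding lorentz_def by measurable

lemma nn_integral_lborel_pair:
  fixes f :: "'a::euclidean_space \<times> 'b::euclidean_space \<Rightarrow> ennreal"
  assumes [measurable]: "f \<in> borel_measurable borel"
  shows "(\<integral>\<^sup>+p. f p \<partial>lborel) = (\<integral>\<^sup>+x. \<integral>\<^sup>+y. f (x, y) \<partial>lborel \<partial>lborel)"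
  by (subst lborel_prod[symmetric], subst lborel.nn_integral_fst[symmetric]) (simp_all add: lborel_prod)

text \<open>
  The radial integral of a cone in dimension five, cut off by \<open>-\<langle>x,x\<rangle> \<le> 1\<close>.
\<close>
lemma nn_integral_fourth_power_cutoff:
  fixes d :: real
  assumes d: "d > 0"
  shows "(\<integral>\<^sup>+s. ennreal (s ^ 4) * indicator {s. 0 < s \<and> s\<^sup>2 * d \<le> 1} s \<partial>lborel) = ennreal (d powr (- 5 / 2) / 5)"
proof -
  define b where "b = d powr (-1/2)"
  have b: "b > 0" "b\<^sup>2 * d = 1" using d by (simp_all add: b_def powr_power powr_minus field_simps)
  have "s\<^sup>2 * d \<le> 1 \<longleftrightarrow> s \<le> b" if s: "s > 0" for s
  proof -
    have "s\<^sup>2 * d \<le> 1 \<longleftrightarrow> s\<^sup>2 * d \<le> b\<^sup>2 * d" using b by simp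
    also have "\<dots> \<longleftrightarrow> s\<^sup>2 \<le> b\<^sup>2" using d by (rule mult_le_cancel_right_pos)
    also have "\<dots> \<longleftrightarrow> s \<le> b" using s b by (simp add: power_mono_iff)
    finally show ?thesis .
  qed
  \<comment> \<open>The endpoint \<open>s = 0\<close> can be added because the integrand vanishes there.\<close>
  then have "ennreal (s ^ 4) * indicator {s. 0 < s \<and> s\<^sup>2 * d \<le> 1} s = ennreal (s ^ 4) * indicator {0..b} s" for s
    by (cases "s = 0") (auto simp: indicator_def)
  then have "(\<integral>\<^sup>+s. ennreal (s ^ 4) * indicator {s. 0 < s \<and> s\<^sup>2 * d \<le> 1} s \<partial>lborel) = (\<integral>\<^sup>+s. ennreal (s ^ 4) * indicator {0..b} s \<partial>lborel)"
    by (intro nn_integral_cong)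
  also have "\<dots> = ennreal (b ^ 5 / 5 - 0 ^ 5 / 5)"
    by (rule nn_integral_FTC_Icc[where F = "\<lambda>s. s ^ 5 / 5"])
       (use b in \<open>auto intro!: derivative_eq_intros\<close>)
  also have "b ^ 5 / 5 - 0 ^ 5 / 5 = d powr (- 5 / 2) / 5"
    using d by (simp add: b_def powr_power)
  finally show ?thesis .
qed

text \<open>
  Over the direction \<open>v\<close> the truncated cone is the segment \<open>0 < s \<le> (1 - |v|\<^sup>2) powr
  (-1/2)\<close>, on which \<open>s\<^sup>4 ds\<close> has integral \<open>(1 - |v|\<^sup>2) powr (-5/2) / 5\<close>,
  one fifth of the hyperbolic density. Passing to cones makes a change of frame a linear map, so that hyperbolic
  volume can be computed in any frame.
\<close>
lemma emeasure_hyp_measure_cone: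
  fixes S :: "(real^4) set"
  assumes S[measurable]: "S \<in> sets borel"
  shows "emeasure hyp_measure S =
    5 * (\<integral>\<^sup>+x. indicator {x. fst x > 0 \<and> lorentz x x < 0 \<and> - 1 \<le> lorentz x x \<and> proj x \<in> S} x \<partial>lborel)"
proof -
  define I where "I = (indicator {x :: real \<times> (real^4). fst x > 0 \<and> lorentz x x < 0 \<and> - 1 \<le> lorentz x x \<and> proj x \<in> S}
     :: real \<times> (real^4) \<Rightarrow> ennreal)"
  have [measurable]: "ball 0 1 \<in> sets (borel :: (real^4) measure)" by simp
  have [measurable]: "I \<in> borel_measurable borel" unfolding I_def by measurable
  have I2[measurable]: "(\<lambda>(s,v). I (s, s *\<^sub>R v)) \<in> borel_measurable (lborel \<Otimes>\<^sub>M lborel)"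
    unfolding lborel_prod by measurable
  have "(\<integral>\<^sup>+x. I x \<partial>lborel) = (\<integral>\<^sup>+s. \<integral>\<^sup>+v. I (s, v) \<partial>lborel \<partial>lborel)"
    by (rule nn_integral_lborel_pair) measurable
  also have "\<dots> = (\<integral>\<^sup>+s. \<integral>\<^sup>+v. ennreal (s ^ 4) * I (s, s *\<^sub>R v) \<partial>lborel \<partial>lborel)"
  proof (rule nn_integral_cong)
    fix s :: real
    show "(\<integral>\<^sup>+v. I (s, v) \<partial>lborel) = (\<integral>\<^sup>+v. ennreal (s ^ 4) * I (s, s *\<^sub>R v) \<partial>lborel)"
    proof (cases "s > 0")
      case True
      have "(\<integral>\<^sup>+v. I (s, v) \<partial>lborel) = (\<integral>\<^sup>+v. I (s, v) \<partial>density (distr lborel borel (\<lambda>v. 0 + s *\<^sub>R v)) (\<lambda>_. ennreal (\<bar>s\<bar>^DIM(real^4))))"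
        using lborel_affine[of s "0::real^4"] True by simp
      also have "\<dots> = (\<integral>\<^sup>+v. ennreal (s ^ 4) * I (s, s *\<^sub>R v) \<partial>lborel)"
        using True by (simp add: nn_integral_density nn_integral_distr)
      finally show ?thesis .
    qed (simp add: I_def)
  qed
  also have "\<dots> = (\<integral>\<^sup>+v. \<integral>\<^sup>+s. ennreal (s ^ 4) * I (s, s *\<^sub>R v) \<partial>lborel \<partial>lborel)"
    by (rule lborel_pair.Fubini') (simp add: case_prod_beta', measurable)
  also have "\<dots> = (\<integral>\<^sup>+v. indicator S v * indicator (ball 0 1) v * ennreal ((1 - (norm v)\<^sup>2) powr (- 5 / 2) / 5) \<partial>lborel)"
  proof (rule nn_integral_cong)
    fix v :: "real^4"
    show "(\<integral>\<^sup>+s. ennreal (s ^ 4) * I (s, s *\<^sub>R v) \<partial>lborel)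
      = indicator S v * indicator (ball 0 1) v * ennreal ((1 - (norm v)\<^sup>2) powr (- 5 / 2) / 5)"
    proof (cases "v \<in> S \<and> norm v < 1")
      case True
      define d where "d = 1 - (norm v)\<^sup>2"
      have d: "d > 0" using True by (simp add: d_def power_less_one_iff)
      have lo: "lorentz (s, s *\<^sub>R v) (s, s *\<^sub>R v) = - (s\<^sup>2 * d)" for s
        unfolding d_def power2_norm_eq_inner by (simp add: lorentz_def power2_eq_square algebra_simps)
      have "ennreal (s ^ 4) * I (s, s *\<^sub>R v) = ennreal (s ^ 4) * indicator {s. 0 < s \<and> s\<^sup>2 * d \<le> 1} s" for s
        using True d by (auto simp: I_def lo proj_def indicator_def)
      then show ?thesis using True nn_integral_fourth_power_cutoff[OF d] by (simp add: d_def)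
    next
      case False
      have "I (s, s *\<^sub>R v) = 0" for s
        using False by (auto simp: I_def indicator_def proj_def timelike_norm_less)
      then show ?thesis using False by (auto simp: indicator_def)
    qed
  qed
  finally have eq: "(\<integral>\<^sup>+x. I x \<partial>lborel) = \<dots>" .
  have "emeasure hyp_measure S = (\<integral>\<^sup>+v. indicator (ball 0 1) v * ennreal ((1 - (norm v)\<^sup>2) powr (- 5 / 2)) * indicator S v \<partial>lborel)"
  proof -
    have "(\<lambda>v::real^4. indicator (ball 0 1) v * ennreal ((1 - (norm v)\<^sup>2) powr (- (real DIM(real^4) + 1) / 2))) \<in> borel_measurable lborel"
      by measurable
    then show ?thesis unfolding hyp_measure_def by (subst emeasure_density) simp_all
  qed
  also have "\<dots> = (\<integral>\<^sup>+v. 5 * (indicator S v * indicator (ball 0 1) v * ennreal ((1 - (norm v)\<^sup>2) powr (- 5 / 2) / 5)) \<partial>lborel)"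
  proof (rule nn_integral_cong)
    fix v :: "real^4"
    have "ennreal r = 5 * ennreal (r / 5)" if "r \<ge> 0" for r
      using ennreal_mult[of 5 "r/5"] that by simp
    from this[of "(1 - (norm v)\<^sup>2) powr (- 5 / 2)"]
    show "indicator (ball 0 1) v * ennreal ((1 - (norm v)\<^sup>2) powr (- 5 / 2)) * indicator S v
      = 5 * (indicator S v * indicator (ball 0 1) v * ennreal ((1 - (norm v)\<^sup>2) powr (- 5 / 2) / 5))"
      by (auto simp: indicator_def)
  qed
  also have "\<dots> = 5 * (\<integral>\<^sup>+x. I x \<partial>lborel)"
    unfolding eq by (rule nn_integral_cmult) measurable
  finally show ?thesis unfolding I_def .
qed

lemma nn_integral_lborel_4:
  fixes f :: "real \<times> real \<times> real \<times> real \<Rightarrow> ennreal"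
  assumes [measurable]: "f \<in> borel_measurable borel"
  shows "(\<integral>\<^sup>+p. f p \<partial>lborel) = (\<integral>\<^sup>+x. \<integral>\<^sup>+y. \<integral>\<^sup>+z. \<integral>\<^sup>+t. f (x, y, z, t) \<partial>lborel \<partial>lborel \<partial>lborel \<partial>lborel)"
  by (subst nn_integral_lborel_pair, measurable)+

text \<open>
  For fixed first coordinate \<open>a\<close>, this passes to the horizontal position \<open>(x, y, z)\<close> and the
  squared height \<open>t\<close> of the upper half-space model.
\<close>
lemma nn_integral_half_space_scaling:
  fixes f :: "real \<times> real \<times> real \<times> real \<Rightarrow> ennreal"
  assumes [measurable]: "f \<in> borel_measurable borel" and a: "a > 0"
  shows "(\<integral>\<^sup>+p. f p \<partial>lborel) =
    ennreal (a ^ 4) * (\<integral>\<^sup>+(x,y,z,t). f (a * x, a * y, a * z, a * (x\<^sup>2 + y\<^sup>2 + z\<^sup>2 + t)) \<partial>lborel)"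
proof -
  have "(\<integral>\<^sup>+p. f p \<partial>lborel) = (\<integral>\<^sup>+x. \<integral>\<^sup>+y. \<integral>\<^sup>+z. \<integral>\<^sup>+t. f (x, y, z, t) \<partial>lborel \<partial>lborel \<partial>lborel \<partial>lborel)"
    by (rule nn_integral_lborel_4) measurable
  also have "\<dots> = ennreal a * (\<integral>\<^sup>+x. \<integral>\<^sup>+y. \<integral>\<^sup>+z. \<integral>\<^sup>+t. f (a * x, y, z, t) \<partial>lborel \<partial>lborel \<partial>lborel \<partial>lborel)"
    by (subst nn_integral_real_affine[where c = a and t = 0]) (use a in auto)
  also have "\<dots> = ennreal a * (\<integral>\<^sup>+x. ennreal a * (\<integral>\<^sup>+y. \<integral>\<^sup>+z. \<integral>\<^sup>+t. f (a * x, a * y, z, t) \<partial>lborel \<partial>lborel \<partial>lborel) \<partial>lborel)"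
    by (subst nn_integral_real_affine[where c = a and t = 0]) (use a in auto)
  also have "\<dots> = ennreal a * (\<integral>\<^sup>+x. ennreal a * (\<integral>\<^sup>+y. ennreal a * (\<integral>\<^sup>+z. \<integral>\<^sup>+t. f (a * x, a * y, a * z, t) \<partial>lborel \<partial>lborel) \<partial>lborel) \<partial>lborel)"
    by (subst nn_integral_real_affine[where c = a and t = 0]) (use a in auto)
  also have "\<dots> = ennreal a * (\<integral>\<^sup>+x. ennreal a * (\<integral>\<^sup>+y. ennreal a * (\<integral>\<^sup>+z. ennreal a * (\<integral>\<^sup>+t. f (a * x, a * y, a * z, a * (x\<^sup>2 + y\<^sup>2 + z\<^sup>2 + t)) \<partial>lborel) \<partial>lborel) \<partial>lborel) \<partial>lborel)"
  proof -
    have "(\<integral>\<^sup>+t. f (a * x, a * y, a * z, t) \<partial>lborel) = ennreal a * (\<integral>\<^sup>+t. f (a * x, a * y, a * z, a * (x\<^sup>2 + y\<^sup>2 + z\<^sup>2 + t)) \<partial>lborel)" for x y z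
      by (subst nn_integral_real_affine[where c = a and t = "a * (x\<^sup>2 + y\<^sup>2 + z\<^sup>2)"]) (use a in \<open>auto simp: distrib_left\<close>)
    then show ?thesis by simp
  qed
  also have "\<dots> = ennreal a * (ennreal a * (ennreal a * (ennreal a * (\<integral>\<^sup>+x. \<integral>\<^sup>+y. \<integral>\<^sup>+z. \<integral>\<^sup>+t. f (a * x, a * y, a * z, a * (x\<^sup>2 + y\<^sup>2 + z\<^sup>2 + t)) \<partial>lborel \<partial>lborel \<partial>lborel \<partial>lborel))))"
    by (simp add: nn_integral_cmult)
  also have "\<dots> = ennreal (a ^ 4) * (\<integral>\<^sup>+(x,y,z,t). f (a * x, a * y, a * z, a * (x\<^sup>2 + y\<^sup>2 + z\<^sup>2 + t)) \<partial>lborel)"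
    using a by (subst nn_integral_lborel_4) (simp_all add: ennreal_mult power4_eq_xxxx mult.assoc case_prod_beta')
  finally show ?thesis .
qed

context half_space_frame begin

text \<open>
  The point over \<open>(x, y, z)\<close> at height \<open>sqrt t\<close> in the upper half-space model. With the
  square of the height as coordinate the inner products with all wall normals are polynomials.
\<close>
definition point :: "real \<times> real \<times> real \<times> real \<Rightarrow> real \<times> (real^4)" where
  "point = (\<lambda>(x, y, z, t). vec_at (1, x, y, z, x\<^sup>2 + y\<^sup>2 + z\<^sup>2 + t))"

lemma point_measurable[measurable]: "point \<in> borel_measurable borel"
  unfolding point_def by measurable

lemma lorentz_point: "lorentz (point (x, y, z, t)) (point (x', y', z', t'))
    = - ((x - x')\<^sup>2 + (y - y')\<^sup>2 + (z - z')\<^sup>2 + t + t') / 2"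
  by (simp add: point_def lorentz_vec_at power2_eq_square field_simps)

lemma lorentz_point_self: "lorentz (point (x, y, z, t)) (point (x, y, z, t)) = - t"
  by (simp add: lorentz_point)

lemma lorentz_vec_at_N: "lorentz (vec_at (a, x, y, z, b)) N = - a / 2"
  by (simp add: vec_at_def lorentz_linear gram')

lemma fst_vec_at_pos:
  assumes "lorentz (vec_at (a, x, y, z, b)) (vec_at (a, x, y, z, b)) < 0"
  shows "fst (vec_at (a, x, y, z, b)) > 0 \<longleftrightarrow> a > 0"
  using future_iff[OF assms _ future] by (simp add: gram lorentz_vec_at_N)

lemma fst_point_pos: "t > 0 \<Longrightarrow> fst (point (x, y, z, t)) > 0"
  using fst_vec_at_pos[of 1 x y z "x\<^sup>2 + y\<^sup>2 + z\<^sup>2 + t"] lorentz_point_self[of x y z t] by (simp add: point_def)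

lemma vec_at_scaled_point:
  "vec_at (a, a * x, a * y, a * z, a * (x\<^sup>2 + y\<^sup>2 + z\<^sup>2 + t)) = a *\<^sub>R point (x, y, z, t)"
  by (simp add: vec_at_def point_def algebra_simps)

text \<open>
  In terms of the height \<open>h = sqrt t\<close> the density is the familiar \<open>h powr (-4)\<close>. It arises
  by integrating the scaling factor \<open>a\<close> of \<open>nn_integral_half_space_scaling\<close> over the
  truncated cone.
\<close>
lemma emeasure_half_space:
  assumes S[measurable]: "S \<in> sets borel"
  shows "emeasure hyp_measure S = (\<integral>\<^sup>+p. ennreal ((snd (snd (snd p))) powr (- 5 / 2) / 2) *
      indicator {p. snd (snd (snd p)) > 0 \<and> proj (point p) \<in> S} p \<partial>lborel)"
proof -
  define I where "I = (indicator {x :: real \<times> (real^4). fst x > 0 \<and> lorentz x x < 0 \<and> - 1 \<le> lorentz x x \<and> proj x \<in> S}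
     :: real \<times> (real^4) \<Rightarrow> ennreal)"
  have [measurable]: "I \<in> borel_measurable borel" unfolding I_def by measurable
  have I_scaled: "I (a *\<^sub>R point p) = (if snd (snd (snd p)) > 0 \<and> a\<^sup>2 * snd (snd (snd p)) \<le> 1 \<and> proj (point p) \<in> S then 1 else 0)"
    if a: "a > 0" for a p
  proof -
    obtain x y z t where p: "p = (x, y, z, t)" by (cases p) auto
    have "lorentz (a *\<^sub>R point p) (a *\<^sub>R point p) = - (a\<^sup>2 * t)"
      by (simp add: p lorentz_linear lorentz_point_self power2_eq_square)
    then show ?thesis
      using a fst_point_pos[of t x y z] by (auto simp: I_def p indicator_def proj_scaleR zero_less_mult_iff)
  qed
  have "(\<integral>\<^sup>+a. I (vec_at a) \<partial>lborel) = (\<integral>\<^sup>+a. \<integral>\<^sup>+p. I (vec_at (a, p)) \<partial>lborel \<partial>lborel)"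
    by (rule nn_integral_lborel_pair) measurable
  also have "\<dots> = (\<integral>\<^sup>+a. \<integral>\<^sup>+p. indicator {0<..} a * ennreal (a ^ 4) * I (a *\<^sub>R point p) \<partial>lborel \<partial>lborel)"
  proof (rule nn_integral_cong)
    fix a :: real
    show "(\<integral>\<^sup>+p. I (vec_at (a, p)) \<partial>lborel) = (\<integral>\<^sup>+p. indicator {0<..} a * ennreal (a ^ 4) * I (a *\<^sub>R point p) \<partial>lborel)"
    proof (cases "a > 0")
      case True
      have "(\<integral>\<^sup>+p. I (vec_at (a, p)) \<partial>lborel) = ennreal (a ^ 4) * (\<integral>\<^sup>+p. I (a *\<^sub>R point p) \<partial>lborel)"
        by (subst nn_integral_half_space_scaling[OF _ True])
           (simp_all add: vec_at_scaled_point case_prod_unfold)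
      then show ?thesis using True by (simp add: nn_integral_cmult)
    next
      case False
      have "I (vec_at (a, p)) = 0" for p
        using False fst_vec_at_pos by (cases p) (auto simp: I_def indicator_def)
      then show ?thesis using False by simp
    qed
  qed
  also have "\<dots> = (\<integral>\<^sup>+p. \<integral>\<^sup>+a. indicator {0<..} a * ennreal (a ^ 4) * I (a *\<^sub>R point p) \<partial>lborel \<partial>lborel)"
    by (rule lborel_pair.Fubini') (simp add: case_prod_beta' lborel_prod, measurable)
  also have "\<dots> = (\<integral>\<^sup>+p. ennreal ((snd (snd (snd p))) powr (- 5 / 2) / 5) *
      indicator {p. snd (snd (snd p)) > 0 \<and> proj (point p) \<in> S} p \<partial>lborel)"
  proof (rule nn_integral_cong)
    fix p :: "real \<times> real \<times> real \<times> real"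
    define t where "t = snd (snd (snd p))"
    show "(\<integral>\<^sup>+a. indicator {0<..} a * ennreal (a ^ 4) * I (a *\<^sub>R point p) \<partial>lborel)
      = ennreal ((snd (snd (snd p))) powr (- 5 / 2) / 5) *
      indicator {p. snd (snd (snd p)) > 0 \<and> proj (point p) \<in> S} p"
    proof (cases "t > 0 \<and> proj (point p) \<in> S")
      case True
      have "indicator {0<..} a * ennreal (a ^ 4) * I (a *\<^sub>R point p) = ennreal (a ^ 4) * indicator {s. 0 < s \<and> s\<^sup>2 * t \<le> 1} a" for a
        using True by (cases "a > 0") (auto simp: I_scaled t_def[symmetric] indicator_def)
      then show ?thesis using True nn_integral_fourth_power_cutoff[of t] by (simp add: t_def)
    next
      case False
      have "indicator {0<..} a * ennreal (a ^ 4) * I (a *\<^sub>R point p) = 0" for a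
        using False by (auto simp: I_scaled t_def[symmetric] indicator_def)
      then have "(\<integral>\<^sup>+a. indicator {0<..} a * ennreal (a ^ 4) * I (a *\<^sub>R point p) \<partial>lborel) = (\<integral>\<^sup>+(a::real). 0 \<partial>lborel)"
        by (intro nn_integral_cong)
      then show ?thesis using False by (simp add: t_def)
    qed
  qed
  finally have eq: "(\<integral>\<^sup>+a. I (vec_at a) \<partial>lborel) = \<dots>" .
  have "emeasure hyp_measure S = 5 * (ennreal (1/2) * (\<integral>\<^sup>+a. I (vec_at a) \<partial>lborel))"
    by (subst nn_integral_vec_at(1)[symmetric]) (simp_all add: emeasure_hyp_measure_cone I_def)
  also have "\<dots> = ennreal (5/2) * (\<integral>\<^sup>+a. I (vec_at a) \<partial>lborel)"
    using ennreal_mult[of 5 "1/2"] by (simp add: mult.assoc[symmetric])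
  also have "\<dots> = (\<integral>\<^sup>+p. ennreal (5/2) * (ennreal ((snd (snd (snd p))) powr (- 5 / 2) / 5) *
      indicator {p. snd (snd (snd p)) > 0 \<and> proj (point p) \<in> S} p) \<partial>lborel)"
    unfolding eq by (rule nn_integral_cmult[symmetric]) measurable
  also have "\<dots> = (\<integral>\<^sup>+p. ennreal ((snd (snd (snd p))) powr (- 5 / 2) / 2) *
      indicator {p. snd (snd (snd p)) > 0 \<and> proj (point p) \<in> S} p \<partial>lborel)"
    by (rule nn_integral_cong) (simp add: mult.assoc[symmetric] ennreal_mult[symmetric])
  finally show ?thesis .
qed

end

section \<open>Integrals over the base of the polytope\<close>

lemma nn_integral_lborel_3:
  fixes f :: "real \<times> real \<times> real \<Rightarrow> ennreal"
  assumes [measurable]: "f \<in> borel_measurable borel"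
  shows "(\<integral>\<^sup>+p. f p \<partial>lborel) = (\<integral>\<^sup>+x. \<integral>\<^sup>+y. \<integral>\<^sup>+z. f (x, y, z) \<partial>lborel \<partial>lborel \<partial>lborel)"
  by (subst nn_integral_lborel_pair, measurable)+

lemma nn_integral_FTC_eq:
  fixes f F :: "real \<Rightarrow> real"
  assumes "f \<in> borel_measurable borel" "\<And>x. a \<le> x \<Longrightarrow> x \<le> b \<Longrightarrow> (F has_real_derivative f x) (at x)"
    "\<And>x. a \<le> x \<Longrightarrow> x \<le> b \<Longrightarrow> 0 \<le> f x" "a \<le> b" "F b - F a = I"
  shows "(\<integral>\<^sup>+x. ennreal (f x) * indicator {a..b} x \<partial>lborel) = ennreal I"
  using nn_integral_FTC_Icc[of f a b F] assms by auto

text \<open>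
  Once the vertex \<open>A\<^sub>3\<close> is at infinity, such a prism is the base of the polytope: \<open>k\<close>
  is the tangent of the angle \<open>\<pi> / m\<^sub>1\<close> of the triangle at the origin and \<open>h\<close> is
  the width of the slab between the parallel walls.
\<close>
definition prism :: "real \<Rightarrow> real \<Rightarrow> real \<Rightarrow> (real \<times> real \<times> real) set" where
  "prism c k h = {(x, y, z). x \<le> c \<and> 0 \<le> y \<and> y \<le> k * x \<and> 0 \<le> z \<and> z \<le> h}"

lemma prism_measurable[measurable]: "prism c k h \<in> sets borel"
  unfolding prism_def by measurable

lemma indicator_prism:
  "k > 0 \<Longrightarrow> indicator (prism c k h) (x, y, z) = (indicator {0..h} z * indicator {0..k * x} y * indicator {0..c} x :: ennreal)"
  by (auto simp: prism_def indicator_def zero_le_mult_iff dest: order_trans)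

text \<open>
  This yields the Euclidean volume of the prism and the mean of the squared distance from the origin, which enters the
  convexity estimate of the hyperbolic volume.
\<close>
lemma nn_integral_prism_quadratic:
  assumes "c > 0" "k > 0" "h > 0" "A \<ge> 0" "D \<ge> 0"
  shows "(\<integral>\<^sup>+p. (case p of (x, y, z) \<Rightarrow> ennreal (A + D * (x\<^sup>2 + y\<^sup>2 + z\<^sup>2))) * indicator (prism c k h) p \<partial>lborel)
    = ennreal (c\<^sup>2 * k * h / 2 * (A + D * (c\<^sup>2 / 2 + (c * k)\<^sup>2 / 6 + h\<^sup>2 / 3)))"
proof -
  have z: "(\<integral>\<^sup>+z. ennreal (A + D * (x\<^sup>2 + y\<^sup>2 + z\<^sup>2)) * indicator {0..h} z \<partial>lborel)
     = ennreal ((A + D * (x\<^sup>2 + y\<^sup>2)) * h + D * h ^ 3 / 3)" for x y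
    by (rule nn_integral_FTC_eq[where F = "\<lambda>z. (A + D * (x\<^sup>2 + y\<^sup>2)) * z + D * z ^ 3 / 3"])
       (use assms in \<open>auto intro!: derivative_eq_intros add_nonneg_nonneg mult_nonneg_nonneg simp: field_simps power2_eq_square power3_eq_cube power4_eq_xxxx\<close>)
  have y: "(\<integral>\<^sup>+y. ennreal ((A + D * (x\<^sup>2 + y\<^sup>2)) * h + D * h ^ 3 / 3) * indicator {0..k * x} y \<partial>lborel)
     = ennreal (((A + D * x\<^sup>2) * h + D * h ^ 3 / 3) * (k * x) + D * h * (k * x) ^ 3 / 3)" if "x \<ge> 0" for x
    by (rule nn_integral_FTC_eq[where F = "\<lambda>y. ((A + D * x\<^sup>2) * h + D * h ^ 3 / 3) * y + D * h * y ^ 3 / 3"])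
       (use assms that in \<open>auto intro!: derivative_eq_intros add_nonneg_nonneg mult_nonneg_nonneg simp: field_simps power2_eq_square power3_eq_cube power4_eq_xxxx\<close>)
  have x: "(\<integral>\<^sup>+x. ennreal (((A + D * x\<^sup>2) * h + D * h ^ 3 / 3) * (k * x) + D * h * (k * x) ^ 3 / 3) * indicator {0..c} x \<partial>lborel)
     = ennreal (A * h * k * c\<^sup>2 / 2 + D * h * k * c ^ 4 / 4 + D * h ^ 3 / 3 * k * c\<^sup>2 / 2 + D * h * k ^ 3 * c ^ 4 / 12)"
    by (rule nn_integral_FTC_eq[where F = "\<lambda>x. A * h * k * x\<^sup>2 / 2 + D * h * k * x ^ 4 / 4 + D * h ^ 3 / 3 * k * x\<^sup>2 / 2 + D * h * k ^ 3 * x ^ 4 / 12"])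
       (use assms in \<open>auto intro!: derivative_eq_intros add_nonneg_nonneg mult_nonneg_nonneg simp: field_simps power2_eq_square power3_eq_cube power4_eq_xxxx\<close>)
  have "(\<integral>\<^sup>+p. (case p of (x, y, z) \<Rightarrow> ennreal (A + D * (x\<^sup>2 + y\<^sup>2 + z\<^sup>2))) * indicator (prism c k h) p \<partial>lborel)
    = (\<integral>\<^sup>+x. \<integral>\<^sup>+y. \<integral>\<^sup>+z. ennreal (A + D * (x\<^sup>2 + y\<^sup>2 + z\<^sup>2)) * indicator (prism c k h) (x, y, z) \<partial>lborel \<partial>lborel \<partial>lborel)"
    by (subst nn_integral_lborel_3) simp_all
  also have "\<dots> = (\<integral>\<^sup>+x. \<integral>\<^sup>+y. (\<integral>\<^sup>+z. ennreal (A + D * (x\<^sup>2 + y\<^sup>2 + z\<^sup>2)) * indicator {0..h} z \<partial>lborel) * indicator {0..k * x} y * indicator {0..c} x \<partial>lborel \<partial>lborel)"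
    using assms by (simp add: indicator_prism mult.assoc[symmetric] nn_integral_multc)
  also have "\<dots> = (\<integral>\<^sup>+x. (\<integral>\<^sup>+y. ennreal ((A + D * (x\<^sup>2 + y\<^sup>2)) * h + D * h ^ 3 / 3) * indicator {0..k * x} y \<partial>lborel) * indicator {0..c} x \<partial>lborel)"
    by (simp add: z nn_integral_multc)
  also have "\<dots> = (\<integral>\<^sup>+x. ennreal (((A + D * x\<^sup>2) * h + D * h ^ 3 / 3) * (k * x) + D * h * (k * x) ^ 3 / 3) * indicator {0..c} x \<partial>lborel)"
    by (rule nn_integral_cong) (auto simp: y split: split_indicator)
  finally show ?thesis unfolding x
    by (simp add: algebra_simps power_mult_distrib power2_eq_square power3_eq_cube power4_eq_xxxx add_divide_distrib)
qed

lemma emeasure_simplex: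
  assumes "s > 0"
  shows "emeasure lborel {(x, y, z). 0 \<le> x \<and> x \<le> y \<and> y \<le> z \<and> z \<le> (s::real)} = ennreal (s ^ 3 / 6)"
proof -
  define B where "B = {(x, y, z). 0 \<le> x \<and> x \<le> y \<and> y \<le> z \<and> z \<le> (s::real)}"
  have [measurable]: "B \<in> sets borel" unfolding B_def by measurable
  have ind: "indicator B (x, y, z) = (indicator {y..s} z * indicator {x..s} y * indicator {0..s} x :: ennreal)" for x y z
    by (auto simp: B_def indicator_def)
  have y: "(\<integral>\<^sup>+y. ennreal (s - y) * indicator {x..s} y \<partial>lborel) = ennreal ((s - x)\<^sup>2 / 2)" if "x \<le> s" for x
    by (rule nn_integral_FTC_eq[where F = "\<lambda>y. - (s - y)\<^sup>2 / 2"])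
       (use assms that in \<open>auto intro!: derivative_eq_intros add_nonneg_nonneg mult_nonneg_nonneg simp: field_simps power2_eq_square power3_eq_cube power4_eq_xxxx\<close>)
  have x: "(\<integral>\<^sup>+x. ennreal ((s - x)\<^sup>2 / 2) * indicator {0..s} x \<partial>lborel) = ennreal (s ^ 3 / 6)"
    by (rule nn_integral_FTC_eq[where F = "\<lambda>x. - ((s - x) ^ 3 / 6)"])
       (use assms in \<open>auto intro!: derivative_eq_intros\<close>)
  have "emeasure lborel B = (\<integral>\<^sup>+p. indicator B p \<partial>lborel)" by simp
  also have "\<dots> = (\<integral>\<^sup>+x. \<integral>\<^sup>+y. \<integral>\<^sup>+z. indicator B (x, y, z) \<partial>lborel \<partial>lborel \<partial>lborel)"
    by (rule nn_integral_lborel_3) measurable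
  also have "\<dots> = (\<integral>\<^sup>+x. \<integral>\<^sup>+y. (\<integral>\<^sup>+z. indicator {y..s} z \<partial>lborel) * indicator {x..s} y * indicator {0..s} x \<partial>lborel \<partial>lborel)"
    by (simp add: ind nn_integral_multc del: nn_integral_indicator)
  also have "\<dots> = (\<integral>\<^sup>+x. (\<integral>\<^sup>+y. ennreal (s - y) * indicator {x..s} y \<partial>lborel) * indicator {0..s} x \<partial>lborel)"
    by (subst nn_integral_multc[symmetric], measurable)
       (intro nn_integral_cong, auto split: split_indicator)
  also have "\<dots> = (\<integral>\<^sup>+x. ennreal ((s - x)\<^sup>2 / 2) * indicator {0..s} x \<partial>lborel)"
    by (rule nn_integral_cong) (auto simp: y split: split_indicator)
  finally show ?thesis unfolding B_def x .
qed

text \<open>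
  With \<open>t = sin \<phi>\<close> the integrand becomes a multiple of \<open>2 / (1 + sin\<^sup>2 \<phi>) - 1 / (1
  + a\<^sup>2 cos\<^sup>2 \<phi>)\<close>, which is integrated by arctangents of multiples of \<open>v = tan
  \<phi>\<close>. At \<open>t = 1\<close> this primitive is only a limit.
\<close>
lemma integral_sqrt_rational:
  fixes a :: real
  shows "(\<integral>\<^sup>+t. ennreal (sqrt (1 - t\<^sup>2) / ((1 + a\<^sup>2 * (1 - t\<^sup>2)) * (1 + t\<^sup>2))) * indicator {0..1} t \<partial>lborel)
    = ennreal (1 / (1 + 2 * a\<^sup>2) * (pi / sqrt 2 - pi / (2 * sqrt (1 + a\<^sup>2))))"
proof -
  define f where "f t = sqrt (1 - t\<^sup>2) / ((1 + a\<^sup>2 * (1 - t\<^sup>2)) * (1 + t\<^sup>2))" for t :: real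
  define q where "q = sqrt (1 + a\<^sup>2)"
  have q: "q > 0" "q\<^sup>2 = 1 + a\<^sup>2" by (auto simp: q_def add_pos_nonneg)
  define v where "v t = t / sqrt (1 - t\<^sup>2)" for t :: real
  define H where "H t = 1 / (1 + 2 * a\<^sup>2) * (sqrt 2 * arctan (sqrt 2 * v t) - 1 / q * arctan (v t / q))" for t
  have a2: "1 + 2 * a\<^sup>2 > 0" by (simp add: add_pos_nonneg)
  have lt: "t\<^sup>2 < 1" if "0 < t" "t < 1" for t :: real using that by (simp add: power_less_one_iff)
  have der: "(H has_real_derivative f t) (at t)" if t: "0 < t" "t < 1" for t
  proof -
    define s where "s = sqrt (1 - t\<^sup>2)"
    have s: "s > 0" "s\<^sup>2 = 1 - t\<^sup>2" using lt[OF t] by (auto simp: s_def)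
    have dv: "(v has_real_derivative 1 / s ^ 3) (at t)"
    proof -
      have "(v has_real_derivative (1 * s - t * (- t / s)) / (s * s)) (at t)"
        unfolding v_def s_def using lt[OF t]
        by (auto intro!: derivative_eq_intros simp: field_simps)
      also have "(1 * s - t * (- t / s)) / (s * s) = (s\<^sup>2 + t\<^sup>2) / s ^ 3"
        using s(1) by (simp add: field_simps power2_eq_square power3_eq_cube)
      finally show ?thesis by (simp add: s(2))
    qed
    have vt: "v t = t / s" by (simp add: v_def s_def)
    have "(H has_real_derivative 1 / (1 + 2 * a\<^sup>2) * (sqrt 2 * (sqrt 2 * (1 / s ^ 3) / (1 + (sqrt 2 * v t)\<^sup>2))
        - 1 / q * ((1 / s ^ 3) / q / (1 + (v t / q)\<^sup>2)))) (at t)"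
      unfolding H_def using dv q(1) a2 by (auto intro!: derivative_eq_intros simp: inverse_eq_divide mult_ac)
    also have "sqrt 2 * (sqrt 2 * (1 / s ^ 3) / (1 + (sqrt 2 * v t)\<^sup>2)) = 2 / (s * (1 + t\<^sup>2))"
    proof -
      have "1 + (sqrt 2 * v t)\<^sup>2 = (1 + t\<^sup>2) / s\<^sup>2"
        using s by (simp add: vt power_mult_distrib power_divide field_simps)
      then show ?thesis using s(1) by (simp add: power2_eq_square power3_eq_cube)
    qed
    also have "1 / q * ((1 / s ^ 3) / q / (1 + (v t / q)\<^sup>2)) = 1 / (s * (1 + a\<^sup>2 * (1 - t\<^sup>2)))"
    proof -
      have "q\<^sup>2 * s\<^sup>2 + t\<^sup>2 = 1 + a\<^sup>2 * (1 - t\<^sup>2)" unfolding q(2) s(2) by (simp add: algebra_simps)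
      moreover have "1 + (v t / q)\<^sup>2 = (q\<^sup>2 * s\<^sup>2 + t\<^sup>2) / (q\<^sup>2 * s\<^sup>2)"
        using s(1) q(1) by (simp add: vt power_divide power_mult_distrib field_simps)
      ultimately have "1 + (v t / q)\<^sup>2 = (1 + a\<^sup>2 * (1 - t\<^sup>2)) / (q\<^sup>2 * s\<^sup>2)" by simp
      then show ?thesis using s(1) q(1) by (simp add: power2_eq_square power3_eq_cube)
    qed
    also have "1 / (1 + 2 * a\<^sup>2) * (2 / (s * (1 + t\<^sup>2)) - 1 / (s * (1 + a\<^sup>2 * (1 - t\<^sup>2)))) = f t"
    proof -
      have p: "1 + t\<^sup>2 > 0" "1 + a\<^sup>2 * (1 - t\<^sup>2) > 0"
        using lt[OF t] by (auto simp: add_pos_nonneg)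
      have "2 / (s * (1 + t\<^sup>2)) - 1 / (s * (1 + a\<^sup>2 * (1 - t\<^sup>2))) =
         (2 * (1 + a\<^sup>2 * (1 - t\<^sup>2)) - (1 + t\<^sup>2)) / (s * (1 + t\<^sup>2) * (1 + a\<^sup>2 * (1 - t\<^sup>2)))"
        using s(1) p by (simp add: divide_simps)
      also have "2 * (1 + a\<^sup>2 * (1 - t\<^sup>2)) - (1 + t\<^sup>2) = (1 + 2 * a\<^sup>2) * s\<^sup>2" unfolding s(2) by (simp add: algebra_simps)
      finally have "2 / (s * (1 + t\<^sup>2)) - 1 / (s * (1 + a\<^sup>2 * (1 - t\<^sup>2))) =
         (1 + 2 * a\<^sup>2) * (s / ((1 + a\<^sup>2 * (1 - t\<^sup>2)) * (1 + t\<^sup>2)))"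
        using s(1) by (simp add: power2_eq_square[of s] mult_ac)
      then show ?thesis using a2 unfolding f_def s_def[symmetric] by simp
    qed
    finally show ?thesis .
  qed
  have cont: "isCont f t" if "0 < t" "t < 1" for t
  proof -
    have "1 + a\<^sup>2 * (1 - t\<^sup>2) > 0" "1 + t\<^sup>2 > 0" using lt[OF that] by (auto simp: add_pos_nonneg)
    then show ?thesis unfolding f_def by (intro continuous_intros) auto
  qed
  have pos: "f t \<ge> 0" if "0 \<le> t" "t \<le> 1" for t
    using that unfolding f_def by (intro divide_nonneg_nonneg mult_nonneg_nonneg add_nonneg_nonneg real_sqrt_ge_zero) (auto simp: power_le_one)
  have v1: "filterlim v at_top (at_left 1)"
  proof -
    have "((\<lambda>t::real. sqrt (1 - t\<^sup>2)) \<longlongrightarrow> sqrt (1 - 1\<^sup>2)) (at_left 1)"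
      by (intro tendsto_intros)
    moreover have "eventually (\<lambda>t::real. sqrt (1 - t\<^sup>2) > 0) (at_left 1)"
      using eventually_at_left_real[of 0 1] by (auto elim!: eventually_mono simp: power_less_one_iff)
    ultimately have "filterlim (\<lambda>t::real. sqrt (1 - t\<^sup>2)) (at_right 0) (at_left 1)"
      by (auto simp: filterlim_at eventually_mono)
    then have "filterlim (\<lambda>t::real. inverse (sqrt (1 - t\<^sup>2))) at_top (at_left 1)"
      by (rule filterlim_compose[OF filterlim_inverse_at_top_right])
    then show ?thesis unfolding v_def divide_inverse
      by (intro filterlim_tendsto_pos_mult_at_top[OF tendsto_ident_at]) auto
  qed
  have lim1: "(H \<longlongrightarrow> 1 / (1 + 2 * a\<^sup>2) * (sqrt 2 * (pi / 2) - 1 / q * (pi / 2))) (at_left 1)"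
  proof -
    have "filterlim (\<lambda>t. sqrt 2 * v t) at_top (at_left 1)"
      using v1 by (intro filterlim_tendsto_pos_mult_at_top[OF tendsto_const]) auto
    moreover have "filterlim (\<lambda>t. v t / q) at_top (at_left 1)"
      using filterlim_tendsto_pos_mult_at_top[OF tendsto_const[of "1/q"] _ v1] q(1) by (simp add: mult.commute)
    ultimately have A: "((\<lambda>t. arctan (sqrt 2 * v t)) \<longlongrightarrow> pi / 2) (at_left 1)"
      and B: "((\<lambda>t. arctan (v t / q)) \<longlongrightarrow> pi / 2) (at_left 1)"
      by (auto intro: filterlim_compose[OF tendsto_arctan_at_top])
    show ?thesis unfolding H_def by (intro tendsto_mult tendsto_diff tendsto_const A B)
  qed
  have lim0: "(H \<longlongrightarrow> 0) (at_right 0)"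
  proof -
    have "isCont v 0" unfolding v_def by (intro continuous_intros) auto
    then have "isCont H 0" unfolding H_def using q(1) by (intro continuous_intros) auto
    then have "(H \<longlongrightarrow> H 0) (at 0)" by (simp add: isCont_def)
    then have "(H \<longlongrightarrow> H 0) (at_right 0)" by (rule tendsto_mono[rotated]) (simp add: at_le)
    moreover have "H 0 = 0" by (simp add: H_def v_def)
    ultimately show ?thesis by simp
  qed
  have *: "set_integrable lborel (einterval 0 1) f"
     "(LBINT t=0..1. f t) = 1 / (1 + 2 * a\<^sup>2) * (sqrt 2 * (pi / 2) - 1 / q * (pi / 2)) - 0"
    using interval_integral_FTC_nonneg[of 0 1 H f 0 "1 / (1 + 2 * a\<^sup>2) * (sqrt 2 * (pi / 2) - 1 / q * (pi / 2))"]
      der cont pos lim0 lim1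
    by (auto simp: zero_ereal_def one_ereal_def ereal_tendsto_simps)
  have ei: "einterval 0 1 = {0<..<1::real}" by (auto simp: einterval_def zero_ereal_def one_ereal_def)
  have "(\<integral>\<^sup>+t. ennreal (f t) * indicator {0..1} t \<partial>lborel) = (\<integral>\<^sup>+t. ennreal (indicator {0<..<1} t *\<^sub>R f t) \<partial>lborel)"
  proof (rule nn_integral_cong_AE)
    show "AE t in lborel. ennreal (f t) * indicator {0..1} t = ennreal (indicator {0<..<1} t *\<^sub>R f t)"
      using AE_lborel_singleton[of 0] AE_lborel_singleton[of 1]
      by eventually_elim (auto split: split_indicator)
  qed
  also have "\<dots> = ennreal (LINT t|lborel. indicator {0<..<1} t *\<^sub>R f t)"
    using * pos by (intro nn_integral_eq_integral) (auto simp: set_integrable_def ei indicator_def)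
  also have "(LINT t|lborel. indicator {0<..<1} t *\<^sub>R f t) = (LBINT t=0..1. f t)"
    by (simp add: interval_lebesgue_integral_def set_lebesgue_integral_def ei)
  also have "\<dots> = 1 / (1 + 2 * a\<^sup>2) * (pi / sqrt 2 - pi / (2 * sqrt (1 + a\<^sup>2)))"
  proof -
    have "sqrt 2 * (pi / 2) = pi / sqrt 2" by (simp add: field_simps)
    then show ?thesis unfolding * q_def by simp
  qed
  finally show ?thesis unfolding f_def .
qed

lemma powr_minus_three_halves: "q > 0 \<Longrightarrow> q powr (- 3 / 2) = 1 / (q * sqrt q)" for q :: real
proof -
  assume q: "q > 0"
  have "q powr (- 3 / 2) = q powr (- 1 + - (1 / 2))" by simp
  also have "\<dots> = q powr (- 1) * q powr (- (1 / 2))" by (rule powr_add)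
  finally show ?thesis using q by (simp add: powr_minus powr_half_sqrt field_simps)
qed

text \<open>
  The arctangent is the integral of \<open>s / (1 + a\<^sup>2 s\<^sup>2)\<close> over the parameter \<open>0 \<le> a
  \<le> 1 / sqrt 2\<close>, where \<open>s = sqrt (1 - t\<^sup>2)\<close>. By Tonelli one may integrate over
  \<open>t\<close> first; what is left in \<open>a\<close> is elementary, and the two arctangents that occur are
  \<open>\<pi>/4\<close> and \<open>\<pi>/6\<close>.
\<close>
lemma arctan_sqrt_integral:
  "(\<integral>\<^sup>+t. ennreal (arctan (sqrt ((1 - t\<^sup>2) / 2)) / (1 + t\<^sup>2)) * indicator {0..1} t \<partial>lborel) = ennreal (pi\<^sup>2 / 24)"
proof -
  define b where "b = 1 / sqrt (2::real)"
  have b: "b > 0" "b\<^sup>2 = 1 / 2" by (auto simp: b_def power_divide)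
  define g where "g t a = sqrt (1 - t\<^sup>2) / ((1 + a\<^sup>2 * (1 - t\<^sup>2)) * (1 + t\<^sup>2))" for t a :: real
  have [measurable]: "(\<lambda>(t, a). g t a) \<in> borel_measurable (borel \<Otimes>\<^sub>M borel)"
    unfolding g_def by measurable
  have inner: "(\<integral>\<^sup>+a. ennreal (g t a) * indicator {0..b} a \<partial>lborel) = ennreal (arctan (sqrt ((1 - t\<^sup>2) / 2)) / (1 + t\<^sup>2))"
    if t: "0 \<le> t" "t \<le> 1" for t
  proof -
    define s where "s = sqrt (1 - t\<^sup>2)"
    have s: "s \<ge> 0" "s\<^sup>2 = 1 - t\<^sup>2" using t by (auto simp: s_def power_le_one)
    have pos: "1 + a\<^sup>2 * s\<^sup>2 > 0" "1 + t\<^sup>2 > 0" for a :: real by (auto simp: add_pos_nonneg)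
    have "((\<lambda>a. arctan (a * s) / (1 + t\<^sup>2)) has_real_derivative g t a) (at a)" for a
    proof -
      have "((\<lambda>a. arctan (a * s) / (1 + t\<^sup>2)) has_real_derivative (s / (1 + (a * s)\<^sup>2)) / (1 + t\<^sup>2)) (at a)"
        using pos(2) by (auto intro!: derivative_eq_intros simp: inverse_eq_divide)
      then show ?thesis
        unfolding g_def s_def[symmetric] unfolding s(2)[symmetric] power_mult_distrib by simp
    qed
    moreover have "g t a \<ge> 0" for a
      unfolding g_def s_def[symmetric] unfolding s(2)[symmetric] using s(1) pos by (simp add: less_imp_le)
    moreover have "arctan (b * s) = arctan (sqrt ((1 - t\<^sup>2) / 2))"
      by (simp add: b_def s_def real_sqrt_divide)
    ultimately show ?thesis
      by (intro nn_integral_FTC_eq[where F = "\<lambda>a. arctan (a * s) / (1 + t\<^sup>2)"]) (use b in \<open>auto simp: g_def[abs_def]\<close>)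
  qed
  have "(\<integral>\<^sup>+t. ennreal (arctan (sqrt ((1 - t\<^sup>2) / 2)) / (1 + t\<^sup>2)) * indicator {0..1} t \<partial>lborel)
    = (\<integral>\<^sup>+t. (\<integral>\<^sup>+a. ennreal (g t a) * indicator {0..b} a \<partial>lborel) * indicator {0..1} t \<partial>lborel)"
    by (rule nn_integral_cong) (auto simp: inner split: split_indicator)
  also have "\<dots> = (\<integral>\<^sup>+t. \<integral>\<^sup>+a. ennreal (g t a) * indicator {0..b} a * indicator {0..1} t \<partial>lborel \<partial>lborel)"
    by (simp add: nn_integral_multc)
  also have "\<dots> = (\<integral>\<^sup>+a. \<integral>\<^sup>+t. ennreal (g t a) * indicator {0..b} a * indicator {0..1} t \<partial>lborel \<partial>lborel)"
    by (rule lborel_pair.Fubini') (simp add: case_prod_beta', measurable)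
  also have "\<dots> = (\<integral>\<^sup>+a. (\<integral>\<^sup>+t. ennreal (g t a) * indicator {0..1} t \<partial>lborel) * indicator {0..b} a \<partial>lborel)"
    by (subst nn_integral_multc[symmetric], measurable) (intro nn_integral_cong, simp add: mult_ac)
  also have "\<dots> = (\<integral>\<^sup>+a. ennreal (1 / (1 + 2 * a\<^sup>2) * (pi / sqrt 2 - pi / (2 * sqrt (1 + a\<^sup>2)))) * indicator {0..b} a \<partial>lborel)"
    unfolding g_def integral_sqrt_rational ..
  also have "\<dots> = ennreal (pi\<^sup>2 / 24)"
  proof (rule nn_integral_FTC_eq[where F = "\<lambda>a. pi / 2 * arctan (sqrt 2 * a) - pi / 2 * arctan (a / sqrt (1 + a\<^sup>2))"])
    fix a :: real
    define q where "q = sqrt (1 + a\<^sup>2)"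
    have q: "q > 0" "q\<^sup>2 = 1 + a\<^sup>2" "q \<ge> 1" by (auto simp: q_def add_pos_nonneg)
    have a2: "1 + 2 * a\<^sup>2 > 0" by (simp add: add_pos_nonneg)
    have dq: "((\<lambda>a. a / sqrt (1 + a\<^sup>2)) has_real_derivative 1 / q ^ 3) (at a)"
    proof -
      have "((\<lambda>a. a / sqrt (1 + a\<^sup>2)) has_real_derivative (1 * q - a * (a / q)) / (q * q)) (at a)"
        unfolding q_def using q(1,2) add_pos_nonneg[OF zero_less_one zero_le_power2[of a]]
        by (auto intro!: derivative_eq_intros simp: field_simps add_nonneg_eq_0_iff)
      also have "(1 * q - a * (a / q)) / (q * q) = (q\<^sup>2 - a\<^sup>2) / q ^ 3"
        using q(1) by (simp add: field_simps power2_eq_square power3_eq_cube)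
      finally show ?thesis by (simp add: q(2))
    qed
    have "((\<lambda>a. pi / 2 * arctan (sqrt 2 * a) - pi / 2 * arctan (a / sqrt (1 + a\<^sup>2))) has_real_derivative
        pi / 2 * (sqrt 2 / (1 + (sqrt 2 * a)\<^sup>2)) - pi / 2 * ((1 / q ^ 3) / (1 + (a / q)\<^sup>2))) (at a)"
    proof -
      have "((\<lambda>a. arctan (a / sqrt (1 + a\<^sup>2))) has_real_derivative (1 / q ^ 3) / (1 + (a / q)\<^sup>2)) (at a)"
        by (rule DERIV_cong[OF DERIV_chain2[OF DERIV_arctan dq]]) (simp add: q_def inverse_eq_divide)
      moreover have "((\<lambda>a. arctan (sqrt 2 * a)) has_real_derivative sqrt 2 / (1 + (sqrt 2 * a)\<^sup>2)) (at a)"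
        by (auto intro!: derivative_eq_intros simp: inverse_eq_divide)
      ultimately show ?thesis by (intro DERIV_diff DERIV_cmult)
    qed
    also have "(1 / q ^ 3) / (1 + (a / q)\<^sup>2) = 1 / (q * (1 + 2 * a\<^sup>2))"
    proof -
      have "1 + (a / q)\<^sup>2 = (q\<^sup>2 + a\<^sup>2) / q\<^sup>2" using q(1) by (simp add: power_divide field_simps)
      then have "1 + (a / q)\<^sup>2 = (1 + 2 * a\<^sup>2) / q\<^sup>2" by (simp add: q(2))
      then show ?thesis using q(1) by (simp add: power2_eq_square power3_eq_cube)
    qed
    also have "pi / 2 * (sqrt 2 / (1 + (sqrt 2 * a)\<^sup>2)) = 1 / (1 + 2 * a\<^sup>2) * (pi / sqrt 2)"
    proof -
      have "pi / sqrt 2 = pi / 2 * sqrt 2" by (simp add: field_simps)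
      moreover have "1 + (sqrt 2 * a)\<^sup>2 = 1 + 2 * a\<^sup>2" by (simp add: power_mult_distrib)
      ultimately show ?thesis by (simp only:) simp
    qed
    also have "1 / (1 + 2 * a\<^sup>2) * (pi / sqrt 2) - pi / 2 * (1 / (q * (1 + 2 * a\<^sup>2)))
       = 1 / (1 + 2 * a\<^sup>2) * (pi / sqrt 2 - pi / (2 * q))"
      by (simp add: right_diff_distrib)
    finally show "((\<lambda>a. pi / 2 * arctan (sqrt 2 * a) - pi / 2 * arctan (a / sqrt (1 + a\<^sup>2))) has_real_derivative
        1 / (1 + 2 * a\<^sup>2) * (pi / sqrt 2 - pi / (2 * sqrt (1 + a\<^sup>2)))) (at a)" unfolding q_def .
    have "sqrt 2 \<le> sqrt (2\<^sup>2)" by (intro real_sqrt_le_mono) simp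
    then have "sqrt 2 \<le> 2 * q" using q(3) by simp
    then have "pi / (2 * q) \<le> pi / sqrt 2" by (intro divide_left_mono) (use q in auto)
    then show "0 \<le> 1 / (1 + 2 * a\<^sup>2) * (pi / sqrt 2 - pi / (2 * sqrt (1 + a\<^sup>2)))"
      unfolding q_def[symmetric] using a2 by simp
  next
    have "b / sqrt (1 + b\<^sup>2) = 1 / sqrt 3"
      unfolding b(2) by (simp add: b_def real_sqrt_divide[symmetric] real_sqrt_mult[symmetric])
    moreover have "arctan (1 / sqrt 3) = pi / 6"
      by (rule arctan_unique) (auto simp: tan_30 pi_gt_zero field_simps)
    moreover have "sqrt 2 * b = 1" by (simp add: b_def)
    ultimately show "pi / 2 * arctan (sqrt 2 * b) - pi / 2 * arctan (b / sqrt (1 + b\<^sup>2))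
       - (pi / 2 * arctan (sqrt 2 * 0) - pi / 2 * arctan (0 / sqrt (1 + 0\<^sup>2))) = pi\<^sup>2 / 24"
      by (simp add: arctan_one power2_eq_square)
  qed (use b in auto)
  finally show ?thesis .
qed


lemma nn_integral_inverse_one_plus_sq:
  "(\<integral>\<^sup>+t. ennreal (pi / 4 / (1 + t\<^sup>2)) * indicator {0..1} t \<partial>lborel) = ennreal (pi\<^sup>2 / 16)"
proof (rule nn_integral_FTC_eq[where F = "\<lambda>t. pi / 4 * arctan t"])
  show "((\<lambda>t. pi / 4 * arctan t) has_real_derivative pi / 4 / (1 + t\<^sup>2)) (at t)" for t
    by (rule DERIV_cong[OF DERIV_cmult[OF DERIV_arctan]]) (rule divide_inverse[symmetric])
  show "pi / 4 * arctan 1 - pi / 4 * arctan 0 = pi\<^sup>2 / 16" by (simp add: arctan_one power2_eq_square)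
qed (simp_all add: add_nonneg_nonneg)

lemma arctan_deficit_integral:
  "(\<integral>\<^sup>+t. ennreal ((pi / 4 - arctan (sqrt ((1 - t\<^sup>2) / 2))) / (1 + t\<^sup>2)) * indicator {0..1} t \<partial>lborel) = ennreal (pi\<^sup>2 / 48)"
  (is "?K = _")
proof -
  have nn: "0 \<le> arctan (sqrt ((1 - t\<^sup>2) / 2))" "arctan (sqrt ((1 - t\<^sup>2) / 2)) \<le> pi / 4" if "0 \<le> t" "t \<le> 1" for t :: real
  proof -
    have "1 - t\<^sup>2 \<le> 2" by (rule order_trans[of _ 1]) simp_all
    then have "(1 - t\<^sup>2) / 2 \<le> 1" by simp
    then have "sqrt ((1 - t\<^sup>2) / 2) \<le> sqrt 1" by (rule real_sqrt_le_mono)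
    then show "arctan (sqrt ((1 - t\<^sup>2) / 2)) \<le> pi / 4" using arctan_le_iff[of "sqrt ((1 - t\<^sup>2) / 2)" 1] by (simp add: arctan_one)
    show "0 \<le> arctan (sqrt ((1 - t\<^sup>2) / 2))" using that by (simp add: zero_le_arctan_iff power_le_one)
  qed
  have "ennreal (pi\<^sup>2 / 16) = (\<integral>\<^sup>+t. ennreal (pi / 4 / (1 + t\<^sup>2)) * indicator {0..1} t \<partial>lborel)"
    by (rule nn_integral_inverse_one_plus_sq[symmetric])
  also have "\<dots> = (\<integral>\<^sup>+t. ennreal ((pi / 4 - arctan (sqrt ((1 - t\<^sup>2) / 2))) / (1 + t\<^sup>2)) * indicator {0..1} t +
      ennreal (arctan (sqrt ((1 - t\<^sup>2) / 2)) / (1 + t\<^sup>2)) * indicator {0..1} t \<partial>lborel)"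
  proof (rule nn_integral_cong)
    fix t :: real
    have "ennreal (pi / 4 / (1 + t\<^sup>2)) = ennreal ((pi / 4 - arctan (sqrt ((1 - t\<^sup>2) / 2))) / (1 + t\<^sup>2)) +
      ennreal (arctan (sqrt ((1 - t\<^sup>2) / 2)) / (1 + t\<^sup>2))" if "0 \<le> t" "t \<le> 1"
    proof -
      have "0 \<le> (pi / 4 - arctan (sqrt ((1 - t\<^sup>2) / 2))) / (1 + t\<^sup>2)" "0 \<le> arctan (sqrt ((1 - t\<^sup>2) / 2)) / (1 + t\<^sup>2)"
        using nn[OF that] by (simp_all add: add_nonneg_nonneg)
      then show ?thesis by (metis add_divide_distrib diff_add_cancel ennreal_plus)
    qed
    then show "ennreal (pi / 4 / (1 + t\<^sup>2)) * indicator {0..1} t = ennreal ((pi / 4 - arctan (sqrt ((1 - t\<^sup>2) / 2))) / (1 + t\<^sup>2)) * indicator {0..1} t +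
      ennreal (arctan (sqrt ((1 - t\<^sup>2) / 2)) / (1 + t\<^sup>2)) * indicator {0..1} t"
      by (auto split: split_indicator)
  qed
  also have "\<dots> = ?K + ennreal (pi\<^sup>2 / 24)"
    by (subst nn_integral_add) (simp_all add: arctan_sqrt_integral)
  finally have "?K = ennreal (pi\<^sup>2 / 16) - ennreal (pi\<^sup>2 / 24)" by simp
  also have "\<dots> = ennreal (pi\<^sup>2 / 16 - pi\<^sup>2 / 24)" by (rule ennreal_minus) simp
  also have "pi\<^sup>2 / 16 - pi\<^sup>2 / 24 = pi\<^sup>2 / 48" by (simp add: field_simps)
  finally show ?thesis .
qed

text \<open>
  The corner \<open>(1/2, 1/2, sqrt (1/2))\<close> of the prism lies on the unit sphere, where the integrand is
  unbounded; it only affects null sets of the iterated integrals. After integration in \<open>z\<close> the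
  substitution \<open>y = x t\<close> replaces polar coordinates on the triangle, and integration in \<open>x\<close>
  leads to \<open>arctan_deficit_integral\<close>.
\<close>
lemma nn_integral_prism_ideal_corner:
  "(\<integral>\<^sup>+p. (case p of (x, y, z) \<Rightarrow> ennreal ((1 - x\<^sup>2 - y\<^sup>2 - z\<^sup>2) powr (- 3 / 2) / 3)) * indicator (prism (1/2) 1 (sqrt (1/2))) p \<partial>lborel)
     = ennreal (pi\<^sup>2 / 144)"
proof -
  define h where "h = sqrt (1/2 :: real)"
  have h: "h > 0" "h\<^sup>2 = 1/2" by (auto simp: h_def)
  have zint: "(\<integral>\<^sup>+z. ennreal ((1 - x\<^sup>2 - y\<^sup>2 - z\<^sup>2) powr (- 3 / 2) / 3) * indicator {0..h} z \<partial>lborel)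
      = ennreal (h / (3 * (1 - x\<^sup>2 - y\<^sup>2) * sqrt (1/2 - x\<^sup>2 - y\<^sup>2)))" if xy: "x\<^sup>2 + y\<^sup>2 < 1/2" for x y :: real
  proof -
    define m where "m = 1 - x\<^sup>2 - y\<^sup>2"
    have m: "m > 1/2" using xy by (simp add: m_def)
    have zm: "m - z\<^sup>2 > 0" if "0 \<le> z" "z \<le> h" for z
    proof -
      have "z\<^sup>2 \<le> h\<^sup>2" using that by (intro power_mono)
      then show ?thesis using m h by simp
    qed
    have "(\<integral>\<^sup>+z. ennreal ((m - z\<^sup>2) powr (- 3 / 2) / 3) * indicator {0..h} z \<partial>lborel)
      = ennreal (h / (3 * m * sqrt (m - h\<^sup>2)))"
    proof (rule nn_integral_FTC_eq[where F = "\<lambda>z. z / (3 * m * sqrt (m - z\<^sup>2))"])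
      fix z assume z: "0 \<le> z" "z \<le> h"
      define s where "s = sqrt (m - z\<^sup>2)"
      have s: "s > 0" "s\<^sup>2 = m - z\<^sup>2" using zm[OF z] by (auto simp: s_def)
      have "((\<lambda>z. z / (3 * m * sqrt (m - z\<^sup>2))) has_real_derivative (3 * m * s - z * (3 * m * (- z / s))) / (3 * m * s)\<^sup>2) (at z)"
        unfolding s_def using zm[OF z] m by (auto intro!: derivative_eq_intros simp: power2_eq_square field_simps)
      also have "(3 * m * s - z * (3 * m * (- z / s))) / (3 * m * s)\<^sup>2 = (s\<^sup>2 + z\<^sup>2) / (3 * m * (s\<^sup>2 * s))"
        using s(1) m by (simp add: field_simps power2_eq_square)
      also have "\<dots> = (m - z\<^sup>2) powr (- 3 / 2) / 3"
        using m zm[OF z] by (simp only: powr_minus_three_halves s(2)) (simp add: s_def)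
      finally show "((\<lambda>z. z / (3 * m * sqrt (m - z\<^sup>2))) has_real_derivative (m - z\<^sup>2) powr (- 3 / 2) / 3) (at z)" .
    qed (use h in auto)
    moreover have "m - h\<^sup>2 = 1/2 - x\<^sup>2 - y\<^sup>2" by (simp add: m_def h(2))
    ultimately show ?thesis by (simp only: m_def)
  qed
  define g where "g x y = h / (3 * (1 - x\<^sup>2 - y\<^sup>2) * sqrt (1/2 - x\<^sup>2 - y\<^sup>2))" for x y
  define Z where "Z x y = (\<integral>\<^sup>+z. ennreal ((1 - x\<^sup>2 - y\<^sup>2 - z\<^sup>2) powr (- 3 / 2) / 3) * indicator {0..h} z \<partial>lborel)" for x y
  have zint': "Z x y = ennreal (g x y)" if "x\<^sup>2 + y\<^sup>2 < 1/2" for x y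
    unfolding Z_def g_def using that by (rule zint)
  have gm[measurable]: "(\<lambda>(x, y). g x y) \<in> borel_measurable (borel \<Otimes>\<^sub>M borel)" unfolding g_def by measurable
  have "(\<integral>\<^sup>+p. (case p of (x, y, z) \<Rightarrow> ennreal ((1 - x\<^sup>2 - y\<^sup>2 - z\<^sup>2) powr (- 3 / 2) / 3)) * indicator (prism (1/2) 1 h) p \<partial>lborel)
    = (\<integral>\<^sup>+x. \<integral>\<^sup>+y. \<integral>\<^sup>+z. ennreal ((1 - x\<^sup>2 - y\<^sup>2 - z\<^sup>2) powr (- 3 / 2) / 3) * indicator (prism (1/2) 1 h) (x, y, z) \<partial>lborel \<partial>lborel \<partial>lborel)"
    by (subst nn_integral_lborel_3) simp_all
  also have "\<dots> = (\<integral>\<^sup>+x. \<integral>\<^sup>+y. Z x y * indicator {0..x} y * indicator {0..1/2} x \<partial>lborel \<partial>lborel)"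
    by (simp add: Z_def indicator_prism mult.assoc[symmetric] nn_integral_multc)
  also have "\<dots> = (\<integral>\<^sup>+x. (\<integral>\<^sup>+y. ennreal (g x y) * indicator {0..x} y \<partial>lborel) * indicator {0..1/2} x \<partial>lborel)"
  proof (rule nn_integral_cong_AE)
    show "AE x in lborel. (\<integral>\<^sup>+y. Z x y * indicator {0..x} y * indicator {0..1/2} x \<partial>lborel)
      = (\<integral>\<^sup>+y. ennreal (g x y) * indicator {0..x} y \<partial>lborel) * indicator {0..1/2} x"
      using AE_lborel_singleton[of "1/2"]
    proof eventually_elim
      fix x :: real assume x: "x \<noteq> 1/2"
      show "(\<integral>\<^sup>+y. Z x y * indicator {0..x} y * indicator {0..1/2} x \<partial>lborel)
      = (\<integral>\<^sup>+y. ennreal (g x y) * indicator {0..x} y \<partial>lborel) * indicator {0..1/2} x"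
      proof (cases "0 \<le> x \<and> x < 1/2")
        case True
        have "x\<^sup>2 + y\<^sup>2 < 1/2" if "0 \<le> y" "y \<le> x" for y
        proof -
          have "y\<^sup>2 \<le> x\<^sup>2" using that by (intro power_mono) auto
          moreover have "x\<^sup>2 < (1/2)\<^sup>2" using True by (intro power_strict_mono) auto
          ultimately show ?thesis by (simp add: power2_eq_square)
        qed
        then have "Z x y * indicator {0..x} y = ennreal (g x y) * indicator {0..x} y" for y
          by (simp add: zint' split: split_indicator)
        then show ?thesis using True by simp
      next
        case False
        then have "indicator {0..1/2} x = (0 :: ennreal)" using x by (auto simp: indicator_def)
        then show ?thesis by simp
      qed
    qed
  qed
  \<comment> \<open>the substitution \<open>y = x t\<close>\<close>
  also have "\<dots> = (\<integral>\<^sup>+x. (\<integral>\<^sup>+t. ennreal (x * g x (x * t)) * indicator {0..1} t \<partial>lborel) * indicator {0..1/2} x \<partial>lborel)"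
  proof (rule nn_integral_cong_AE)
    show "AE x in lborel. (\<integral>\<^sup>+y. ennreal (g x y) * indicator {0..x} y \<partial>lborel) * indicator {0..1/2} x
      = (\<integral>\<^sup>+t. ennreal (x * g x (x * t)) * indicator {0..1} t \<partial>lborel) * indicator {0..1/2} x"
      using AE_lborel_singleton[of 0]
    proof eventually_elim
      fix x :: real assume x: "x \<noteq> 0"
      show "(\<integral>\<^sup>+y. ennreal (g x y) * indicator {0..x} y \<partial>lborel) * indicator {0..1/2} x
      = (\<integral>\<^sup>+t. ennreal (x * g x (x * t)) * indicator {0..1} t \<partial>lborel) * indicator {0..1/2} x"
      proof (cases "x > 0")
        case True
        have "(\<integral>\<^sup>+y. ennreal (g x y) * indicator {0..x} y \<partial>lborel)
           = ennreal x * (\<integral>\<^sup>+t. ennreal (g x (x * t)) * indicator {0..x} (x * t) \<partial>lborel)"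
          using True by (subst nn_integral_real_affine[where c = x and t = 0]) auto
        also have "\<dots> = (\<integral>\<^sup>+t. ennreal x * (ennreal (g x (x * t)) * indicator {0..x} (x * t)) \<partial>lborel)"
          by (rule nn_integral_cmult[symmetric]) measurable
        also have "\<dots> = (\<integral>\<^sup>+t. ennreal (x * g x (x * t)) * indicator {0..1} t \<partial>lborel)"
          using True by (intro nn_integral_cong) (auto simp: ennreal_mult' zero_le_mult_iff split: split_indicator)
        finally show ?thesis by simp
      qed (use x in auto)
    qed
  qed
  also have "\<dots> = (\<integral>\<^sup>+x. \<integral>\<^sup>+t. ennreal (x * g x (x * t)) * indicator {0..1} t * indicator {0..1/2} x \<partial>lborel \<partial>lborel)"
    by (simp add: nn_integral_multc)
  also have "\<dots> = (\<integral>\<^sup>+t. \<integral>\<^sup>+x. ennreal (x * g x (x * t)) * indicator {0..1} t * indicator {0..1/2} x \<partial>lborel \<partial>lborel)"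
    by (rule lborel_pair.Fubini') (simp add: case_prod_beta', measurable)
  also have "\<dots> = (\<integral>\<^sup>+t. (\<integral>\<^sup>+x. ennreal (x * g x (x * t)) * indicator {0..1/2} x \<partial>lborel) * indicator {0..1} t \<partial>lborel)"
    by (subst nn_integral_multc[symmetric], measurable) (intro nn_integral_cong, simp add: mult_ac)
  also have "\<dots> = (\<integral>\<^sup>+t. ennreal (1 / 3 * ((pi / 4 - arctan (sqrt ((1 - t\<^sup>2) / 2))) / (1 + t\<^sup>2))) * indicator {0..1} t \<partial>lborel)"
  proof (rule nn_integral_cong_AE)
    have xint: "(\<integral>\<^sup>+x. ennreal (x * g x (x * t)) * indicator {0..1/2} x \<partial>lborel)
       = ennreal (1 / 3 * ((pi / 4 - arctan (sqrt ((1 - t\<^sup>2) / 2))) / (1 + t\<^sup>2)))" if t: "0 \<le> t" "t < 1" for t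
    proof -
      define m where "m = 1 + t\<^sup>2"
      have m: "m > 0" "m < 2" using t by (auto simp: m_def add_pos_nonneg power_less_one_iff)
      have xm: "1/2 - x\<^sup>2 * m > 0" if "0 \<le> x" "x \<le> 1/2" for x
      proof -
        have "x\<^sup>2 \<le> (1/2)\<^sup>2" using that by (intro power_mono)
        then have "x\<^sup>2 * m \<le> (1/2)\<^sup>2 * m" using m by (intro mult_right_mono) auto
        moreover have "(1/2)\<^sup>2 * m = m / 4" by (simp add: power2_eq_square)
        ultimately show ?thesis using m by linarith
      qed
      have gx: "x * g x (x * t) = h * x / (3 * (1 - x\<^sup>2 * m) * sqrt (1/2 - x\<^sup>2 * m))" for x
      proof -
        have "1 - x\<^sup>2 - (x * t)\<^sup>2 = 1 - x\<^sup>2 * m" "1/2 - x\<^sup>2 - (x * t)\<^sup>2 = 1/2 - x\<^sup>2 * m"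
          by (simp_all add: m_def power_mult_distrib algebra_simps)
        then show ?thesis unfolding g_def by (simp only: times_divide_eq_right mult.commute[of x h])
      qed
      have hs: "sqrt 2 * h = 1" by (simp add: h_def real_sqrt_mult[symmetric])
      show ?thesis unfolding gx
      proof (rule nn_integral_FTC_eq[where F = "\<lambda>x. - (1 / (3 * m)) * arctan (sqrt 2 * sqrt (1/2 - x\<^sup>2 * m))"])
        fix x :: real assume x: "0 \<le> x" "x \<le> 1/2"
        define u where "u = sqrt (1/2 - x\<^sup>2 * m)"
        have u: "u > 0" "u\<^sup>2 = 1/2 - x\<^sup>2 * m" using xm[OF x] by (auto simp: u_def)
        have q: "1 - x\<^sup>2 * m > 0" using xm[OF x] by simp
        have "((\<lambda>x. - (1 / (3 * m)) * arctan (sqrt 2 * sqrt (1/2 - x\<^sup>2 * m))) has_real_derivative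
            - (1 / (3 * m)) * (sqrt 2 * (- (x * m) / u) / (1 + (sqrt 2 * u)\<^sup>2))) (at x)"
          unfolding u_def using xm[OF x] m
          by (auto intro!: derivative_eq_intros simp: inverse_eq_divide)
        also have "1 + (sqrt 2 * u)\<^sup>2 = 2 * (1 - x\<^sup>2 * m)" by (simp add: power_mult_distrib u(2))
        also have "- (1 / (3 * m)) * (sqrt 2 * (- (x * m) / u) / (2 * (1 - x\<^sup>2 * m))) = (sqrt 2 / 2) * x / (3 * (1 - x\<^sup>2 * m) * u)"
          using m u(1) q by (simp add: divide_simps)
        also have "sqrt 2 / 2 = h" by (simp add: h_def real_sqrt_divide field_simps)
        finally show "((\<lambda>x. - (1 / (3 * m)) * arctan (sqrt 2 * sqrt (1/2 - x\<^sup>2 * m))) has_real_derivative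
            h * x / (3 * (1 - x\<^sup>2 * m) * sqrt (1/2 - x\<^sup>2 * m))) (at x)" unfolding u_def .
        show "0 \<le> h * x / (3 * (1 - x\<^sup>2 * m) * sqrt (1/2 - x\<^sup>2 * m))"
          using x u(1) q h by (simp add: u_def[symmetric])
      next
        have "sqrt 2 * sqrt (1/2 - (1/2)\<^sup>2 * m) = sqrt ((1 - t\<^sup>2) / 2)"
          unfolding real_sqrt_mult[symmetric] by (simp add: m_def power2_eq_square field_simps)
        moreover have "sqrt 2 * sqrt (1/2 - 0\<^sup>2 * m) = 1" by (simp add: real_sqrt_mult[symmetric])
        ultimately show "- (1 / (3 * m)) * arctan (sqrt 2 * sqrt (1/2 - (1/2)\<^sup>2 * m)) - - (1 / (3 * m)) * arctan (sqrt 2 * sqrt (1/2 - 0\<^sup>2 * m))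
          = 1 / 3 * ((pi / 4 - arctan (sqrt ((1 - t\<^sup>2) / 2))) / (1 + t\<^sup>2))"
          by (simp add: arctan_one m_def[symmetric] diff_divide_distrib)
      qed simp_all
    qed
    show "AE t in lborel. (\<integral>\<^sup>+x. ennreal (x * g x (x * t)) * indicator {0..1/2} x \<partial>lborel) * indicator {0..1} t
       = ennreal (1 / 3 * ((pi / 4 - arctan (sqrt ((1 - t\<^sup>2) / 2))) / (1 + t\<^sup>2))) * indicator {0..1} t"
      using AE_lborel_singleton[of 1] by eventually_elim (auto simp: xint split: split_indicator)
  qed
  also have "\<dots> = ennreal (1 / 3) * (\<integral>\<^sup>+t. ennreal ((pi / 4 - arctan (sqrt ((1 - t\<^sup>2) / 2))) / (1 + t\<^sup>2)) * indicator {0..1} t \<partial>lborel)"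
    by (subst nn_integral_cmult[symmetric], measurable) (intro nn_integral_cong, subst ennreal_mult', simp, rule mult.assoc)
  also have "\<dots> = ennreal (pi\<^sup>2 / 144)"
    unfolding arctan_deficit_integral by (simp add: ennreal_mult[symmetric])
  finally show ?thesis unfolding h_def .
qed

section \<open>Horoballs in half-space coordinates\<close>

lemma future_of_neg:
  assumes "lorentz x x \<le> 0" "lorentz y y \<le> 0" "fst y > 0" "lorentz x y < 0"
  shows "fst x > 0"
proof (rule ccontr)
  assume neg: "\<not> fst x > 0"
  have "- (snd x \<bullet> snd y) \<le> norm (snd x) * norm (snd y)"
    using norm_cauchy_schwarz[of "snd x" "- snd y"] by simp
  also have "\<dots> \<le> (- fst x) * fst y"
    using assms neg by (intro mult_mono) (auto simp: causal_norm_le)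
  finally show False using assms(4) by (simp add: lorentz_def)
qed

lemma lorentz_future_nonpos:
  assumes "lorentz x x \<le> 0" "fst x \<ge> 0" "lorentz y y \<le> 0" "fst y \<ge> 0"
  shows "lorentz x y \<le> 0"
proof -
  have "snd x \<bullet> snd y \<le> norm (snd x) * norm (snd y)" by (rule norm_cauchy_schwarz)
  also have "\<dots> \<le> fst x * fst y"
    using assms by (intro mult_mono) (auto simp: causal_norm_le)
  finally show ?thesis by (simp add: lorentz_def)
qed

lemma proj_lift: "proj (lift v) = v" by (simp add: proj_def)

lemma lorentz_lift_ball: "v \<in> ball 0 1 \<longleftrightarrow> lorentz (lift v) (lift v) < 0"
  using proj_in_ball[of "lift v"] by (simp add: proj_lift)

lemma lorentz_lift_sphere: "norm v = 1 \<longleftrightarrow> lorentz (lift v) (lift v) = 0"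
proof -
  have "norm v = 1 \<longleftrightarrow> (norm v)\<^sup>2 = 1" by (metis norm_ge_zero one_power2 power2_eq_iff_nonneg zero_le_one)
  then show ?thesis by (simp add: lorentz_def dot_square_norm)
qed

lemma lorentz_lift_proj_self: "fst x \<noteq> 0 \<Longrightarrow> lorentz (lift (proj x)) (lift (proj x)) = lorentz x x / (fst x)\<^sup>2"
  by (simp add: lift_proj lorentz_linear power2_eq_square)

lemma proj_norm_1: "fst x > 0 \<Longrightarrow> norm (proj x) = 1 \<longleftrightarrow> lorentz x x = 0"
  by (simp add: lorentz_lift_sphere lorentz_lift_proj_self)

text \<open>Homogeneity: both the point and the centre may be given by arbitrary vectors of their rays.\<close>
lemma horoball_proj_iff:
  assumes "fst x > 0" "lorentz x x < 0" "fst n > 0"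
  shows "proj x \<in> horoball (proj n) r \<longleftrightarrow> - lorentz x n \<le> r * fst n * sqrt (- lorentz x x)"
proof -
  have q: "sqrt (- lorentz x x) > 0" using assms by simp
  have "- lorentz (lift (proj x)) (lift (proj n)) = - lorentz x n / (fst x * fst n)"
    using assms by (simp add: lift_proj lorentz_linear)
  moreover have "sqrt (- lorentz (lift (proj x)) (lift (proj x))) = sqrt (- lorentz x x) / fst x"
  proof -
    have "- lorentz (lift (proj x)) (lift (proj x)) = (- lorentz x x) / (fst x)\<^sup>2"
      using assms by (simp add: lorentz_lift_proj_self)
    then have "sqrt (- lorentz (lift (proj x)) (lift (proj x))) = sqrt (- lorentz x x) / sqrt ((fst x)\<^sup>2)"
      by (simp only: real_sqrt_divide)
    then show ?thesis using assms by simp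
  qed
  moreover have "proj x \<in> ball 0 1" using assms by (simp only: proj_in_ball)
  ultimately have "proj x \<in> horoball (proj n) r \<longleftrightarrow> - lorentz x n / (fst x * fst n) / (sqrt (- lorentz x x) / fst x) \<le> r"
    unfolding horoball_def by simp
  also have "- lorentz x n / (fst x * fst n) / (sqrt (- lorentz x x) / fst x) = - lorentz x n / (fst n * sqrt (- lorentz x x))"
    using assms q by simp
  also have "\<dots> \<le> r \<longleftrightarrow> - lorentz x n \<le> r * fst n * sqrt (- lorentz x x)"
    using pos_divide_le_eq[of "fst n * sqrt (- lorentz x x)" "- lorentz x n" r] assms q by (simp add: mult.assoc)
  finally show ?thesis .
qed

lemma horoball_mono: "s \<le> r \<Longrightarrow> horoball p s \<subseteq> horoball p r"
  by (auto simp: horoball_def)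

lemma horoball_measurable[measurable]: "horoball (p :: real^4) r \<in> sets borel"
proof -
  have [measurable]: "ball 0 1 \<in> sets (borel :: (real^4) measure)" by simp
  show ?thesis unfolding horoball_def by measurable
qed

lemma polytope_of_measurable[measurable]: "polytope_of b \<in> sets (borel :: (real^4) measure)"
proof -
  have [measurable]: "cball 0 1 \<in> sets (borel :: (real^4) measure)" by simp
  show ?thesis unfolding polytope_of_def by measurable
qed

text \<open>The volume over a unit of base above the squared height \<open>t0\<close>.\<close>
lemma nn_integral_powr_tail:
  assumes "t0 > (0::real)"
  shows "(\<integral>\<^sup>+t. ennreal (t powr (- 5 / 2) / 2) * indicator {t0..} t \<partial>lborel) = ennreal (t0 powr (- 3 / 2) / 3)"
proof -
  have "((\<lambda>t::real. t powr (- 3 / 2)) \<longlongrightarrow> 0) at_top"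
    by (intro tendsto_neg_powr filterlim_ident) simp
  then have "((\<lambda>t::real. - (t powr (- 3 / 2) / 3)) \<longlongrightarrow> - (0 / 3)) at_top"
    by (intro tendsto_minus tendsto_divide tendsto_const) simp_all
  then have "(\<integral>\<^sup>+t. ennreal (t powr (- 5 / 2) / 2) * indicator {t0..} t \<partial>lborel) = ennreal (0 - - (t0 powr (- 3 / 2) / 3))"
    using assms by (intro nn_integral_FTC_atLeast) (auto intro!: derivative_eq_intros)
  then show ?thesis by simp
qed

context half_space_frame begin

lemma lorentz_point_N: "lorentz (point (x, y, z, t)) N = - 1 / 2"
  by (simp add: point_def lorentz_vec_at_N)

lemma vec_at_exists: "\<exists>a x y z b. v = vec_at (a, x, y, z, b)"
proof -
  have "surj vec_at" using nn_integral_vec_at(2)[of "\<lambda>_. 0"] by simp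
  then obtain p where p: "v = vec_at p" by (metis surjD)
  obtain a x y z b where "p = (a, x, y, z, b)" by (cases p)
  with p show ?thesis by blast
qed

text \<open>
  A vector with positive first coordinate spans the same ray as a \<open>point\<close>, whose squared height is
  negative if the vector is spacelike.
\<close>
lemma vec_at_eq_point:
  "a > 0 \<Longrightarrow> vec_at (a, x, y, z, b) = a *\<^sub>R point (x / a, y / a, z / a, b / a - (x / a)\<^sup>2 - (y / a)\<^sup>2 - (z / a)\<^sup>2)"
  using vec_at_scaled_point[of a "x / a" "y / a" "z / a" "b / a - (x / a)\<^sup>2 - (y / a)\<^sup>2 - (z / a)\<^sup>2"] by simp

lemma ball_point_exists:
  assumes "v \<in> ball 0 1"
  obtains x y z t where "t > 0" "v = proj (point (x, y, z, t))"
proof -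
  obtain a x y z b where v: "lift v = vec_at (a, x, y, z, b)" using vec_at_exists by blast
  have q: "lorentz (lift v) (lift v) < 0" using assms by (simp only: lorentz_lift_ball)
  have a: "a > 0" using fst_vec_at_pos[of a x y z b] q unfolding v[symmetric] by simp
  define t where "t = b / a - (x / a)\<^sup>2 - (y / a)\<^sup>2 - (z / a)\<^sup>2"
  have l: "lift v = a *\<^sub>R point (x / a, y / a, z / a, t)"
    unfolding v t_def using a by (rule vec_at_eq_point)
  have "lorentz (lift v) (lift v) = - (a\<^sup>2 * t)"
    unfolding l by (simp add: lorentz_linear lorentz_point_self power2_eq_square)
  then have "t > 0" using q a by (simp add: zero_less_mult_iff)
  moreover have "v = proj (point (x / a, y / a, z / a, t))"
    using a by (metis l proj_lift proj_scaleR less_irrefl)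
  ultimately show thesis by (rule that)
qed

lemma fst_point_0_pos: "t \<ge> 0 \<Longrightarrow> fst (point (x, y, z, t)) > 0"
  by (rule future_of_neg[where y = N]) (use future in \<open>simp_all add: lorentz_point_self lorentz_point_N gram\<close>)

lemma sphere_point_exists:
  assumes "norm v = 1"
  shows "v = proj N \<or> (\<exists>x y z. v = proj (point (x, y, z, 0)))"
proof -
  obtain a x y z b where v: "lift v = vec_at (a, x, y, z, b)" using vec_at_exists by blast
  have q: "lorentz (lift v) (lift v) = 0" using assms by (simp only: lorentz_lift_sphere)
  have "lorentz (lift v) N \<le> 0" by (rule lorentz_future_nonpos) (use q future gram in auto)
  then have a: "a \<ge> 0" unfolding v lorentz_vec_at_N by simp
  have q': "x\<^sup>2 + y\<^sup>2 + z\<^sup>2 = a * b" using q unfolding v lorentz_vec_at by (simp add: power2_eq_square)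
  show ?thesis
  proof (cases "a = 0")
    case True
    then have "x = 0 \<and> y = 0 \<and> z = 0" using q' by (simp add: add_nonneg_eq_0_iff)
    then have l: "lift v = b *\<^sub>R N" using v True by (simp add: vec_at_def)
    then have "b \<noteq> 0" by auto (metis fst_conv fst_zero scaleR_zero_left zero_neq_one)
    then show ?thesis by (metis l proj_lift proj_scaleR)
  next
    case False
    then have a: "a > 0" using a by simp
    have "b / a - (x / a)\<^sup>2 - (y / a)\<^sup>2 - (z / a)\<^sup>2 = (a * b - (x\<^sup>2 + y\<^sup>2 + z\<^sup>2)) / a\<^sup>2"
      using a by (simp add: power_divide diff_divide_distrib add_divide_distrib power2_eq_square)
    also have "\<dots> = 0" using q' by simp
    finally have "lift v = a *\<^sub>R point (x / a, y / a, z / a, 0)"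
      unfolding v using vec_at_eq_point[OF a] by simp
    then show ?thesis using a by (metis proj_lift proj_scaleR less_irrefl)
  qed
qed

lemma lorentz_lift_point: "t \<ge> 0 \<Longrightarrow> lorentz (lift (proj (point (x, y, z, t)))) w \<le> 0 \<longleftrightarrow> lorentz (point (x, y, z, t)) w \<le> 0"
  using fst_point_0_pos[of t x y z] by (simp add: lorentz_lift_proj divide_le_0_iff)

lemma point_in_ball: "t > 0 \<Longrightarrow> proj (point (x, y, z, t)) \<in> ball 0 1"
  using fst_point_pos[of t x y z] by (simp only: proj_in_ball lorentz_point_self)

text \<open>A horoball centred at infinity is the part of the half-space above a fixed height.\<close>
lemma point_in_horoball:
  assumes "t > 0" "r > 0"
  shows "proj (point (x, y, z, t)) \<in> horoball (proj N) r \<longleftrightarrow> (1 / (2 * r * fst N))\<^sup>2 \<le> t"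
proof -
  have neg: "lorentz (point (x, y, z, t)) (point (x, y, z, t)) < 0"
    unfolding lorentz_point_self using assms by simp
  have "proj (point (x, y, z, t)) \<in> horoball (proj N) r \<longleftrightarrow> 1 / 2 \<le> r * fst N * sqrt t"
    using horoball_proj_iff[OF fst_point_pos[OF assms(1)] neg future, of r]
    unfolding lorentz_point_self lorentz_point_N by (simp only: minus_minus minus_divide_left)
  also have "\<dots> \<longleftrightarrow> 1 / (2 * r * fst N) \<le> sqrt t"
  proof -
    have "2 * r * fst N > 0" using assms future by simp
    then have "1 / (2 * r * fst N) \<le> sqrt t \<longleftrightarrow> 1 \<le> sqrt t * (2 * r * fst N)" by (rule pos_divide_le_eq)
    then show ?thesis by (simp add: mult_ac)
  qed
  also have "\<dots> \<longleftrightarrow> (1 / (2 * r * fst N))\<^sup>2 \<le> t"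
  proof -
    have "1 / (2 * r * fst N) > 0" using assms future by simp
    then show ?thesis using assms(1)
      by (metis real_le_rsqrt real_sqrt_le_iff real_sqrt_abs abs_of_pos order_less_imp_le)
  qed
  finally show ?thesis .
qed

text \<open>
  A region above a graph over a base \<open>B\<close>. Positivity of the graph is required only almost everywhere,
  since a region may touch the boundary at an ideal vertex.
\<close>
lemma emeasure_region_above:
  fixes g :: "real \<times> real \<times> real \<Rightarrow> real"
  assumes [measurable]: "S \<in> sets borel" "B \<in> sets borel" "g \<in> borel_measurable borel"
    and S: "\<And>x y z t. t > 0 \<Longrightarrow> proj (point (x, y, z, t)) \<in> S \<longleftrightarrow> (x, y, z) \<in> B \<and> g (x, y, z) \<le> t"
    and pos: "AE p in lborel. p \<in> B \<longrightarrow> g p > 0"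
  shows "emeasure hyp_measure S = (\<integral>\<^sup>+p. ennreal (g p powr (- 3 / 2) / 3) * indicator B p \<partial>lborel)"
proof -
  define h where "h p = ennreal ((snd (snd (snd p))) powr (- 5 / 2) / 2) *
      indicator {p. snd (snd (snd p)) > 0 \<and> proj (point p) \<in> S} p" for p
  have [measurable]: "h \<in> borel_measurable borel" unfolding h_def by measurable
  define h' where "h' = (\<lambda>(x, y, z). \<integral>\<^sup>+t. h (x, y, z, t) \<partial>lborel)"
  have [measurable]: "h' \<in> borel_measurable borel" unfolding h'_def by measurable
  have "emeasure hyp_measure S = (\<integral>\<^sup>+p. h p \<partial>lborel)"
    unfolding h_def by (rule emeasure_half_space) measurable
  also have "\<dots> = (\<integral>\<^sup>+p. h' p \<partial>lborel)"
    by (simp add: nn_integral_lborel_4 nn_integral_lborel_3 h'_def)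
  also have "\<dots> = (\<integral>\<^sup>+p. ennreal (g p powr (- 3 / 2) / 3) * indicator B p \<partial>lborel)"
  proof (rule nn_integral_cong_AE)
    show "AE p in lborel. h' p = ennreal (g p powr (- 3 / 2) / 3) * indicator B p"
      using pos
    proof eventually_elim
      fix p assume p: "p \<in> B \<longrightarrow> g p > 0"
      obtain x y z where xyz: "p = (x, y, z)" by (cases p)
      have "h (x, y, z, t) = (ennreal (t powr (- 5 / 2) / 2) * indicator {g p..} t) * indicator B p" for t
        using p S[of t x y z] by (auto simp: h_def xyz indicator_def)
      then have "h' p = (\<integral>\<^sup>+t. (ennreal (t powr (- 5 / 2) / 2) * indicator {g p..} t) * indicator B p \<partial>lborel)"
        by (simp add: h'_def xyz)
      also have "\<dots> = (\<integral>\<^sup>+t. ennreal (t powr (- 5 / 2) / 2) * indicator {g p..} t \<partial>lborel) * indicator B p"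
        by (rule nn_integral_multc) measurable
      also have "\<dots> = ennreal (g p powr (- 3 / 2) / 3) * indicator B p"
        using p nn_integral_powr_tail[of "g p"] by (cases "p \<in> B") auto
      finally show "h' p = ennreal (g p powr (- 3 / 2) / 3) * indicator B p" .
    qed
  qed
  finally show ?thesis .
qed

text \<open>
  A polytope with a vertex at infinity is, above height 1, a cylinder over its base, and so is its part inside the
  horoball.
\<close>
lemma emeasure_horoball_inter:
  assumes [measurable]: "S \<in> sets borel" "B \<in> sets borel"
    and S: "\<And>x y z t. t \<ge> 1 \<Longrightarrow> proj (point (x, y, z, t)) \<in> S \<longleftrightarrow> (x, y, z) \<in> B"
    and r: "0 < r" "r \<le> 1 / (2 * fst N)"
  shows "emeasure hyp_measure (horoball (proj N) r \<inter> S) = ennreal ((2 * r * fst N) ^ 3 / 3) * emeasure lborel B"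
proof -
  define t0 where "t0 = (1 / (2 * r * fst N))\<^sup>2"
  have w: "0 < 2 * r * fst N" "2 * r * fst N \<le> 1"
    using r future by (simp_all add: field_simps)
  have t0: "t0 \<ge> 1" unfolding t0_def by (rule one_le_power) (use w in simp)
  have "emeasure hyp_measure (horoball (proj N) r \<inter> S) = (\<integral>\<^sup>+p. ennreal (t0 powr (- 3 / 2) / 3) * indicator B p \<partial>lborel)"
  proof (rule emeasure_region_above)
    fix x y z t :: real assume t: "t > 0"
    show "proj (point (x, y, z, t)) \<in> horoball (proj N) r \<inter> S \<longleftrightarrow> (x, y, z) \<in> B \<and> t0 \<le> t"
      using point_in_horoball[OF t r(1), of x y z] S[of t x y z] t0 by (auto simp: t0_def[symmetric])
  qed (use t0 in auto)
  also have "\<dots> = ennreal (t0 powr (- 3 / 2) / 3) * emeasure lborel B"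
    by (simp add: nn_integral_cmult)
  also have "t0 powr (- 3 / 2) = (2 * r * fst N) ^ 3"
  proof -
    have "t0 = (2 * r * fst N) powr (- 2)"
      using w by (simp add: t0_def powr_minus power_divide powr_numeral field_simps)
    then show ?thesis using w by (simp add: powr_powr powr_numeral)
  qed
  finally show ?thesis .
qed

text \<open>
  If every wall that misses the point at infinity stays below height 1 and one such wall attains this height, over
  \<open>(x0, y0, z0)\<close>, then the horoballs that extend beyond none of them are those contained in the part
  above height 1.
\<close>
lemma admissible_horoball_iff:
  fixes b :: "nat \<Rightarrow> real \<times> (real^4)"
  assumes above: "\<And>i x y z t. i \<le> 5 \<Longrightarrow> lorentz N (b i) \<noteq> 0 \<Longrightarrow> t \<ge> 1 \<Longrightarrow> lorentz (point (x, y, z, t)) (b i) \<le> 0"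
    and touch: "i0 \<le> 5" "lorentz N (b i0) \<noteq> 0"
      "\<And>t. 0 < t \<Longrightarrow> lorentz (point (x0, y0, z0, t)) (b i0) \<le> 0 \<Longrightarrow> t \<ge> 1"
  shows "admissible_horoball b (proj N) r \<longleftrightarrow> 0 < r \<and> r \<le> 1 / (2 * fst N)"
proof -
  define t0 where "t0 = (1 / (2 * r * fst N))\<^sup>2"
  have nz: "lorentz (lift (proj N)) (b i) \<noteq> 0 \<longleftrightarrow> lorentz N (b i) \<noteq> 0" for i
    using future by (simp add: lorentz_lift_proj)
  have t01: "t0 \<ge> 1 \<longleftrightarrow> r \<le> 1 / (2 * fst N)" if "r > 0"
  proof -
    have "t0 \<ge> 1 \<longleftrightarrow> 1 / (2 * r * fst N) \<ge> 1" unfolding t0_def using that future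
      by (metis abs_1 abs_le_square_iff abs_of_pos divide_pos_pos less_numeral_extra(1) mult_pos_pos one_power2 zero_less_numeral)
    then show ?thesis using that future by (simp add: field_simps)
  qed
  show ?thesis
  proof
    assume a: "admissible_horoball b (proj N) r"
    then have r: "r > 0" by (simp add: admissible_horoball_def)
    have t0: "t0 > 0" using r future by (simp add: t0_def)
    have "proj (point (x0, y0, z0, t0)) \<in> horoball (proj N) r"
      using point_in_horoball[OF t0 r] by (simp add: t0_def)
    then have "lorentz (lift (proj (point (x0, y0, z0, t0)))) (b i0) \<le> 0"
      using a touch nz by (auto simp: admissible_horoball_def)
    then have "t0 \<ge> 1" using touch(3) t0 by (simp add: lorentz_lift_point)
    then show "0 < r \<and> r \<le> 1 / (2 * fst N)" using r t01 by simp
  next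
    assume r: "0 < r \<and> r \<le> 1 / (2 * fst N)"
    show "admissible_horoball b (proj N) r"
      unfolding admissible_horoball_def
    proof (intro conjI allI impI ballI)
      fix i v assume i: "i \<le> DIM(real^4) + 1" "lorentz (lift (proj N)) (b i) \<noteq> 0" and v: "v \<in> horoball (proj N) r"
      have "v \<in> ball 0 1" using v by (simp add: horoball_def)
      then obtain x y z t where t: "t > 0" "v = proj (point (x, y, z, t))" by (rule ball_point_exists)
      have "t0 \<le> t" using v point_in_horoball[OF t(1)] r by (simp add: t(2) t0_def)
      then have "t \<ge> 1" using t01 r by simp
      then show "lorentz (lift v) (b i) \<le> 0" using above[of i t x y z] i nz t by (simp add: lorentz_lift_point)
    qed (use r in simp)
  qed
qed

lemma maximal_horoball_iff:
  fixes b :: "nat \<Rightarrow> real \<times> (real^4)"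
  assumes adm: "\<And>r. admissible_horoball b (proj N) r \<longleftrightarrow> 0 < r \<and> r \<le> 1 / (2 * fst N)"
  shows "maximal_horoball b (proj N) r \<longleftrightarrow> r = 1 / (2 * fst N)"
proof
  assume m: "maximal_horoball b (proj N) r"
  then have r: "0 < r" "r \<le> 1 / (2 * fst N)" using adm by (auto simp: maximal_horoball_def)
  have one: "proj (point (0, 0, 0, 1)) \<in> horoball (proj N) (1 / (2 * fst N))"
    using future by (subst point_in_horoball) auto
  have "horoball (proj N) (1 / (2 * fst N)) \<subseteq> horoball (proj N) r"
    using m adm future by (auto simp: maximal_horoball_def)
  then have "(1 / (2 * r * fst N))\<^sup>2 \<le> 1" using one point_in_horoball[of 1 r 0 0 0] r by auto
  then have "1 / (2 * r * fst N) \<le> 1" using r future by (simp add: power_le_one_iff abs_square_le_1)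
  then show "r = 1 / (2 * fst N)" using r future by (simp add: field_simps)
next
  assume "r = 1 / (2 * fst N)"
  then show "maximal_horoball b (proj N) r" using future by (auto simp: maximal_horoball_def adm intro: subsetD[OF horoball_mono])
qed

end

section \<open>Truncated orthoschemes as regions above a hemisphere\<close>

text \<open>
  By strict convexity of the ball, a point of the sphere is an extreme point of every subset of the closed ball that
  contains it.
\<close>
lemma ideal_vertices_eq: "ideal_vertices b = {v \<in> polytope_of b. norm v = 1}"
proof -
  have "v extreme_point_of polytope_of b" if v: "v \<in> polytope_of b" "norm v = 1" for v
    unfolding extreme_point_of_def
  proof (intro conjI ballI notI)
    fix x y assume xy: "x \<in> polytope_of b" "y \<in> polytope_of b" "v \<in> open_segment x y"
    then have "norm x \<le> 1" "norm y \<le> 1" by (auto simp: polytope_of_def)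
    then have "norm v < 1"
      using dist_decreases_open_segment[OF xy(3), of 0] by (auto simp: dist_norm)
    then show False using v by simp
  qed (use v in simp)
  then show ?thesis by (auto simp: ideal_vertices_def extreme_point_of_def)
qed

text \<open>
  The convex function \<open>q powr (-3/2)\<close> lies above its tangent at \<open>a\<close>. With \<open>s = sqrt
  (q/a)\<close> the difference has the sign of \<open>3 s\<^sup>5 - 5 s\<^sup>3 + 2\<close>, which has a double zero
  at \<open>s = 1\<close>.
\<close>
lemma powr_tangent_bound:
  fixes q a :: real
  assumes q: "q > 0" and a: "a > 0"
  shows "a powr (- 3 / 2) * (5 / 2 - 3 / 2 * (q / a)) \<le> q powr (- 3 / 2)"
proof -
  define s where "s = sqrt (q / a)"
  have s: "s > 0" "s\<^sup>2 = q / a" using q a by (auto simp: s_def)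
  have "0 \<le> (s - 1)\<^sup>2 * (3 * s ^ 3 + 6 * s\<^sup>2 + 4 * s + 2)" using s(1) by simp
  also have "\<dots> = 3 * s\<^sup>2 * s ^ 3 - 5 * s ^ 3 + 2"
    by (simp add: power2_eq_square power3_eq_cube algebra_simps)
  finally have "(5 / 2 - 3 / 2 * s\<^sup>2) * s ^ 3 \<le> 1" by (simp add: algebra_simps)
  then have "5 / 2 - 3 / 2 * s\<^sup>2 \<le> 1 / s ^ 3" using s(1) by (simp add: pos_le_divide_eq)
  also have "1 / s ^ 3 = (q / a) powr (- 3 / 2)"
    using q a by (subst powr_minus_three_halves) (simp_all add: s_def power3_eq_cube)
  finally have "a powr (- 3 / 2) * (5 / 2 - 3 / 2 * (q / a)) \<le> a powr (- 3 / 2) * (q / a) powr (- 3 / 2)"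
    unfolding s(2) by (intro mult_left_mono) auto
  also have "a powr (- 3 / 2) * (q / a) powr (- 3 / 2) = q powr (- 3 / 2)"
    using q a by (simp add: powr_mult[symmetric])
  finally show ?thesis .
qed

lemma all_le_5: "(\<forall>i\<le>5. Q i) \<longleftrightarrow> Q 0 \<and> Q (Suc 0) \<and> Q 2 \<and> Q 3 \<and> Q 4 \<and> Q (5::nat)"
proof -
  have "{..5::nat} = {0, Suc 0, 2, 3, 4, 5}" by auto
  moreover have "(\<forall>i\<le>5. Q i) \<longleftrightarrow> (\<forall>i\<in>{..5}. Q i)" by (simp only: atMost_iff Ball_def)
  ultimately show ?thesis by simp
qed

text \<open>
  The normals of a truncated orthoscheme, with \<open>C = cos (\<pi>/m\<^sub>1)\<close>, \<open>S = cos
  (\<pi>/m\<^sub>2)\<close>, \<open>c = cos (\<pi>/m\<^sub>3)\<close> and \<open>L = cos (\<pi>/m\<^sub>4)\<close>.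
  That \<open>C\<^sup>2 + S\<^sup>2 = 1\<close> expresses \<open>1/m\<^sub>1 + 1/m\<^sub>2 = 1/2\<close>, so that
  \<open>H\<^sup>0, H\<^sup>1, H\<^sup>2\<close> have a common ideal point. The inequality says that the base prism
  seen from this point lies in the closed unit ball.
\<close>
locale truncated_scheme =
  fixes b :: "nat \<Rightarrow> real \<times> (real^4)" and C S c L :: real
  assumes norm_b: "\<And>i. i \<le> 5 \<Longrightarrow> lorentz (b i) (b i) = 1"
    and adjacent: "lorentz (b 0) (b (Suc 0)) = - C" "lorentz (b (Suc 0)) (b 2) = - S" "lorentz (b 2) (b 3) = - c"
      "lorentz (b 3) (b 4) = - L" "lorentz (b 4) (b 5) = - 1"
    and far: "\<And>i j. j \<le> 5 \<Longrightarrow> i + 2 \<le> j \<Longrightarrow> lorentz (b i) (b j) = 0"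
    and params: "C\<^sup>2 + S\<^sup>2 = 1" "C > 0" "S > 0" "c > 0" "L > 0" "c\<^sup>2 + (c * (S / C))\<^sup>2 + L\<^sup>2 \<le> 1"
    and interior: "\<exists>v\<in>ball 0 1. \<forall>i\<le>5. lorentz (lift v) (b i) < 0"
begin

lemma lorentz_b:
  "lorentz (b 0) (b 0) = 1" "lorentz (b (Suc 0)) (b (Suc 0)) = 1" "lorentz (b 2) (b 2) = 1"
  "lorentz (b 3) (b 3) = 1" "lorentz (b 4) (b 4) = 1" "lorentz (b 5) (b 5) = 1"
  "lorentz (b 0) (b 2) = 0" "lorentz (b 0) (b 3) = 0" "lorentz (b 0) (b 4) = 0" "lorentz (b 0) (b 5) = 0"
  "lorentz (b (Suc 0)) (b 3) = 0" "lorentz (b (Suc 0)) (b 4) = 0" "lorentz (b (Suc 0)) (b 5) = 0"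
  "lorentz (b 2) (b 4) = 0" "lorentz (b 2) (b 5) = 0" "lorentz (b 3) (b 5) = 0"
  by (simp_all add: norm_b far)

lemmas gram_b = lorentz_b adjacent lorentz_b[THEN trans[OF lorentz_commute]] adjacent[THEN trans[OF lorentz_commute]]

text \<open>
  The sum of the normals of the parallel walls \<open>H\<^sup>4\<close> and \<open>H\<^sup>5\<close> is null and
  represents their common ideal point \<open>A\<^sub>3\<close>. The scale of \<open>N\<close> and the choice of
  \<open>E\<close> make \<open>H\<^sup>3\<close> the unit hemisphere about the origin.
\<close>
definition N where "N = (1 / (2 * L)) *\<^sub>R (b 4 + b 5)"
definition E where "E = b 3 + N"
definition F\<^sub>1 where "F\<^sub>1 = (- 1 / S) *\<^sub>R (b (Suc 0) + C *\<^sub>R b 0)"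
definition F\<^sub>2 where "F\<^sub>2 = - b 0"
definition F\<^sub>3 where "F\<^sub>3 = - b 5"

lemmas frame_defs = E_def F\<^sub>1_def F\<^sub>2_def F\<^sub>3_def N_def

sublocale half_space_frame E F\<^sub>1 F\<^sub>2 F\<^sub>3 N
proof
  have S2: "1 - C * C = S * S" using params(1) by (simp add: power2_eq_square)
  note P = params(2-5)
  show "lorentz E E = 0" "lorentz N N = 0" "lorentz E N = -1/2"
    "lorentz F\<^sub>2 F\<^sub>2 = 1" "lorentz F\<^sub>3 F\<^sub>3 = 1" "lorentz F\<^sub>2 F\<^sub>3 = 0"
    "lorentz F\<^sub>1 F\<^sub>2 = 0" "lorentz F\<^sub>1 F\<^sub>3 = 0"
    "lorentz E F\<^sub>1 = 0" "lorentz E F\<^sub>2 = 0" "lorentz E F\<^sub>3 = 0"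
    "lorentz N F\<^sub>1 = 0" "lorentz N F\<^sub>2 = 0" "lorentz N F\<^sub>3 = 0"
    using P by (simp_all add: frame_defs lorentz_linear gram_b)
  have "lorentz F\<^sub>1 F\<^sub>1 = (1 - C * C) / (S * S)"
    by (simp add: frame_defs lorentz_linear gram_b)
  then show "lorentz F\<^sub>1 F\<^sub>1 = 1" using P by (simp add: S2)
  obtain v where v: "v \<in> ball 0 1" "\<forall>i\<le>5. lorentz (lift v) (b i) < 0" using interior by blast
  have "lorentz (lift v) (b 4) < 0" "lorentz (lift v) (b 5) < 0" using v by auto
  then have "lorentz (lift v) N < 0" using P
    by (simp add: N_def lorentz_linear divide_less_0_iff)
  then have "lorentz N (lift v) < 0" by (simp only: lorentz_commute)
  moreover have "lorentz (lift v) (lift v) < 0" using v by (simp only: lorentz_lift_ball)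
  ultimately show "fst N > 0"
    by (intro future_of_neg[of N "lift v"]) (use P in \<open>simp_all add: N_def lorentz_linear gram_b\<close>)
qed

text \<open>
  Nondegeneracy in terms of the frame; it is used to find the linear relation between the six normals in
  five-dimensional space.
\<close>
lemma eq_if_lorentz_eq:
  assumes "lorentz u E = lorentz w E" "lorentz u F\<^sub>1 = lorentz w F\<^sub>1" "lorentz u F\<^sub>2 = lorentz w F\<^sub>2"
    "lorentz u F\<^sub>3 = lorentz w F\<^sub>3" "lorentz u N = lorentz w N"
  shows "u = w"
proof -
  have "lorentz (u - w) y = 0" for y
  proof -
    obtain a x y' z b where y: "y = vec_at (a, x, y', z, b)" using vec_at_exists by blast
    show ?thesis using assms by (simp add: y vec_at_def lorentz_linear)
  qed
  then have "u - w = 0" by (rule lorentz_nondegenerate)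
  then show ?thesis by simp
qed

lemma b_eq:
  "b 0 = - F\<^sub>2" "b (Suc 0) = - S *\<^sub>R F\<^sub>1 + C *\<^sub>R F\<^sub>2" "b 2 = F\<^sub>1 + (2 * c) *\<^sub>R N"
  "b 3 = E - N" "b 4 = F\<^sub>3 + (2 * L) *\<^sub>R N" "b 5 = - F\<^sub>3"
proof -
  show "b 2 = F\<^sub>1 + (2 * c) *\<^sub>R N"
    by (rule eq_if_lorentz_eq) (use params(2-5) in \<open>simp_all add: frame_defs lorentz_linear gram_b field_simps\<close>,
        use params(1) in \<open>simp add: power2_eq_square\<close>)
qed (use params in \<open>simp_all add: frame_defs algebra_simps\<close>)

lemma b_eq_vec_at:
  "b 0 = vec_at (0, 0, - 1, 0, 0)" "b (Suc 0) = vec_at (0, - S, C, 0, 0)" "b 2 = vec_at (0, 1, 0, 0, 2 * c)"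
  "b 3 = vec_at (1, 0, 0, 0, - 1)" "b 4 = vec_at (0, 0, 0, 1, 2 * L)" "b 5 = vec_at (0, 0, 0, - 1, 0)"
  by (simp_all add: b_eq vec_at_def)

lemma lorentz_N_b:
  "lorentz N (b 0) = 0" "lorentz N (b (Suc 0)) = 0" "lorentz N (b 2) = 0"
  "lorentz N (b 3) = - 1 / 2" "lorentz N (b 4) = 0" "lorentz N (b 5) = 0"
  by (simp_all add: b_eq_vec_at lorentz_commute[of N] lorentz_vec_at_N)

lemma lorentz_point_b:
  "lorentz (point (x, y, z, t)) (b 0) = - y"
  "lorentz (point (x, y, z, t)) (b (Suc 0)) = C * y - S * x"
  "lorentz (point (x, y, z, t)) (b 2) = x - c"
  "lorentz (point (x, y, z, t)) (b 3) = (1 - (x\<^sup>2 + y\<^sup>2 + z\<^sup>2 + t)) / 2"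
  "lorentz (point (x, y, z, t)) (b 4) = z - L"
  "lorentz (point (x, y, z, t)) (b 5) = - z"
  by (simp_all add: b_eq_vec_at point_def lorentz_vec_at) (simp add: field_simps)

abbreviation k where "k \<equiv> S / C"

lemma k_pos: "k > 0" using params by simp

text \<open>
  The polytope is the part of the vertical prism over its base that lies above the unit hemisphere
  \<open>H\<^sup>3\<close>.
\<close>
lemma point_in_polytope:
  assumes "t \<ge> 0"
  shows "proj (point (x, y, z, t)) \<in> polytope_of b \<longleftrightarrow> (x, y, z) \<in> prism c k L \<and> 1 - x\<^sup>2 - y\<^sup>2 - z\<^sup>2 \<le> t"
proof -
  have "proj (point (x, y, z, t)) \<in> cball 0 1"
    using fst_point_0_pos[OF assms, of x y z] assms by (simp only: proj_in_cball lorentz_point_self)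
  moreover have "C * y - S * x \<le> 0 \<longleftrightarrow> y \<le> k * x" using params(2) by (simp add: field_simps)
  ultimately show ?thesis
    using assms by (auto simp: polytope_of_def all_le_5 lorentz_lift_point lorentz_point_b prism_def)
qed

lemma prism_bounds:
  assumes "(x, y, z) \<in> prism c k L"
  shows "0 \<le> x" "x \<le> c" "0 \<le> y" "y \<le> c * k" "0 \<le> z" "z \<le> L"
proof -
  show "0 \<le> y" "0 \<le> z" "z \<le> L" "x \<le> c" using assms by (auto simp: prism_def)
  have "0 \<le> k * x" "y \<le> k * x" using assms by (auto simp: prism_def)
  then show "0 \<le> x" using k_pos by (simp only: zero_le_mult_iff) auto
  have "y \<le> k * x" by fact
  also have "\<dots> \<le> k * c" using k_pos \<open>x \<le> c\<close> by (intro mult_left_mono) auto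
  finally show "y \<le> c * k" by (simp add: mult.commute)
qed

text \<open>
  The vertex of the base farthest from the origin is its only point that can lie on the unit sphere; then it is the
  ideal vertex \<open>A\<^sub>0\<close>.
\<close>
lemma prism_height:
  assumes "(x, y, z) \<in> prism c k L"
  shows "x\<^sup>2 + y\<^sup>2 + z\<^sup>2 \<le> 1"
    and "x\<^sup>2 + y\<^sup>2 + z\<^sup>2 = 1 \<Longrightarrow> x = c \<and> y = c * k \<and> z = L \<and> c\<^sup>2 + (c * k)\<^sup>2 + L\<^sup>2 = 1"
proof -
  note B = prism_bounds[OF assms]
  have sq: "x\<^sup>2 \<le> c\<^sup>2" "y\<^sup>2 \<le> (c * k)\<^sup>2" "z\<^sup>2 \<le> L\<^sup>2" using B by (auto intro!: power_mono)
  then show "x\<^sup>2 + y\<^sup>2 + z\<^sup>2 \<le> 1" using params(6) by linarith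
  assume "x\<^sup>2 + y\<^sup>2 + z\<^sup>2 = 1"
  then have eq: "x\<^sup>2 = c\<^sup>2" "y\<^sup>2 = (c * k)\<^sup>2" "z\<^sup>2 = L\<^sup>2" "c\<^sup>2 + (c * k)\<^sup>2 + L\<^sup>2 = 1"
    using sq params(6) by linarith+
  have "c * k > 0" using params k_pos by simp
  then show "x = c \<and> y = c * k \<and> z = L \<and> c\<^sup>2 + (c * k)\<^sup>2 + L\<^sup>2 = 1"
    using eq B params by (auto simp: power2_eq_iff_nonneg simp del: power_mult_distrib times_divide_eq_right)
qed

lemma prism_height_pos:
  assumes "(x, y, z) \<in> prism c k L" "(x, y, z) \<noteq> (c, c * k, L)"
  shows "1 - x\<^sup>2 - y\<^sup>2 - z\<^sup>2 > 0"
proof -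
  have "x\<^sup>2 + y\<^sup>2 + z\<^sup>2 \<noteq> 1" using prism_height(2)[OF assms(1)] assms(2) by blast
  then show ?thesis using prism_height(1)[OF assms(1)] by linarith
qed

lemma emeasure_polytope:
  "emeasure hyp_measure (polytope_of b) = (\<integral>\<^sup>+p. (case p of (x, y, z) \<Rightarrow> ennreal ((1 - x\<^sup>2 - y\<^sup>2 - z\<^sup>2) powr (- 3 / 2) / 3)) * indicator (prism c k L) p \<partial>lborel)"
proof -
  define g where "g = (\<lambda>(x, y, z). 1 - x\<^sup>2 - y\<^sup>2 - z\<^sup>2 :: real)"
  have [measurable]: "g \<in> borel_measurable borel" unfolding g_def by measurable
  have "emeasure hyp_measure (polytope_of b) = (\<integral>\<^sup>+p. ennreal (g p powr (- 3 / 2) / 3) * indicator (prism c k L) p \<partial>lborel)"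
  proof (rule emeasure_region_above)
    show "AE p in lborel. p \<in> prism c k L \<longrightarrow> g p > 0"
      using AE_lborel_singleton[of "(c, c * k, L)"]
    proof eventually_elim
      fix p :: "real \<times> real \<times> real" assume p: "p \<noteq> (c, c * k, L)"
      obtain x y z where xyz: "p = (x, y, z)" by (cases p)
      show "p \<in> prism c k L \<longrightarrow> g p > 0" using prism_height_pos[of x y z] p by (simp add: xyz g_def)
    qed
  qed (auto simp: point_in_polytope g_def)
  also have "\<dots> = (\<integral>\<^sup>+p. (case p of (x, y, z) \<Rightarrow> ennreal ((1 - x\<^sup>2 - y\<^sup>2 - z\<^sup>2) powr (- 3 / 2) / 3)) * indicator (prism c k L) p \<partial>lborel)"
    by (intro nn_integral_cong) (auto simp: g_def split: prod.split)
  finally show ?thesis .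
qed

lemma emeasure_prism: "emeasure lborel (prism c k L) = ennreal (c\<^sup>2 * k * L / 2)"
proof -
  have "emeasure lborel (prism c k L) = (\<integral>\<^sup>+p. (case p of (x, y, z) \<Rightarrow> ennreal (1 + 0 * (x\<^sup>2 + y\<^sup>2 + z\<^sup>2))) * indicator (prism c k L) p \<partial>lborel)"
    by (simp add: case_prod_unfold)
  then show ?thesis using params k_pos by (subst (asm) nn_integral_prism_quadratic) auto
qed

text \<open>
  Jensen's inequality for \<open>(1 - |p|\<^sup>2) powr (-3/2)\<close>, through the tangent at \<open>|p|\<^sup>2 =
  2/9\<close>: the integral of the tangent function over the base only depends on the mean of
  \<open>|p|\<^sup>2\<close>.
\<close>
lemma volume_lower_bound:
  assumes avg: "c\<^sup>2 / 2 + (c * k)\<^sup>2 / 6 + L\<^sup>2 / 3 \<ge> 2 / 9"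
  shows "ennreal (c\<^sup>2 * k * L / 2 / 3 * (7 / 9) powr (- 3 / 2)) \<le> emeasure hyp_measure (polytope_of b)"
proof -
  define A where "A = (7 / 9 :: real) powr (- 3 / 2) / 3"
  have A: "A \<ge> 0" by (simp add: A_def)
  have vol: "c\<^sup>2 * k * L / 2 \<ge> 0" using params k_pos by simp
  have lin: "1 \<le> 4 / 7 + 27 / 14 * u" if "2 / 9 \<le> u" for u :: real using that by simp
  have le: "c\<^sup>2 * k * L / 2 * A * 1 \<le> c\<^sup>2 * k * L / 2 * A * (4 / 7 + 27 / 14 * (c\<^sup>2 / 2 + (c * k)\<^sup>2 / 6 + L\<^sup>2 / 3))"
    by (intro mult_left_mono mult_nonneg_nonneg vol A lin avg)
  have "ennreal (c\<^sup>2 * k * L / 2 / 3 * (7 / 9) powr (- 3 / 2)) \<le> ennreal (c\<^sup>2 * k * L / 2 * (4 / 7 * A + 27 / 14 * A * (c\<^sup>2 / 2 + (c * k)\<^sup>2 / 6 + L\<^sup>2 / 3)))"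
  proof -
    have "P * (4 / 7 * A + 27 / 14 * A * u) = P * A * (4 / 7 + 27 / 14 * u)"
      and "P / 3 * (7 / 9) powr (- 3 / 2) = P * A * 1" for P u :: real
      by (simp_all add: A_def algebra_simps)
    with le show ?thesis by (intro ennreal_leI) (simp only:)
  qed
  also have "\<dots> = (\<integral>\<^sup>+p. (case p of (x, y, z) \<Rightarrow> ennreal (4 / 7 * A + 27 / 14 * A * (x\<^sup>2 + y\<^sup>2 + z\<^sup>2))) * indicator (prism c k L) p \<partial>lborel)"
    using params k_pos A by (subst nn_integral_prism_quadratic) auto
  also have "\<dots> \<le> emeasure hyp_measure (polytope_of b)"
    unfolding emeasure_polytope
  proof (rule nn_integral_mono_AE)
    show "AE p in lborel. (case p of (x, y, z) \<Rightarrow> ennreal (4 / 7 * A + 27 / 14 * A * (x\<^sup>2 + y\<^sup>2 + z\<^sup>2))) * indicator (prism c k L) p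
      \<le> (case p of (x, y, z) \<Rightarrow> ennreal ((1 - x\<^sup>2 - y\<^sup>2 - z\<^sup>2) powr (- 3 / 2) / 3)) * indicator (prism c k L) p"
      using AE_lborel_singleton[of "(c, c * k, L)"]
    proof eventually_elim
      fix p :: "real \<times> real \<times> real" assume p: "p \<noteq> (c, c * k, L)"
      obtain x y z where xyz: "p = (x, y, z)" by (cases p)
      have "4 / 7 * A + 27 / 14 * A * (x\<^sup>2 + y\<^sup>2 + z\<^sup>2) \<le> (1 - x\<^sup>2 - y\<^sup>2 - z\<^sup>2) powr (- 3 / 2) / 3" if "(x, y, z) \<in> prism c k L"
      proof -
        have "1 - x\<^sup>2 - y\<^sup>2 - z\<^sup>2 > 0" using prism_height_pos[OF that] p by (simp add: xyz)
        from powr_tangent_bound[OF this, of "7/9"]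
        have "3 * A * (5 / 2 - 3 / 2 * ((1 - x\<^sup>2 - y\<^sup>2 - z\<^sup>2) / (7 / 9))) \<le> (1 - x\<^sup>2 - y\<^sup>2 - z\<^sup>2) powr (- 3 / 2)"
          by (simp add: A_def)
        moreover have "3 * A * (5 / 2 - 3 / 2 * ((1 - x\<^sup>2 - y\<^sup>2 - z\<^sup>2) / (7 / 9))) = 3 * (4 / 7 * A + 27 / 14 * A * (x\<^sup>2 + y\<^sup>2 + z\<^sup>2))"
          by (simp add: field_simps)
        ultimately have "3 * (4 / 7 * A + 27 / 14 * A * (x\<^sup>2 + y\<^sup>2 + z\<^sup>2)) \<le> (1 - x\<^sup>2 - y\<^sup>2 - z\<^sup>2) powr (- 3 / 2)"
          by (simp only:)
        moreover have "u \<le> w / 3" if "3 * u \<le> w" for u w :: real using that by simp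
        ultimately show ?thesis by blast
      qed
      then show "(case p of (x, y, z) \<Rightarrow> ennreal (4 / 7 * A + 27 / 14 * A * (x\<^sup>2 + y\<^sup>2 + z\<^sup>2))) * indicator (prism c k L) p
      \<le> (case p of (x, y, z) \<Rightarrow> ennreal ((1 - x\<^sup>2 - y\<^sup>2 - z\<^sup>2) powr (- 3 / 2) / 3)) * indicator (prism c k L) p"
        by (auto simp: xyz indicator_def intro!: ennreal_leI)
    qed
  qed
  finally show ?thesis .
qed

text \<open>
  The bound \<open>c\<^sup>2 k L / 6\<close> on \<open>W\<close> is the volume of the maximal horoball at
  \<open>A\<^sub>3\<close> inside the polytope. If the polytope had infinite volume, the quotient would be 0 by the
  conventions for \<open>measure\<close> and division.
\<close>
lemma relative_volume_bound:
  assumes avg: "c\<^sup>2 / 2 + (c * k)\<^sup>2 / 6 + L\<^sup>2 / 3 \<ge> 2 / 9"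
    and W: "W \<le> c\<^sup>2 * k * L / 2 / 3"
  shows "W / hyp_vol (polytope_of b) \<le> (7 / 9) powr (3 / 2)"
proof (cases "emeasure hyp_measure (polytope_of b) = \<infinity>")
  case True
  then show ?thesis by (simp add: hyp_vol_def measure_def)
next
  case False
  have P: "c\<^sup>2 * k * L / 2 / 3 > 0" using params k_pos by simp
  have "emeasure hyp_measure (polytope_of b) = ennreal (hyp_vol (polytope_of b))"
    unfolding hyp_vol_def using False by (simp add: emeasure_eq_ennreal_measure)
  then have V: "c\<^sup>2 * k * L / 2 / 3 * (7 / 9) powr (- 3 / 2) \<le> hyp_vol (polytope_of b)"
    using volume_lower_bound[OF avg] by (simp add: hyp_vol_def)
  have pos: "c\<^sup>2 * k * L / 2 / 3 * (7 / 9) powr (- 3 / 2) > 0" using P by (intro mult_pos_pos) auto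
  have "W \<le> (7 / 9) powr (3 / 2) * (c\<^sup>2 * k * L / 2 / 3 * (7 / 9) powr (- 3 / 2))"
  proof -
    have "(7 / 9 :: real) powr (3 / 2) * (7 / 9) powr (- 3 / 2) = 1" by (simp add: powr_add[symmetric])
    moreover have "u * (v * w) = v" if "u * w = 1" for u v w :: real
      using that by (simp add: mult.left_commute[of u v w])
    ultimately have "(7 / 9) powr (3 / 2) * (c\<^sup>2 * k * L / 2 / 3 * (7 / 9) powr (- 3 / 2)) = c\<^sup>2 * k * L / 2 / 3" by blast
    with W show ?thesis by (simp only:)
  qed
  also have "\<dots> \<le> (7 / 9) powr (3 / 2) * hyp_vol (polytope_of b)"
    using V by (intro mult_left_mono) auto
  finally show ?thesis using V pos by (subst pos_divide_le_eq) auto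
qed

lemma admissible_iff: "admissible_horoball b (proj N) r \<longleftrightarrow> 0 < r \<and> r \<le> 1 / (2 * fst N)"
proof (rule admissible_horoball_iff)
  fix i x y z t assume "i \<le> (5::nat)" "lorentz N (b i) \<noteq> 0" "t \<ge> (1::real)"
  then have "i = 3" using all_le_5[of "\<lambda>i. lorentz N (b i) \<noteq> 0 \<longrightarrow> i = 3"]
    by (auto simp: lorentz_N_b)
  then show "lorentz (point (x, y, z, t)) (b i) \<le> 0" using \<open>t \<ge> 1\<close> by (simp add: lorentz_point_b add_nonneg_nonneg)
      (smt (verit) zero_le_power2)
next
  show "lorentz N (b 3) \<noteq> 0" by (simp add: lorentz_N_b)
  show "t \<ge> 1" if "lorentz (point (0, 0, 0, t)) (b 3) \<le> 0" for t using that by (simp add: lorentz_point_b)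
qed simp

lemma hyp_vol_horoball:
  assumes "admissible_horoball b (proj N) r"
  shows "hyp_vol (horoball (proj N) r \<inter> polytope_of b) = (2 * r * fst N) ^ 3 / 3 * (c\<^sup>2 * k * L / 2)"
proof -
  have r: "0 < r" "r \<le> 1 / (2 * fst N)" using assms admissible_iff by auto
  have "emeasure hyp_measure (horoball (proj N) r \<inter> polytope_of b) = ennreal ((2 * r * fst N) ^ 3 / 3) * emeasure lborel (prism c k L)"
  proof (rule emeasure_horoball_inter[OF _ _ _ r])
    fix x y z t :: real assume "t \<ge> 1"
    then have "1 - x\<^sup>2 - y\<^sup>2 - z\<^sup>2 \<le> t" by (smt (verit) zero_le_power2)
    then show "proj (point (x, y, z, t)) \<in> polytope_of b \<longleftrightarrow> (x, y, z) \<in> prism c k L"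
      using \<open>t \<ge> 1\<close> by (simp add: point_in_polytope)
  qed measurable
  also have "\<dots> = ennreal ((2 * r * fst N) ^ 3 / 3 * (c\<^sup>2 * k * L / 2))"
    using r future params k_pos by (simp only: emeasure_prism) (rule ennreal_mult[symmetric], auto)
  finally show ?thesis using r future params k_pos by (simp add: hyp_vol_def measure_def)
qed

lemma proj_N_ideal: "proj N \<in> ideal_vertices b"
proof -
  have n: "norm (proj N) = 1" using future by (simp add: proj_norm_1 gram)
  have "lorentz (lift (proj N)) (b i) \<le> 0" if "i \<le> 5" for i
  proof -
    have "\<forall>i\<le>5. lorentz N (b i) \<le> 0" unfolding all_le_5 by (simp add: lorentz_N_b)
    then show ?thesis using that future by (simp add: lorentz_lift_proj divide_le_0_iff)
  qed
  then show ?thesis using n by (simp add: ideal_vertices_eq polytope_of_def)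
qed

text \<open>
  An ideal vertex other than the point at infinity lies at height 0 over a point of the base, which must therefore
  reach the unit sphere.
\<close>
lemma ideal_vertices_cases:
  assumes "v \<in> ideal_vertices b"
  shows "v = proj N \<or> v = proj (point (c, c * k, L, 0)) \<and> c\<^sup>2 + (c * k)\<^sup>2 + L\<^sup>2 = 1"
proof -
  have v: "v \<in> polytope_of b" "norm v = 1" using assms by (auto simp: ideal_vertices_eq)
  from sphere_point_exists[OF v(2)] show ?thesis
  proof
    assume "\<exists>x y z. v = proj (point (x, y, z, 0))"
    then obtain x y z where xyz: "v = proj (point (x, y, z, 0))" by blast
    then have "(x, y, z) \<in> prism c k L" "1 - x\<^sup>2 - y\<^sup>2 - z\<^sup>2 \<le> 0" using v(1) by (auto simp: point_in_polytope)
    with prism_height[of x y z] show ?thesis by (auto simp: xyz)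
  qed simp
qed

lemma relative_density_bound:
  assumes avg: "c\<^sup>2 / 2 + (c * k)\<^sup>2 / 6 + L\<^sup>2 / 3 \<ge> 2 / 9" and adm: "admissible_horoball b (proj N) r"
  shows "relative_density b (proj N) r \<le> (7 / 9) powr (3 / 2)"
  unfolding relative_density_def
proof (rule relative_volume_bound[OF avg])
  have "0 < r" "r \<le> 1 / (2 * fst N)" using adm admissible_iff by auto
  then have "0 \<le> 2 * r * fst N" "2 * r * fst N \<le> 1" using future by (simp_all add: field_simps)
  then have "(2 * r * fst N) ^ 3 \<le> 1" by (rule power_le_one)
  then have "(2 * r * fst N) ^ 3 / 3 * (c\<^sup>2 * k * L / 2) \<le> 1 / 3 * (c\<^sup>2 * k * L / 2)"
    using params k_pos by (intro mult_right_mono) auto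
  then show "hyp_vol (horoball (proj N) r \<inter> polytope_of b) \<le> c\<^sup>2 * k * L / 2 / 3"
    by (simp add: hyp_vol_horoball[OF adm])
qed

end

section \<open>Balls inside a truncated orthoscheme\<close>

context half_space_frame begin

lemma emeasure_region_above_le:
  assumes [measurable]: "S \<in> sets borel" "B \<in> sets borel" and g: "g > 0"
    and S: "\<And>x y z t. t > 0 \<Longrightarrow> proj (point (x, y, z, t)) \<in> S \<Longrightarrow> (x, y, z) \<in> B \<and> g \<le> t"
  shows "emeasure hyp_measure S \<le> ennreal (g powr (- 3 / 2) / 3) * emeasure lborel B"
proof -
  have "emeasure hyp_measure S = (\<integral>\<^sup>+p. ennreal ((snd (snd (snd p))) powr (- 5 / 2) / 2) *
      indicator {p. snd (snd (snd p)) > 0 \<and> proj (point p) \<in> S} p \<partial>lborel)"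
    by (rule emeasure_half_space) measurable
  also have "\<dots> \<le> (\<integral>\<^sup>+(x, y, z, t). (ennreal (t powr (- 5 / 2) / 2) * indicator {g..} t) * indicator B (x, y, z) \<partial>lborel)"
    using S by (intro nn_integral_mono) (auto simp: indicator_def)
  also have "\<dots> = (\<integral>\<^sup>+x. \<integral>\<^sup>+y. \<integral>\<^sup>+z. \<integral>\<^sup>+t. (ennreal (t powr (- 5 / 2) / 2) * indicator {g..} t) * indicator B (x, y, z) \<partial>lborel \<partial>lborel \<partial>lborel \<partial>lborel)"
    by (subst nn_integral_lborel_4) simp_all
  also have "\<dots> = (\<integral>\<^sup>+x. \<integral>\<^sup>+y. \<integral>\<^sup>+z. ennreal (g powr (- 3 / 2) / 3) * indicator B (x, y, z) \<partial>lborel \<partial>lborel \<partial>lborel)"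
    using nn_integral_powr_tail[OF g] by (subst nn_integral_multc) auto
  also have "\<dots> = (\<integral>\<^sup>+p. ennreal (g powr (- 3 / 2) / 3) * indicator B p \<partial>lborel)"
    by (subst nn_integral_lborel_3) simp_all
  also have "\<dots> = ennreal (g powr (- 3 / 2) / 3) * emeasure lborel B"
    by (rule nn_integral_cmult_indicator) measurable
  finally show ?thesis .
qed

text \<open>
  A hyperbolic ball is a Euclidean ball in the upper half-space: the condition reads \<open>|p - p0|\<^sup>2 + (h - h0
  cosh r)\<^sup>2 \<le> (h0 sinh r)\<^sup>2\<close> in terms of the heights \<open>h = sqrt t\<close> and \<open>h0 =
  sqrt t0\<close>.
\<close>
lemma point_in_hyp_ball:
  assumes t: "t > 0" "t0 > 0" and r: "r > 0"
  shows "proj (point (x, y, z, t)) \<in> hyp_ball (proj (point (x0, y0, z0, t0))) r \<longleftrightarrow>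
    (x - x0)\<^sup>2 + (y - y0)\<^sup>2 + (z - z0)\<^sup>2 + t + t0 \<le> 2 * sqrt t * sqrt t0 * cosh r"
proof -
  let ?X = "point (x, y, z, t)" and ?Y = "point (x0, y0, z0, t0)"
  define D where "D = (x - x0)\<^sup>2 + (y - y0)\<^sup>2 + (z - z0)\<^sup>2 + t + t0"
  have fX: "fst ?X > 0" and fY: "fst ?Y > 0" using t by (auto intro: fst_point_pos)
  have s: "sqrt t > 0" "sqrt t0 > 0" using t by auto
  have num: "- lorentz (lift (proj ?Y)) (lift (proj ?X)) = D / 2 / (fst ?X * fst ?Y)"
  proof -
    have "- lorentz (lift (proj ?Y)) (lift (proj ?X)) = - lorentz ?Y ?X / (fst ?X * fst ?Y)"
      using fX fY by (simp add: lift_proj lorentz_linear)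
    also have "- lorentz ?Y ?X = D / 2"
      by (simp add: lorentz_point D_def power2_commute[of x0] power2_commute[of y0] power2_commute[of z0])
        (simp add: field_simps)
    finally show ?thesis .
  qed
  have den: "sqrt (lorentz (lift (proj ?Y)) (lift (proj ?Y)) * lorentz (lift (proj ?X)) (lift (proj ?X)))
     = sqrt t * sqrt t0 / (fst ?X * fst ?Y)"
  proof -
    have "lorentz (lift (proj ?Y)) (lift (proj ?Y)) * lorentz (lift (proj ?X)) (lift (proj ?X)) = (t * t0) / (fst ?X * fst ?Y)\<^sup>2"
      using fX fY by (simp add: lorentz_lift_proj_self lorentz_point_self power_mult_distrib mult_ac)
    also have "sqrt \<dots> = sqrt t * sqrt t0 / (fst ?X * fst ?Y)"
      using fX fY by (simp add: real_sqrt_divide real_sqrt_mult)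
    finally show ?thesis .
  qed
  define q where "q = D / (2 * sqrt t * sqrt t0)"
  have "(D / 2 / (fst ?X * fst ?Y)) / (sqrt t * sqrt t0 / (fst ?X * fst ?Y)) = q"
    using fX fY s by (simp add: q_def)
  then have dist: "hyp_dist (proj ?Y) (proj ?X) = arcosh q"
    unfolding hyp_dist_def num den by (simp only:)
  have "0 \<le> (sqrt t - sqrt t0)\<^sup>2" by simp
  then have "2 * sqrt t * sqrt t0 \<le> t + t0" using t by (simp add: power2_diff)
  also have "\<dots> \<le> D" by (simp add: D_def)
  finally have q1: "q \<ge> 1" using s by (simp add: q_def)
  have "arcosh q \<le> r \<longleftrightarrow> q \<le> cosh r"
    using arcosh_less_iff_real[of "cosh r" q] q1 r cosh_real_ge_1[of r] by (simp add: arcosh_cosh_real not_less[symmetric])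
  also have "\<dots> \<longleftrightarrow> D \<le> 2 * sqrt t * sqrt t0 * cosh r"
    using s by (simp add: q_def pos_divide_le_eq mult_ac)
  finally show ?thesis using point_in_ball[OF t(1), of x y z] by (simp add: hyp_ball_def dist D_def)
qed

end

lemma emeasure_box3:
  fixes x y z \<rho> :: real assumes "\<rho> > 0"
  shows "emeasure lborel ({x - \<rho>..x + \<rho>} \<times> {y - \<rho>..y + \<rho>} \<times> {z - \<rho>..z + \<rho>}) = ennreal (8 * \<rho> ^ 3)"
proof -
  have "emeasure lborel ({x - \<rho>..x + \<rho>} \<times> {y - \<rho>..y + \<rho>} \<times> {z - \<rho>..z + \<rho>})
    = emeasure lborel {x - \<rho>..x + \<rho>} * (emeasure lborel {y - \<rho>..y + \<rho>} * emeasure lborel {z - \<rho>..z + \<rho>})"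
    by (subst lborel_prod[symmetric], subst lborel.emeasure_pair_measure_Times, simp, simp add: borel_Times)
       (subst lborel_prod[symmetric], subst lborel.emeasure_pair_measure_Times, simp_all)
  also have "\<dots> = ennreal (2 * \<rho>) * (ennreal (2 * \<rho>) * ennreal (2 * \<rho>))"
    using assms by simp
  also have "\<dots> = ennreal (2 * \<rho> * (2 * \<rho> * (2 * \<rho>)))"
  proof -
    have m: "ennreal u * (ennreal u * ennreal u) = ennreal (u * (u * u))" if "u \<ge> 0" for u
      using that by (simp add: ennreal_mult)
    show ?thesis by (rule m) (use assms in simp)
  qed
  finally show ?thesis by (simp add: power3_eq_cube mult_ac)
qed

lemma hyp_ball_measurable: "hyp_ball (v :: real^4) r \<in> sets borel"
proof -
  have [measurable]: "ball 0 1 \<in> sets (borel :: (real^4) measure)" by simp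
  show ?thesis unfolding hyp_ball_def hyp_dist_def arcosh_def by measurable
qed

context truncated_scheme begin

text \<open>
  The sum \<open>tan (\<pi>/m\<^sub>1) + 1 / cos (\<pi>/m\<^sub>1)\<close>: moving two walls of the base inwards by
  \<open>\<rho>\<close> lowers the corner \<open>(c, c k)\<close> by \<open>sec_tan * \<rho>\<close>.
\<close>
abbreviation sec_tan where "sec_tan \<equiv> (1 + S) / C"

text \<open>
  A ball in the polytope is smaller than the maximal horoball at \<open>A\<^sub>3\<close>. In the half-space it is a
  Euclidean ball of some radius \<open>\<rho>\<close> with lowest height \<open>tb\<close>, so its volume is at most
  \<open>8 \<rho>\<^sup>3 / (3 tb\<^sup>3)\<close>, the volume above height \<open>tb\<close> over a cube of edge
  \<open>2 \<rho>\<close>. Its horizontal centre has distance at least \<open>\<rho>\<close> from the sides of the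
  base, which bounds \<open>\<rho>\<close> by \<open>R\<close> and keeps the centre away from the unit sphere, while
  the lowest point of the ball lies above the unit hemisphere, which bounds \<open>tb\<close> from below. What remains
  is \<open>2 \<rho> \<le> K tb\<close>, a quadratic inequality in \<open>\<rho>\<close> that follows from its
  instance at \<open>R\<close>, the hypothesis \<open>quad\<close>.
\<close>
lemma ball_volume_bound:
  assumes K: "K > 0" "K ^ 3 \<le> c\<^sup>2 * k * L / 2" and R: "R > 0" "c * k \<le> (1 + sec_tan) * R"
    and quad: "(2 + sec_tan\<^sup>2 + 4 / K\<^sup>2) * R\<^sup>2 \<le> 1 - c\<^sup>2 - (c * k)\<^sup>2 - L\<^sup>2 + (2 * c + 2 * (c * k) * sec_tan + 2 * L) * R"
    and ball: "ball_packing b v r"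
  shows "hyp_vol (hyp_ball v r) \<le> c\<^sup>2 * k * L / 2 / 3"
proof -
  have v: "v \<in> ball 0 1" "r > 0" and sub: "hyp_ball v r \<subseteq> polytope_of b" using ball by (auto simp: ball_packing_def)
  from v(1) obtain x y z t0 where t0: "t0 > 0" "v = proj (point (x, y, z, t0))" by (rule ball_point_exists)
  define s where "s = sqrt t0"
  have s: "s > 0" "t0 = s\<^sup>2" using t0 by (auto simp: s_def)
  \<comment> \<open>Euclidean radius, height of the Euclidean centre, and lowest height of the ball\<close>
  define \<rho> where "\<rho> = s * sinh r"
  define h where "h = s * cosh r"
  define tb where "tb = h - \<rho>"
  have \<rho>: "\<rho> > 0" using s v by (simp add: \<rho>_def)
  have h: "h > 0" using s by (simp add: h_def cosh_real_pos)
  have h2: "h\<^sup>2 = s\<^sup>2 + \<rho>\<^sup>2" by (simp add: h_def \<rho>_def power_mult_distrib cosh_square_eq algebra_simps)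
  have "\<rho> < h" using s by (simp add: h_def \<rho>_def sinh_less_cosh_real)
  then have tb: "tb > 0" by (simp add: tb_def)
  have inb: "proj (point (x', y', z', t\<^sup>2)) \<in> hyp_ball v r \<longleftrightarrow> (x' - x)\<^sup>2 + (y' - y)\<^sup>2 + (z' - z)\<^sup>2 + (t - h)\<^sup>2 \<le> \<rho>\<^sup>2"
    if "t > 0" for x' y' z' t
  proof -
    have "proj (point (x', y', z', t\<^sup>2)) \<in> hyp_ball v r \<longleftrightarrow> (x' - x)\<^sup>2 + (y' - y)\<^sup>2 + (z' - z)\<^sup>2 + t\<^sup>2 + t0 \<le> 2 * t * h"
      using point_in_hyp_ball[of "t\<^sup>2" t0 r x' y' z' x y z] that t0 v by (simp add: s_def[symmetric] h_def mult_ac)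
    also have "\<dots> \<longleftrightarrow> (x' - x)\<^sup>2 + (y' - y)\<^sup>2 + (z' - z)\<^sup>2 + (t - h)\<^sup>2 \<le> \<rho>\<^sup>2"
      using h2 by (simp add: s(2) power2_diff algebra_simps)
    finally show ?thesis .
  qed
  have inP: "(x', y', z') \<in> prism c k L \<and> 1 - x'\<^sup>2 - y'\<^sup>2 - z'\<^sup>2 \<le> t\<^sup>2"
    if "t > 0" "(x' - x)\<^sup>2 + (y' - y)\<^sup>2 + (z' - z)\<^sup>2 + (t - h)\<^sup>2 \<le> \<rho>\<^sup>2" for x' y' z' t
    using inb[of t x' y' z'] that sub point_in_polytope[of "t\<^sup>2" x' y' z'] by auto
  have X: "x + \<rho> \<le> c" using inP[OF h, of "x + \<rho>" y z] by (simp add: prism_def)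
  have Y: "\<rho> \<le> y" using inP[OF h, of x "y - \<rho>" z] by (simp add: prism_def)
  have Z: "z + \<rho> \<le> L" "\<rho> \<le> z" using inP[OF h, of x y "z + \<rho>"] inP[OF h, of x y "z - \<rho>"] by (simp_all add: prism_def)
  have SC: "S * S + C * C = 1" using params(1) by (simp add: power2_eq_square)
  \<comment> \<open>the point of the ball that is nearest to the vertical wall \<open>H\<^sup>1\<close>\<close>
  have XY: "C * y + \<rho> \<le> S * x"
  proof -
    have "(x - S * \<rho> - x)\<^sup>2 + (y + C * \<rho> - y)\<^sup>2 + (z - z)\<^sup>2 + (h - h)\<^sup>2 = (S * S + C * C) * \<rho>\<^sup>2"
      by (simp add: power2_eq_square algebra_simps)
    then have "(x - S * \<rho>, y + C * \<rho>, z) \<in> prism c k L" using inP[OF h] SC by simp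
    then have "y + C * \<rho> \<le> k * (x - S * \<rho>)" by (simp add: prism_def)
    then have "C * (y + C * \<rho>) \<le> C * (k * (x - S * \<rho>))" using params by (intro mult_left_mono) auto
    then have "C * y + (S * S + C * C) * \<rho> \<le> S * x" using params by (simp add: algebra_simps)
    then show ?thesis using SC by simp
  qed
  have bottom: "1 - x\<^sup>2 - y\<^sup>2 - z\<^sup>2 \<le> tb\<^sup>2" using inP[OF tb, of x y z] by (simp add: tb_def)
  have xpos: "0 < x"
  proof -
    have "0 < C * y + \<rho>" using \<rho> Y params by (simp add: add_nonneg_pos)
    then have "0 < S * x" using XY by linarith
    then show ?thesis using params by (simp add: zero_less_mult_iff)
  qed
  have Ya: "y \<le> c * k - sec_tan * \<rho>"
  proof -
    have "S * x \<le> S * (c - \<rho>)" using X params by (intro mult_left_mono) auto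
    then have "C * y \<le> S * (c - \<rho>) - \<rho>" using XY by linarith
    also have "\<dots> = C * (c * k - sec_tan * \<rho>)" using params by (simp add: field_simps)
    finally show ?thesis using params by simp
  qed
  have \<rho>R: "\<rho> \<le> R"
  proof -
    have "(1 + sec_tan) * \<rho> \<le> c * k" using Y Ya by (simp only: distrib_right mult_1)
    also have "\<dots> \<le> (1 + sec_tan) * R" by (rule R)
    finally show ?thesis using params by (simp add: add_pos_pos)
  qed
  have "4 / K\<^sup>2 * \<rho>\<^sup>2 \<le> 1 - x\<^sup>2 - y\<^sup>2 - z\<^sup>2"
  proof -
    have sq: "x\<^sup>2 \<le> (c - \<rho>)\<^sup>2" "y\<^sup>2 \<le> (c * k - sec_tan * \<rho>)\<^sup>2" "z\<^sup>2 \<le> (L - \<rho>)\<^sup>2"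
      using X xpos Y Ya Z \<rho> by (auto intro!: power_mono)
    define A0 where "A0 = 1 - c\<^sup>2 - (c * k)\<^sup>2 - L\<^sup>2"
    define A1 where "A1 = 2 * c + 2 * (c * k) * sec_tan + 2 * L"
    define A2 where "A2 = 2 + sec_tan\<^sup>2 + 4 / K\<^sup>2"
    have A: "A0 \<ge> 0" "A1 \<ge> 0" using params by (auto simp: A0_def A1_def)
    have "A2 * R\<^sup>2 \<le> A0 + A1 * R" using quad by (simp only: A0_def A1_def A2_def)
    \<comment> \<open>scaling the inequality at \<open>R\<close> down to \<open>\<rho>\<close> loses nothing, as \<open>A0\<close> and \<open>A1\<close> are nonnegative and \<open>\<rho> \<le> R\<close>\<close>
    then have "(\<rho> / R)\<^sup>2 * (A2 * R\<^sup>2) \<le> (\<rho> / R)\<^sup>2 * (A0 + A1 * R)" by (intro mult_left_mono) auto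
    also have "(\<rho> / R)\<^sup>2 * (A2 * R\<^sup>2) = A2 * \<rho>\<^sup>2" using R by (simp add: power_divide)
    also have "(\<rho> / R)\<^sup>2 * (A0 + A1 * R) = (\<rho> / R)\<^sup>2 * A0 + (\<rho> / R) * (A1 * \<rho>)"
      using R by (simp add: field_simps power2_eq_square)
    also have "\<dots> \<le> 1 * A0 + 1 * (A1 * \<rho>)"
      using A \<rho> \<rho>R R by (intro add_mono mult_right_mono power_le_one) auto
    finally have "A2 * \<rho>\<^sup>2 \<le> A0 + A1 * \<rho>" by simp
    have "4 / K\<^sup>2 * \<rho>\<^sup>2 \<le> 1 - (c - \<rho>)\<^sup>2 - (c * k - sec_tan * \<rho>)\<^sup>2 - (L - \<rho>)\<^sup>2"
    proof -
      have expand: "1 - (c - \<rho>)\<^sup>2 - (w - u * \<rho>)\<^sup>2 - (L - \<rho>)\<^sup>2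
         = (1 - c\<^sup>2 - w\<^sup>2 - L\<^sup>2 + (2 * c + 2 * w * u + 2 * L) * \<rho>) - (2 + u\<^sup>2) * \<rho>\<^sup>2" for u w
        by (simp add: power2_eq_square algebra_simps)
      have A2: "A2 * \<rho>\<^sup>2 = (2 + sec_tan\<^sup>2) * \<rho>\<^sup>2 + 4 / K\<^sup>2 * \<rho>\<^sup>2" by (simp only: A2_def distrib_right)
      have combine: "u \<le> w" if "w = p - q" "d = q + u" "d \<le> p" for u w p q d :: real using that by linarith
      show ?thesis by (rule combine[OF expand A2 \<open>A2 * \<rho>\<^sup>2 \<le> A0 + A1 * \<rho>\<close>[unfolded A0_def A1_def]])
    qed
    also have "\<dots> \<le> 1 - x\<^sup>2 - y\<^sup>2 - z\<^sup>2" using sq by (intro diff_mono order_refl)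
    finally show ?thesis .
  qed
  also note bottom
  finally have "4 / K\<^sup>2 * \<rho>\<^sup>2 \<le> tb\<^sup>2" .
  then have "(2 * \<rho>)\<^sup>2 \<le> (K * tb)\<^sup>2" using K by (simp add: power_mult_distrib pos_divide_le_eq mult_ac)
  then have "2 * \<rho> \<le> K * tb" by (rule power2_le_imp_le) (use K tb in simp)
  then have "(2 * \<rho>) ^ 3 \<le> (K * tb) ^ 3" using \<rho> by (intro power_mono) auto
  also have "\<dots> \<le> c\<^sup>2 * k * L / 2 * tb ^ 3" unfolding power_mult_distrib using K tb by (intro mult_right_mono) auto
  finally have final: "8 * \<rho> ^ 3 / tb ^ 3 \<le> c\<^sup>2 * k * L / 2" using tb by (simp add: pos_divide_le_eq power_mult_distrib)
  have "emeasure hyp_measure (hyp_ball v r) \<le> ennreal ((tb\<^sup>2) powr (- 3 / 2) / 3) *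
      emeasure lborel ({x - \<rho>..x + \<rho>} \<times> {y - \<rho>..y + \<rho>} \<times> {z - \<rho>..z + \<rho>})"
  proof (rule emeasure_region_above_le)
    fix x' y' z' t :: real assume t: "t > 0" and "proj (point (x', y', z', t)) \<in> hyp_ball v r"
    then have *: "(x' - x)\<^sup>2 + (y' - y)\<^sup>2 + (z' - z)\<^sup>2 + (sqrt t - h)\<^sup>2 \<le> \<rho>\<^sup>2"
      using inb[of "sqrt t" x' y' z'] by simp
    have "(x' - x)\<^sup>2 \<le> \<rho>\<^sup>2" "(y' - y)\<^sup>2 \<le> \<rho>\<^sup>2" "(z' - z)\<^sup>2 \<le> \<rho>\<^sup>2" "(sqrt t - h)\<^sup>2 \<le> \<rho>\<^sup>2"
      using * zero_le_power2[of "x' - x"] zero_le_power2[of "y' - y"] zero_le_power2[of "z' - z"] zero_le_power2[of "sqrt t - h"]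
      by linarith+
    then have abs: "\<bar>x' - x\<bar> \<le> \<rho>" "\<bar>y' - y\<bar> \<le> \<rho>" "\<bar>z' - z\<bar> \<le> \<rho>" "\<bar>sqrt t - h\<bar> \<le> \<rho>"
      using \<rho> by (simp_all add: abs_le_square_iff[symmetric])
    then have "tb \<le> sqrt t" by (simp add: tb_def abs_le_iff)
    then have "tb\<^sup>2 \<le> t" using tb t by (metis real_sqrt_pow2 power_mono less_imp_le)
    with abs show "(x', y', z') \<in> {x - \<rho>..x + \<rho>} \<times> {y - \<rho>..y + \<rho>} \<times> {z - \<rho>..z + \<rho>} \<and> tb\<^sup>2 \<le> t"
      by (auto simp: abs_le_iff)
  qed (use tb in \<open>auto simp: hyp_ball_measurable borel_Times\<close>)
  also have "\<dots> = ennreal ((tb\<^sup>2) powr (- 3 / 2) / 3 * (8 * \<rho> ^ 3))"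
    unfolding emeasure_box3[OF \<rho>] by (rule ennreal_mult[symmetric]) (use \<rho> in auto)
  also have "(tb\<^sup>2) powr (- 3 / 2) / 3 * (8 * \<rho> ^ 3) = 8 * \<rho> ^ 3 / tb ^ 3 / 3"
    using tb by (subst powr_minus_three_halves) (simp_all add: power3_eq_cube power2_eq_square)
  also have "ennreal \<dots> \<le> ennreal (c\<^sup>2 * k * L / 2 / 3)" using final by (intro ennreal_leI divide_right_mono) auto
  finally show ?thesis unfolding hyp_vol_def measure_def using params k_pos by (intro enn2real_leI) auto
qed

end

section \<open>Horoballs of null vectors and the reflection group\<close>

text \<open>The equality case of the Cauchy--Schwarz inequality for the spatial parts.\<close>
lemma orthogonal_null_vectors_parallel:
  fixes x y :: "real \<times> (real^4)"
  assumes x: "lorentz x x = 0" "fst x > 0" and y: "lorentz y y = 0" "fst y > 0" and xy: "lorentz x y = 0"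
  shows "y = (fst y / fst x) *\<^sub>R x"
proof -
  have nx: "norm (snd x) = fst x" and ny: "norm (snd y) = fst y"
    using x y by (simp_all add: lorentz_def norm_eq_sqrt_inner power2_eq_square[symmetric])
  have "snd x \<bullet> snd y = norm (snd x) * norm (snd y)" using xy by (simp add: nx ny lorentz_def)
  then have "norm (snd x) *\<^sub>R snd y = norm (snd y) *\<^sub>R snd x" by (rule norm_cauchy_schwarz_eq[THEN iffD1])
  then have "fst x *\<^sub>R snd y = fst y *\<^sub>R snd x" by (simp only: nx ny)
  then have "inverse (fst x) *\<^sub>R (fst x *\<^sub>R snd y) = inverse (fst x) *\<^sub>R (fst y *\<^sub>R snd x)" by simp
  then have "snd y = (fst y / fst x) *\<^sub>R snd x" using x by (simp add: divide_inverse mult.commute)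
  then show ?thesis using x by (simp add: prod_eq_iff)
qed

text \<open>
  A horoball described by a single null vector: the direction is the centre and the scale encodes the size. Lorentz
  maps act on such horoballs by acting on the vector.
\<close>
definition null_horoball :: "real \<times> (real^4) \<Rightarrow> (real^4) set" where
  "null_horoball n = {v \<in> ball 0 1. - lorentz (lift v) n \<le> sqrt (- lorentz (lift v) (lift v))}"

lemma horoball_eq_null_horoball:
  assumes "fst n > 0"
  shows "horoball (proj n) (1 / fst n) = null_horoball n"
proof -
  have "v \<in> horoball (proj n) (1 / fst n) \<longleftrightarrow> v \<in> null_horoball n" if "v \<in> ball 0 1" for v
    using horoball_proj_iff[of "lift v" n "1 / fst n"] assms that[unfolded lorentz_lift_ball] that
    by (simp add: proj_lift null_horoball_def)
  then show ?thesis by (auto simp: null_horoball_def horoball_def)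
qed

text \<open>
  The component \<open>u\<close> of \<open>\<langle>x,n\<rangle> m + \<langle>x,m\<rangle> n\<close> orthogonal to the
  timelike vector \<open>x\<close> is spacelike, which is the claim after expansion of \<open>\<langle>u,u\<rangle>
  \<ge> 0\<close>.
\<close>
lemma reverse_cauchy_schwarz_null:
  fixes x m n :: "real \<times> (real^4)"
  assumes x: "lorentz x x < 0" "fst x > 0" and m: "lorentz m m = 0" "fst m > 0" and n: "lorentz n n = 0" "fst n > 0"
  shows "- lorentz m n * (- lorentz x x) \<le> 2 * (- lorentz x m) * (- lorentz x n)"
proof -
  define p where "p = - lorentz x m"
  define q where "q = - lorentz x n"
  have pq: "p > 0" "q > 0" using lorentz_future_neg[OF x, of m] lorentz_future_neg[OF x, of n] m n by (auto simp: p_def q_def)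
  define u where "u = q *\<^sub>R m + p *\<^sub>R n - (2 * p * q / (- lorentz x x)) *\<^sub>R x"
  have xu: "lorentz x u = 0" using x by (simp add: u_def lorentz_linear p_def q_def)
  have "lorentz u u \<ge> 0"
  proof (rule ccontr)
    assume "\<not> lorentz u u \<ge> 0"
    then have uu: "lorentz u u < 0" by simp
    show False using future_iff[OF uu, of x] future_iff[of "- u" x] x uu xu
      by (auto simp: lorentz_linear lorentz_commute[of u x] timelike_norm_less)
  qed
  moreover have "lorentz u u = 2 * p * q * (lorentz m n + 2 * p * q / (- lorentz x x))"
    using x m n
    by (simp add: u_def lorentz_linear lorentz_commute[of n m] lorentz_commute[of m x] lorentz_commute[of n x] p_def[symmetric] q_def[symmetric]
        minus_equation_iff[of "lorentz x m"] minus_equation_iff[of "lorentz x n"])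
       (simp add: p_def q_def field_simps)
  ultimately have "lorentz m n + 2 * p * q / (- lorentz x x) \<ge> 0"
    using pq mult_pos_pos[OF pq] by (auto simp: zero_le_mult_iff)
  then show ?thesis using x by (simp add: p_def q_def field_simps)
qed

text \<open>
  By \<open>reverse_cauchy_schwarz_null\<close> a common point satisfies both defining inequalities with equality.
  Moving an interior point slightly towards the centre of the first horoball makes the first inequality strict and
  keeps the second one.
\<close>
lemma null_horoball_interior_disjoint:
  assumes m: "lorentz m m = 0" "fst m > 0" and n: "lorentz n n = 0" "fst n > 0" and mn: "- lorentz m n \<ge> 2"
  shows "interior (null_horoball m) \<inter> interior (null_horoball n) = {}"
proof (rule ccontr)
  define U where "U = interior (null_horoball m) \<inter> interior (null_horoball n)"
  assume "interior (null_horoball m) \<inter> interior (null_horoball n) \<noteq> {}"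
  then obtain v where v: "v \<in> U" by (auto simp: U_def)
  have "open U" by (simp add: U_def open_Int)
  have sub: "U \<subseteq> null_horoball m" "U \<subseteq> null_horoball n" using interior_subset by (auto simp: U_def)
  define p where "p = proj m"
  \<comment> \<open>the segment from \<open>v\<close> towards the centre of the first horoball\<close>
  define f where "f d = v + d *\<^sub>R (p - v)" for d :: real
  have "continuous (at_right 0) f" unfolding f_def by (intro continuous_intros)
  then have "(f \<longlongrightarrow> f 0) (at_right 0)" by (simp add: continuous_within)
  moreover have "f 0 = v" by (simp add: f_def)
  ultimately have "eventually (\<lambda>d. f d \<in> U) (at_right 0)"
    using \<open>open U\<close> v by (metis topological_tendstoD)
  moreover have "eventually (\<lambda>d::real. d \<in> {0<..<1}) (at_right 0)"
    by (rule eventually_at_right_real) simp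
  ultimately have "eventually (\<lambda>d. f d \<in> U \<and> 0 < d \<and> d < 1) (at_right 0)" by eventually_elim simp
  then obtain d where d: "f d \<in> U" "0 < d" "d < 1"
    using eventually_happens[of _ "at_right (0::real)"] by (auto simp: trivial_limit_at_right_real)
  have vb: "v \<in> ball 0 1" and db: "f d \<in> ball 0 1" using v d sub by (auto simp: null_horoball_def)
  define X where "X = lift v"
  define Y where "Y = lift (f d)"
  have XX: "lorentz X X < 0" and YY: "lorentz Y Y < 0" using vb db by (simp_all only: X_def Y_def lorentz_lift_ball)
  have Y_eq: "Y = (1 - d) *\<^sub>R X + (d / fst m) *\<^sub>R m"
    using m(2) by (simp add: Y_def X_def f_def p_def proj_def prod_eq_iff algebra_simps)
  have Xm: "- lorentz X m > 0" using lorentz_future_neg[OF XX, of m] m by (simp add: X_def)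
  have vm: "- lorentz X m \<le> sqrt (- lorentz X X)" using v sub by (auto simp: X_def null_horoball_def)
  have Ym: "- lorentz Y m = (1 - d) * (- lorentz X m)" using m by (simp add: Y_eq lorentz_linear)
  have YY_eq: "- lorentz Y Y = (1 - d)\<^sup>2 * (- lorentz X X) + 2 * (1 - d) * (d / fst m) * (- lorentz X m)"
    using m by (simp add: Y_eq lorentz_linear lorentz_commute[of m X] power2_eq_square algebra_simps)
  have "(- lorentz X m)\<^sup>2 \<le> - lorentz X X"
    using power_mono[OF vm, of 2] Xm XX by simp
  then have "(- lorentz Y m)\<^sup>2 \<le> (1 - d)\<^sup>2 * (- lorentz X X)"
    unfolding Ym power_mult_distrib by (intro mult_left_mono) auto
  also have "\<dots> < - lorentz Y Y"   proof -
    have "2 * (1 - d) * (d / fst m) * (- lorentz X m) > 0"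
      using d m Xm by (intro mult_pos_pos divide_pos_pos) auto
    then show ?thesis unfolding YY_eq by (simp only: less_add_same_cancel1)
  qed
  finally have Ym2: "- lorentz Y m < sqrt (- lorentz Y Y)" by (rule real_less_rsqrt)
  have Yn: "- lorentz Y n \<le> sqrt (- lorentz Y Y)" using d sub by (auto simp: Y_def null_horoball_def)
  have Ynpos: "- lorentz Y n > 0" using lorentz_future_neg[OF YY, of n] n by (simp add: Y_def)
  have "2 * (- lorentz Y Y) \<le> - lorentz m n * (- lorentz Y Y)" using mn YY by (intro mult_right_mono) auto
  also have "\<dots> \<le> 2 * (- lorentz Y m) * (- lorentz Y n)"
    by (rule reverse_cauchy_schwarz_null) (use YY m n in \<open>auto simp: Y_def\<close>)
  also have "\<dots> < 2 * sqrt (- lorentz Y Y) * sqrt (- lorentz Y Y)"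
  proof -
    have "(- lorentz Y m) * (- lorentz Y n) < sqrt (- lorentz Y Y) * (- lorentz Y n)"
      using Ym2 Ynpos by (rule mult_strict_right_mono)
    also have "\<dots> \<le> sqrt (- lorentz Y Y) * sqrt (- lorentz Y Y)"
      using Yn YY by (intro mult_left_mono) auto
    finally show ?thesis by simp
  qed
  also have "\<dots> = 2 * (- lorentz Y Y)" using YY by simp
  finally show False by simp
qed

definition future_isometry :: "(real \<times> (real^4) \<Rightarrow> real \<times> (real^4)) \<Rightarrow> bool" where
  "future_isometry g \<longleftrightarrow> (\<forall>x y. lorentz (g x) (g y) = lorentz x y) \<and> (\<forall>a x. g (a *\<^sub>R x) = a *\<^sub>R g x) \<and>
     (\<forall>x. lorentz x x \<le> 0 \<longrightarrow> fst x > 0 \<longrightarrow> fst (g x) > 0)"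

lemma future_isometryD:
  assumes "future_isometry g"
  shows "lorentz (g x) (g y) = lorentz x y" "g (a *\<^sub>R x) = a *\<^sub>R g x"
    "lorentz x x \<le> 0 \<Longrightarrow> fst x > 0 \<Longrightarrow> fst (g x) > 0"
  by (rule assms[unfolded future_isometry_def, THEN conjunct1, rule_format],
      rule assms[unfolded future_isometry_def, THEN conjunct2, THEN conjunct1, rule_format],
      rule assms[unfolded future_isometry_def, THEN conjunct2, THEN conjunct2, rule_format])

lemma lorentz_reflection_isometry:
  assumes "lorentz u u = 1"
  shows "lorentz (lorentz_reflection u x) (lorentz_reflection u y) = lorentz x y"
  using assms by (simp add: lorentz_reflection_def lorentz_linear lorentz_commute[of u y] algebra_simps)

lemma future_isometry_reflection:
  assumes u: "lorentz u u = 1"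
  shows "future_isometry (lorentz_reflection u)"
  unfolding future_isometry_def
proof (intro conjI allI impI)
  have timelike: "fst (lorentz_reflection u x) > 0" if x: "lorentz x x < 0" "fst x > 0" for x
  proof -
    have "lorentz (lorentz_reflection u x) x = lorentz x x - 2 * (lorentz x u)\<^sup>2"
      by (simp add: lorentz_reflection_def lorentz_linear lorentz_commute[of u x] power2_eq_square)
    also have "\<dots> < 0" using x(1) zero_le_power2[of "lorentz x u"] by linarith
    finally show ?thesis
      using future_of_neg[of "lorentz_reflection u x" x] x u by (simp add: lorentz_reflection_isometry)
  qed
  fix x :: "real \<times> (real^4)" assume x: "lorentz x x \<le> 0" "fst x > 0"
  \<comment> \<open>a null vector is compared with the image of a timelike one\<close>
  define y :: "real \<times> (real^4)" where "y = (1, 0)"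
  have y: "lorentz y y < 0" "fst y > 0" by (simp_all add: y_def lorentz_def)
  have "lorentz (lorentz_reflection u x) (lorentz_reflection u y) < 0"
    using lorentz_future_neg[OF y x] u by (simp add: lorentz_reflection_isometry lorentz_commute)
  then show "fst (lorentz_reflection u x) > 0"
    using future_of_neg[of "lorentz_reflection u x" "lorentz_reflection u y"] x y u timelike[of y]
    by (simp add: lorentz_reflection_isometry)
qed (use u in \<open>simp_all add: lorentz_reflection_isometry\<close>, simp add: lorentz_reflection_def lorentz_linear algebra_simps)

lemma lorentz_reflection_involution:
  assumes "lorentz u u = 1" shows "lorentz_reflection u (lorentz_reflection u x) = x"
  using assms by (simp add: lorentz_reflection_def lorentz_linear algebra_simps)

lemma lorentz_reflection_adjoint:
  "lorentz (lorentz_reflection u x) y = lorentz x (lorentz_reflection u y)"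
  by (simp add: lorentz_reflection_def lorentz_linear lorentz_commute[of u y])

lemma future_isometry_comp: "future_isometry g \<Longrightarrow> future_isometry h \<Longrightarrow> future_isometry (g \<circ> h)"
proof -
  assume g: "future_isometry g" and h: "future_isometry h"
  show ?thesis unfolding future_isometry_def o_apply
  proof (intro conjI allI impI)
    show "fst (g (h x)) > 0" if "lorentz x x \<le> 0" "fst x > 0" for x
      by (rule future_isometryD(3)[OF g]) (use that future_isometryD(1,3)[OF h] in simp_all)
  qed (simp_all only: future_isometryD[OF g] future_isometryD[OF h])
qed

text \<open>
  The right inverse makes the action on horoballs surjective in \<open>klein_action_null_horoball\<close>.
\<close>
lemma reflection_group_future_isometry:
  fixes b :: "nat \<Rightarrow> real \<times> (real^4)"
  assumes b: "\<And>i. i \<le> 5 \<Longrightarrow> lorentz (b i) (b i) = 1" and g: "g \<in> reflection_group b"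
  shows "future_isometry g \<and> (\<exists>h. future_isometry h \<and> (\<forall>x. g (h x) = x))"
  using g
proof induction
  case id
  have "future_isometry id" by (simp add: future_isometry_def del: split_paired_All)
  then show ?case unfolding id_def by blast
next
  case (step g i)
  from step.IH obtain h where h: "future_isometry g" "future_isometry h" "\<forall>x. g (h x) = x" by (elim conjE exE)
  have u: "lorentz (b i) (b i) = 1" using step.hyps b by simp
  have "future_isometry (lorentz_reflection (b i) \<circ> g)"
    by (rule future_isometry_comp[OF future_isometry_reflection[OF u] h(1)])
  moreover have "future_isometry (h \<circ> lorentz_reflection (b i))"
    by (rule future_isometry_comp[OF h(2) future_isometry_reflection[OF u]])
  moreover have "\<forall>x. (lorentz_reflection (b i) \<circ> g) ((h \<circ> lorentz_reflection (b i)) x) = x"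
    by (simp only: o_apply h(3)[rule_format] lorentz_reflection_involution[OF u]) simp
  ultimately show ?case by blast
qed

lemma klein_action_null_horoball_subset:
  assumes g: "future_isometry g" and v: "v \<in> null_horoball n"
  shows "klein_action g v \<in> null_horoball (g n)"
proof -
  define X where "X = g (lift v)"
  have vb: "lorentz (lift v) (lift v) < 0" using v by (simp only: null_horoball_def mem_Collect_eq lorentz_lift_ball)
  have iso: "lorentz X X = lorentz (lift v) (lift v)" "lorentz X (g n) = lorentz (lift v) n"
    unfolding X_def by (rule future_isometryD[OF g])+
  have fX: "fst X > 0" unfolding X_def by (rule future_isometryD(3)[OF g]) (use vb in simp_all)
  have kl: "klein_action g v = proj X" by (simp add: klein_action_def proj_def X_def)
  have "proj X \<in> ball 0 1" using fX iso vb by (simp only: proj_in_ball)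
  moreover have "- lorentz (lift (proj X)) (g n) = - lorentz (lift v) n / fst X"
    using fX by (simp add: lorentz_lift_proj iso)
  moreover have "sqrt (- lorentz (lift (proj X)) (lift (proj X))) = sqrt (- lorentz (lift v) (lift v)) / fst X"
  proof -
    have "- lorentz (lift (proj X)) (lift (proj X)) = (- lorentz (lift v) (lift v)) / (fst X)\<^sup>2"
      using fX by (simp add: lorentz_lift_proj_self iso)
    then have "sqrt (- lorentz (lift (proj X)) (lift (proj X))) = sqrt (- lorentz (lift v) (lift v)) / sqrt ((fst X)\<^sup>2)"
      by (simp only: real_sqrt_divide)
    then show ?thesis using fX by simp
  qed
  moreover have "- lorentz (lift v) n \<le> sqrt (- lorentz (lift v) (lift v))" using v by (simp add: null_horoball_def)
  ultimately show ?thesis using fX unfolding kl null_horoball_def mem_Collect_eq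
    by (metis divide_right_mono less_imp_le)
qed

lemma klein_action_null_horoball:
  fixes b :: "nat \<Rightarrow> real \<times> (real^4)"
  assumes b: "\<And>i. i \<le> 5 \<Longrightarrow> lorentz (b i) (b i) = 1" and g: "g \<in> reflection_group b"
  shows "klein_action g ` null_horoball n = null_horoball (g n)"
proof
  obtain h where h: "future_isometry g" "future_isometry h" "\<And>x. g (h x) = x"
    using reflection_group_future_isometry[OF b g] by blast
  then show "klein_action g ` null_horoball n \<subseteq> null_horoball (g n)"
    using klein_action_null_horoball_subset by blast
  show "null_horoball (g n) \<subseteq> klein_action g ` null_horoball n"
  proof
    fix w assume w: "w \<in> null_horoball (g n)"
    have hg: "h (g n) = n" 
    proof -
      have "lorentz (h (g n) - n) y = 0" for y
      proof -
        have "lorentz (h (g n)) y = lorentz (g (h (g n))) (g y)" "lorentz n y = lorentz (g n) (g y)"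
          by (simp_all only: future_isometryD(1)[OF h(1)])
        then show ?thesis by (simp add: lorentz_linear h(3))
      qed
      then show ?thesis using lorentz_nondegenerate[of "h (g n) - n"] by simp
    qed
    have wb: "lorentz (lift w) (lift w) < 0" using w by (simp only: null_horoball_def mem_Collect_eq lorentz_lift_ball)
    have fh: "fst (h (lift w)) > 0" by (rule future_isometryD(3)[OF h(2)]) (use wb in simp_all)
    have "klein_action g (klein_action h w) = proj (g (lift (proj (h (lift w)))))"
      by (simp add: klein_action_def proj_def)
    also have "g (lift (proj (h (lift w)))) = (1 / fst (h (lift w))) *\<^sub>R g (h (lift w))"
      using fh by (simp add: lift_proj future_isometryD(2)[OF h(1)])
    also have "proj \<dots> = w" using fh by (subst proj_scaleR) (simp_all add: h(3) proj_lift)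
    finally have "klein_action g (klein_action h w) = w" .
    moreover have "klein_action h w \<in> null_horoball n"
      using klein_action_null_horoball_subset[OF h(2) w] by (simp add: hg)
    ultimately show "w \<in> klein_action g ` null_horoball n" by (metis image_eqI)
  qed
qed

section \<open>Metric parameters of the six symbols\<close>

text \<open>
  The metric conditions on a symbol under which the estimates above apply: those of the locale, the lower bound on the
  mean of \<open>|p|\<^sup>2\<close> over the base, and the existence of constants \<open>K\<close> and
  \<open>R\<close> for \<open>ball_volume_bound\<close>. The best \<open>K\<close> is the cube root of the volume of
  the base, the best \<open>R\<close> the inradius of its triangle.
\<close>
definition scheme_params :: "real \<Rightarrow> real \<Rightarrow> real \<Rightarrow> real \<Rightarrow> bool" where
  "scheme_params C S c L \<longleftrightarrow>
     C\<^sup>2 + S\<^sup>2 = 1 \<and> C > 0 \<and> S > 0 \<and> c > 0 \<and> L > 0 \<and> c\<^sup>2 + (c * (S / C))\<^sup>2 + L\<^sup>2 \<le> 1 \<and>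
     2 / 9 \<le> c\<^sup>2 / 2 + (c * (S / C))\<^sup>2 / 6 + L\<^sup>2 / 3 \<and>
     (\<exists>K R. K > 0 \<and> K ^ 3 \<le> c\<^sup>2 * (S / C) * L / 2 \<and> R > 0 \<and> c * (S / C) \<le> (1 + (1 + S) / C) * R \<and>
        (2 + ((1 + S) / C)\<^sup>2 + 4 / K\<^sup>2) * R\<^sup>2 \<le>
          1 - c\<^sup>2 - (c * (S / C))\<^sup>2 - L\<^sup>2 + (2 * c + 2 * (c * (S / C)) * ((1 + S) / C) + 2 * L) * R)"

lemma scheme_params_I:
  fixes C S c L K R k a :: real
  assumes "k = S / C" "a = (1 + S) / C" "C\<^sup>2 + S\<^sup>2 = 1" "C > 0" "S > 0" "c > 0" "L > 0"
    "c\<^sup>2 + (c * k)\<^sup>2 + L\<^sup>2 \<le> 1" "2 / 9 \<le> c\<^sup>2 / 2 + (c * k)\<^sup>2 / 6 + L\<^sup>2 / 3"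
    "K > 0" "K ^ 3 \<le> c\<^sup>2 * k * L / 2" "R > 0" "c * k \<le> (1 + a) * R"
    "(2 + a\<^sup>2 + 4 / K\<^sup>2) * R\<^sup>2 \<le> 1 - c\<^sup>2 - (c * k)\<^sup>2 - L\<^sup>2 + (2 * c + 2 * (c * k) * a + 2 * L) * R"
  shows "scheme_params C S c L"
  using assms unfolding scheme_params_def by blast

lemma sqrt_bounds:
  "1.4142 \<le> sqrt 2" "sqrt 2 \<le> 1.4143" "1.732 \<le> sqrt 3" "sqrt 3 \<le> 1.7321" "2.236 \<le> sqrt 5" "sqrt 5 \<le> 2.2361"
  by (rule real_le_rsqrt real_le_lsqrt; simp add: power2_eq_square)+

lemma square_params: "(sqrt 2 / 2)\<^sup>2 + (sqrt 2 / 2)\<^sup>2 = (1::real)" "1 = (sqrt 2 / 2) / (sqrt 2 / 2 :: real)"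
  "1 + sqrt 2 = (1 + sqrt 2 / 2) / (sqrt 2 / 2 :: real)"
  by (simp_all add: power_divide field_simps)

lemma hexagon_params: "(sqrt 3 / 2)\<^sup>2 + (1 / 2)\<^sup>2 = (1::real)" "sqrt 3 / 3 = (1 / 2) / (sqrt 3 / 2 :: real)"
  "sqrt 3 = (1 + 1 / 2) / (sqrt 3 / 2 :: real)"
  by (simp_all add: power_divide field_simps)

text \<open>
  In this and the following lemmas \<open>K\<close> and \<open>R\<close> are decimal approximations, from below and
  from above, to the cube root of the volume of the base and to the inradius of its triangle.
\<close>
lemma scheme_params_4433: "scheme_params (sqrt 2 / 2) (sqrt 2 / 2) (1 / 2) (1 / 2)"
proof (rule scheme_params_I[where K = "0.396" and R = "0.147", OF square_params(2,3,1)])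
  have a2: "(1 + sqrt 2)\<^sup>2 = 3 + 2 * sqrt (2::real)" by (simp add: power2_eq_square algebra_simps)
  show "(2 + (1 + sqrt 2)\<^sup>2 + 4 / 0.396\<^sup>2) * 0.147\<^sup>2 \<le> 1 - (1 / 2)\<^sup>2 - (1 / 2 * 1)\<^sup>2 - (1 / 2)\<^sup>2 +
    (2 * (1 / 2) + 2 * (1 / 2 * 1) * (1 + sqrt 2) + 2 * (1 / 2)) * (0.147::real)"
    unfolding a2 using sqrt_bounds(1,2) by (simp add: power2_eq_square, (simp add: field_simps)?)
  show "1 / 2 * 1 \<le> (1 + (1 + sqrt 2)) * (0.147::real)" using sqrt_bounds(1,2) by simp
qed (simp_all add: power2_eq_square power3_eq_cube)

lemma scheme_params_4434: "scheme_params (sqrt 2 / 2) (sqrt 2 / 2) (1 / 2) (sqrt 2 / 2)"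
proof (rule scheme_params_I[where K = "0.44" and R = "0.147", OF square_params(2,3,1)])
  have a2: "(1 + sqrt 2)\<^sup>2 = 3 + 2 * sqrt (2::real)" by (simp add: power2_eq_square algebra_simps)
  have L2: "(sqrt 2 / 2)\<^sup>2 = (1 / 2 :: real)" by (simp add: power_divide)
  show "(2 + (1 + sqrt 2)\<^sup>2 + 4 / 0.44\<^sup>2) * 0.147\<^sup>2 \<le> 1 - (1 / 2)\<^sup>2 - (1 / 2 * 1)\<^sup>2 - (sqrt 2 / 2)\<^sup>2 +
    (2 * (1 / 2) + 2 * (1 / 2 * 1) * (1 + sqrt 2) + 2 * (sqrt 2 / 2)) * (0.147::real)"
    unfolding a2 L2 using sqrt_bounds(1,2) by (simp add: power2_eq_square, (simp add: field_simps)?)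
  show "1 / 2 * 1 \<le> (1 + (1 + sqrt 2)) * (0.147::real)" using sqrt_bounds(1,2) by simp
  show "(1 / 2)\<^sup>2 + (1 / 2 * 1)\<^sup>2 + (sqrt 2 / 2)\<^sup>2 \<le> (1::real)"
    "2 / 9 \<le> (1 / 2)\<^sup>2 / 2 + (1 / 2 * 1)\<^sup>2 / 6 + (sqrt 2 / 2)\<^sup>2 / (3::real)"
    unfolding L2 by (simp_all add: power2_eq_square)
  show "0.44 ^ 3 \<le> (1 / 2)\<^sup>2 * 1 * (sqrt 2 / 2) / (2::real)" using sqrt_bounds(1) by (simp add: power2_eq_square power3_eq_cube)
qed simp_all

lemma scheme_params_633:
  assumes L: "L > 0" "1 / 4 \<le> L\<^sup>2" "L\<^sup>2 \<le> 2 / 3" and K: "K > 0" "K ^ 3 \<le> 0.0721 * L"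
    and Q: "(5 + 4 / K\<^sup>2) * 0.1057\<^sup>2 \<le> 2 / 3 - L\<^sup>2 + (2 + 2 * L) * 0.1057"
  shows "scheme_params (sqrt 3 / 2) (1 / 2) (1 / 2) L"
proof (rule scheme_params_I[where K = K and R = "0.1057", OF hexagon_params(2,3,1)])
  have ck: "(1 / 2 * (sqrt 3 / 3))\<^sup>2 = (1 / 12 :: real)" "2 * (1 / 2 * (sqrt 3 / 3)) * sqrt 3 = (1::real)"
    by (simp_all add: power2_eq_square)
  show "(2 + (sqrt 3)\<^sup>2 + 4 / K\<^sup>2) * 0.1057\<^sup>2 \<le> 1 - (1 / 2)\<^sup>2 - (1 / 2 * (sqrt 3 / 3))\<^sup>2 - L\<^sup>2 +
     (2 * (1 / 2) + 2 * (1 / 2 * (sqrt 3 / 3)) * sqrt 3 + 2 * L) * 0.1057"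
    unfolding ck using Q by (simp add: power2_eq_square[of "1/2"])
  show "1 / 2 * (sqrt 3 / 3) \<le> (1 + sqrt 3) * (0.1057::real)" using sqrt_bounds(3,4) by simp
  show "(1 / 2)\<^sup>2 + (1 / 2 * (sqrt 3 / 3))\<^sup>2 + L\<^sup>2 \<le> 1"
    "2 / 9 \<le> (1 / 2)\<^sup>2 / 2 + (1 / 2 * (sqrt 3 / 3))\<^sup>2 / 6 + L\<^sup>2 / 3"
    unfolding ck using L by (simp_all add: power2_eq_square[of "1/2"])
  have "0.0721 * L \<le> sqrt 3 / 24 * L" using sqrt_bounds(3) L by (intro mult_right_mono) auto
  then show "K ^ 3 \<le> (1 / 2)\<^sup>2 * (sqrt 3 / 3) * L / 2" using K(2) by (simp add: power2_eq_square)
qed (use L K in auto)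

lemma scheme_params_6333: "scheme_params (sqrt 3 / 2) (1 / 2) (1 / 2) (1 / 2)"
  by (rule scheme_params_633[where K = "0.33"]) (simp_all add: power2_eq_square power3_eq_cube)

lemma scheme_params_6334: "scheme_params (sqrt 3 / 2) (1 / 2) (1 / 2) (sqrt 2 / 2)"
proof (rule scheme_params_633[where K = "0.37"])
  have L2: "(sqrt 2 / 2)\<^sup>2 = (1 / 2 :: real)" by (simp add: power_divide)
  show "1 / 4 \<le> (sqrt 2 / 2 :: real)\<^sup>2" "(sqrt 2 / 2)\<^sup>2 \<le> (2 / 3 :: real)" unfolding L2 by simp_all
  show "(5 + 4 / 0.37\<^sup>2) * 0.1057\<^sup>2 \<le> 2 / 3 - (sqrt 2 / 2)\<^sup>2 + (2 + 2 * (sqrt 2 / 2)) * (0.1057::real)"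
    unfolding L2 using sqrt_bounds(1) by (simp add: power2_eq_square, (simp add: field_simps)?)
  show "0.37 ^ 3 \<le> 0.0721 * (sqrt 2 / 2 :: real)" using sqrt_bounds(1) by (simp add: power3_eq_cube)
qed simp_all

lemma scheme_params_6335: "scheme_params (sqrt 3 / 2) (1 / 2) (1 / 2) ((1 + sqrt 5) / 4)"
proof (rule scheme_params_633[where K = "0.387"])
  have L2: "((1 + sqrt 5) / 4)\<^sup>2 = ((3 + sqrt 5) / 8 :: real)" by (simp add: power_divide power2_eq_square algebra_simps)
  show "1 / 4 \<le> ((1 + sqrt 5) / 4 :: real)\<^sup>2" "((1 + sqrt 5) / 4)\<^sup>2 \<le> (2 / 3 :: real)"
    unfolding L2 using sqrt_bounds(5,6) by simp_all
  show "(5 + 4 / 0.387\<^sup>2) * 0.1057\<^sup>2 \<le> 2 / 3 - ((1 + sqrt 5) / 4)\<^sup>2 + (2 + 2 * ((1 + sqrt 5) / 4)) * (0.1057::real)"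
    unfolding L2 using sqrt_bounds(5,6) by (simp add: power2_eq_square, (simp add: field_simps)?)
  show "0.387 ^ 3 \<le> 0.0721 * ((1 + sqrt 5) / 4 :: real)" using sqrt_bounds(5) by (simp add: power3_eq_cube)
  show "(1 + sqrt 5) / 4 > (0::real)" using sqrt_bounds(5) by simp
qed simp_all

lemma scheme_params_6343: "scheme_params (sqrt 3 / 2) (1 / 2) (sqrt 2 / 2) (1 / 2)"
proof (rule scheme_params_I[where K = "0.416" and R = "0.1495", OF hexagon_params(2,3,1)])
  have c2: "(sqrt 2 / 2)\<^sup>2 = (1 / 2 :: real)" by (simp add: power_divide)
  have ck: "(sqrt 2 / 2 * (sqrt 3 / 3))\<^sup>2 = (1 / 6 :: real)" "2 * (sqrt 2 / 2 * (sqrt 3 / 3)) * sqrt 3 = sqrt (2::real)"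
    by (simp_all add: power_mult_distrib power_divide)
  show "(2 + (sqrt 3)\<^sup>2 + 4 / 0.416\<^sup>2) * 0.1495\<^sup>2 \<le> 1 - (sqrt 2 / 2)\<^sup>2 - (sqrt 2 / 2 * (sqrt 3 / 3))\<^sup>2 - (1 / 2)\<^sup>2 +
     (2 * (sqrt 2 / 2) + 2 * (sqrt 2 / 2 * (sqrt 3 / 3)) * sqrt 3 + 2 * (1 / 2)) * (0.1495::real)"
    unfolding ck c2 using sqrt_bounds(1) by (simp add: power2_eq_square, (simp add: field_simps)?)
  have "sqrt 2 * sqrt 3 \<le> 1.4143 * (1.7321::real)" using sqrt_bounds by (intro mult_mono) auto
  then show "sqrt 2 / 2 * (sqrt 3 / 3) \<le> (1 + sqrt 3) * (0.1495::real)" using sqrt_bounds(3) by simp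
  show "(sqrt 2 / 2)\<^sup>2 + (sqrt 2 / 2 * (sqrt 3 / 3))\<^sup>2 + (1 / 2)\<^sup>2 \<le> (1::real)"
    "2 / 9 \<le> (sqrt 2 / 2)\<^sup>2 / 2 + (sqrt 2 / 2 * (sqrt 3 / 3))\<^sup>2 / 6 + (1 / 2)\<^sup>2 / (3::real)"
    unfolding ck c2 by (simp_all add: power2_eq_square)
  show "0.416 ^ 3 \<le> (sqrt 2 / 2)\<^sup>2 * (sqrt 3 / 3) * (1 / 2) / (2::real)"
    unfolding c2 using sqrt_bounds(3) by (simp add: power3_eq_cube)
qed simp_all

text \<open>
  At \<open>x = \<pi>/5\<close> one has \<open>cos (2 x) = - cos (3 x)\<close>, a cubic equation for \<open>cos
  x\<close> with the root \<open>-1\<close>.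
\<close>
lemma cos_pi_fifth: "cos (pi / 5) = (1 + sqrt 5) / 4"
proof -
  define g where "g = cos (pi / 5)"
  have "g > 0" unfolding g_def by (rule cos_gt_zero) (auto simp: pi_gt_zero)
  have "cos (2 * (pi / 5)) = - cos (3 * (pi / 5))"
    using cos_pi_minus[of "3 * (pi / 5)"] by (simp add: field_simps)
  moreover have "cos (2 * (pi / 5)) = 2 * g\<^sup>2 - 1" unfolding g_def by (rule cos_double_cos)
  moreover have "cos (3 * (pi / 5)) = 4 * g ^ 3 - 3 * g" unfolding g_def by (rule cos_treble_cos)
  ultimately have "2 * g\<^sup>2 - 1 = - (4 * g ^ 3 - 3 * g)" by (simp only:)
  then have "(g + 1) * (4 * g\<^sup>2 - 2 * g - 1) = 0"
    by (simp add: power2_eq_square power3_eq_cube algebra_simps)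
  then have "4 * g\<^sup>2 - 2 * g - 1 = 0" using \<open>g > 0\<close> by simp
  then have "(4 * g - 1)\<^sup>2 = 5" by (simp add: power2_eq_square algebra_simps)
  then have "\<bar>4 * g - 1\<bar> = sqrt 5" by (metis real_sqrt_abs)
  moreover have "sqrt 5 > (1::real)" by simp
  then have "4 * g - 1 \<noteq> - sqrt 5" using \<open>g > 0\<close> by linarith
  ultimately have "4 * g - 1 = sqrt 5" by (simp add: abs_if split: if_splits)
  then show ?thesis by (simp add: g_def)
qed

lemma symbols4_params:
  assumes "m \<in> symbols4"
  shows "scheme_params (cos (pi / real (m ! 0))) (cos (pi / real (m ! 1))) (cos (pi / real (m ! 2))) (cos (pi / real (m ! 3)))"
  using assms scheme_params_4433 scheme_params_4434 scheme_params_6333 scheme_params_6334 scheme_params_6335 scheme_params_6343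
  by (auto simp: symbols4_def cos_45 cos_30 cos_60 cos_pi_fifth numeral_2_eq_2 numeral_3_eq_3)

section \<open>The symbol with two ideal vertices\<close>

text \<open>
  The symbol \<open>{4,4,3,4,\<infinity>}\<close>. Here \<open>c\<^sup>2 + (c k)\<^sup>2 + L\<^sup>2 = 1\<close>, so
  the corner of the base lies on the unit sphere and \<open>A\<^sub>0\<close> is a second ideal vertex.
\<close>
locale two_cusp_scheme = truncated_scheme b "sqrt 2 / 2" "sqrt 2 / 2" "1 / 2" "sqrt 2 / 2"
  for b :: "nat \<Rightarrow> real \<times> (real^4)"
begin

text \<open>
  A second frame, with \<open>A\<^sub>0\<close> at infinity. The walls \<open>H\<^sup>1, \<dots>, H\<^sup>4\<close>
  through \<open>A\<^sub>0\<close> form the Coxeter diagram of the cubic tessellation, and the directions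
  \<open>U\<^sub>i\<close> are the edges of its cube: they turn these walls into the sides of the simplex \<open>0
  \<le> x \<le> y \<le> z \<le> sqrt 2 / 2\<close>.
\<close>
definition N\<^sub>0 where "N\<^sub>0 = vec_at (1, 1 / 2, 1 / 2, sqrt 2 / 2, 1)"
definition E\<^sub>0 where "E\<^sub>0 = vec_at (1 / 2, 1 / 4, 1 / 4, - sqrt 2 / 4, 1 / 2)"
definition U\<^sub>1 where "U\<^sub>1 = vec_at (0, sqrt 2 / 2, - sqrt 2 / 2, 0, 0)"
definition U\<^sub>2 where "U\<^sub>2 = vec_at (0, - sqrt 2 / 2, - sqrt 2 / 2, 0, - sqrt 2)"
definition U\<^sub>3 where "U\<^sub>3 = vec_at (- sqrt 2, - sqrt 2 / 2, - sqrt 2 / 2, 0, 0)"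

lemmas corner_defs = N\<^sub>0_def E\<^sub>0_def U\<^sub>1_def U\<^sub>2_def U\<^sub>3_def

lemma N\<^sub>0_eq_point: "N\<^sub>0 = point (1 / 2, 1 / 2, sqrt 2 / 2, 0)"
  by (simp add: N\<^sub>0_def point_def power_divide)

sublocale corner: half_space_frame E\<^sub>0 U\<^sub>1 U\<^sub>2 U\<^sub>3 N\<^sub>0
proof
  show "fst N\<^sub>0 > 0" unfolding N\<^sub>0_eq_point by (rule fst_point_0_pos) simp
qed (simp_all add: corner_defs lorentz_vec_at)

lemma vec_at_add: "vec_at (a, x, y, z, d) + vec_at (a', x', y', z', d') = vec_at (a + a', x + x', y + y', z + z', d + d')"
  by (simp add: vec_at_def algebra_simps)

lemma vec_at_scale: "r *\<^sub>R vec_at (a, x, y, z, d) = vec_at (r * a, r * x, r * y, r * z, r * d)"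
  by (simp add: vec_at_def algebra_simps)

lemma corner_vec_at:
  "corner.vec_at (a, x, y, z, d) = vec_at (a / 2 - sqrt 2 * z + d, a / 4 + sqrt 2 / 2 * (x - y - z) + d / 2,
     a / 4 - sqrt 2 / 2 * (x + y + z) + d / 2, (d - a / 2) * (sqrt 2 / 2), a / 2 - sqrt 2 * y + d)"
  unfolding corner.vec_at_def split unfolding corner_defs vec_at_scale vec_at_add
  by (rule arg_cong[of _ _ vec_at]) (simp add: field_simps)

lemma b_eq_corner:
  "b 0 = corner.vec_at (1, sqrt 2 / 2, sqrt 2 / 2, sqrt 2 / 2, 1 / 2)"
  "b (Suc 0) = corner.vec_at (0, - 1, 0, 0, 0)"
  "b 2 = corner.vec_at (0, sqrt 2 / 2, - sqrt 2 / 2, 0, 0)"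
  "b 3 = corner.vec_at (0, 0, sqrt 2 / 2, - sqrt 2 / 2, 0)"
  "b 4 = corner.vec_at (0, 0, 0, 1, sqrt 2)"
  "b 5 = corner.vec_at (sqrt 2, 0, 0, 0, - sqrt 2 / 2)"
  unfolding b_eq_vec_at corner_vec_at
  by (simp_all add: field_simps)

lemma lorentz_corner_point_b:
  "lorentz (corner.point (x, y, z, t)) (b 0) = sqrt 2 / 2 * (x + y + z) - (x\<^sup>2 + y\<^sup>2 + z\<^sup>2 + t) / 2 - 1 / 4"
  "lorentz (corner.point (x, y, z, t)) (b (Suc 0)) = - x"
  "lorentz (corner.point (x, y, z, t)) (b 2) = sqrt 2 / 2 * (x - y)"
  "lorentz (corner.point (x, y, z, t)) (b 3) = sqrt 2 / 2 * (y - z)"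
  "lorentz (corner.point (x, y, z, t)) (b 4) = z - sqrt 2 / 2"
  "lorentz (corner.point (x, y, z, t)) (b 5) = sqrt 2 / 2 * (1 / 2 - (x\<^sup>2 + y\<^sup>2 + z\<^sup>2 + t))"
  unfolding b_eq_corner corner.point_def split corner.lorentz_vec_at by (simp_all add: field_simps)

lemma lorentz_N0_b:
  "lorentz N\<^sub>0 (b 0) = - 1 / 2" "lorentz N\<^sub>0 (b (Suc 0)) = 0" "lorentz N\<^sub>0 (b 2) = 0"
  "lorentz N\<^sub>0 (b 3) = 0" "lorentz N\<^sub>0 (b 4) = 0" "lorentz N\<^sub>0 (b 5) = - sqrt 2 / 2"
  unfolding b_eq_vec_at N\<^sub>0_def lorentz_vec_at by simp_all

text \<open>
  From \<open>A\<^sub>0\<close> the wall \<open>H\<^sup>0\<close> is the unit hemisphere about the vertex \<open>(s,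
  s, s)\<close>, \<open>s = sqrt 2 / 2\<close>, of the simplex, and \<open>H\<^sup>5\<close> a smaller hemisphere
  about the origin.
\<close>
lemma corner_point_b0_b5:
  assumes "t \<ge> 1"
  shows "lorentz (corner.point (x, y, z, t)) (b 0) \<le> 0" "lorentz (corner.point (x, y, z, t)) (b 5) \<le> 0"
proof -
  have "0 \<le> (x - sqrt 2 / 2)\<^sup>2 + (y - sqrt 2 / 2)\<^sup>2 + (z - sqrt 2 / 2)\<^sup>2" by simp
  also have "\<dots> = x\<^sup>2 + y\<^sup>2 + z\<^sup>2 - sqrt 2 * (x + y + z) + 3 / 2"
    by (simp add: power2_diff power_divide algebra_simps)
  finally show "lorentz (corner.point (x, y, z, t)) (b 0) \<le> 0" using assms by (simp add: lorentz_corner_point_b field_simps)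
  have "x\<^sup>2 + y\<^sup>2 + z\<^sup>2 \<ge> 0" by simp
  then have "1 / 2 - (x\<^sup>2 + y\<^sup>2 + z\<^sup>2 + t) \<le> 0" using assms by linarith
  then show "lorentz (corner.point (x, y, z, t)) (b 5) \<le> 0"
    unfolding lorentz_corner_point_b by (intro mult_nonneg_nonpos) simp_all
qed

lemma corner_point_in_polytope:
  assumes "t \<ge> 1"
  shows "proj (corner.point (x, y, z, t)) \<in> polytope_of b \<longleftrightarrow> (x, y, z) \<in> {(x, y, z). 0 \<le> x \<and> x \<le> y \<and> y \<le> z \<and> z \<le> sqrt 2 / 2}"
proof -
  have "proj (corner.point (x, y, z, t)) \<in> cball 0 1"
    using corner.fst_point_0_pos[of t x y z] assms by (simp only: proj_in_cball corner.lorentz_point_self)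
  then show ?thesis
    using assms corner_point_b0_b5[OF assms, of x y z]
    by (simp add: polytope_of_def all_le_5 corner.lorentz_lift_point)
       (auto simp: lorentz_corner_point_b mult_le_0_iff)
qed

lemma corner_admissible_iff: "admissible_horoball b (proj N\<^sub>0) r \<longleftrightarrow> 0 < r \<and> r \<le> 1 / (2 * fst N\<^sub>0)"
proof (rule corner.admissible_horoball_iff)
  fix i x y z t assume i: "i \<le> (5::nat)" "lorentz N\<^sub>0 (b i) \<noteq> 0" and t: "t \<ge> (1::real)"
  have "\<forall>i\<le>5. lorentz N\<^sub>0 (b i) \<noteq> 0 \<longrightarrow> i = 0 \<or> i = 5" unfolding all_le_5 by (simp add: lorentz_N0_b)
  then have "i = 0 \<or> i = 5" using i by blast
  then show "lorentz (corner.point (x, y, z, t)) (b i) \<le> 0" using corner_point_b0_b5[OF t] by blast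
next
  show "lorentz N\<^sub>0 (b 0) \<noteq> 0" by (simp add: lorentz_N0_b)
  show "t \<ge> 1" if "lorentz (corner.point (sqrt 2 / 2, sqrt 2 / 2, sqrt 2 / 2, t)) (b 0) \<le> 0" for t
    using that by (simp add: lorentz_corner_point_b power_divide field_simps)
qed simp

lemma hyp_vol_corner_horoball:
  assumes "admissible_horoball b (proj N\<^sub>0) r"
  shows "hyp_vol (horoball (proj N\<^sub>0) r \<inter> polytope_of b) = (2 * r * fst N\<^sub>0) ^ 3 * (sqrt 2 / 72)"
proof -
  let ?B = "{(x, y, z). 0 \<le> x \<and> x \<le> y \<and> y \<le> z \<and> z \<le> sqrt 2 / 2} :: (real \<times> real \<times> real) set"
  have r: "0 < r" "r \<le> 1 / (2 * fst N\<^sub>0)" using assms corner_admissible_iff by auto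
  have [measurable]: "?B \<in> sets borel" by measurable
  have "emeasure hyp_measure (horoball (proj N\<^sub>0) r \<inter> polytope_of b) = ennreal ((2 * r * fst N\<^sub>0) ^ 3 / 3) * emeasure lborel ?B"
    by (rule corner.emeasure_horoball_inter[OF _ _ corner_point_in_polytope r]) measurable
  also have "emeasure lborel ?B = ennreal ((sqrt 2 / 2) ^ 3 / 6)" by (rule emeasure_simplex) simp
  also have "(sqrt 2 / 2) ^ 3 / 6 = sqrt 2 / (24::real)" by (simp add: power3_eq_cube)
  also have "ennreal ((2 * r * fst N\<^sub>0) ^ 3 / 3) * ennreal (sqrt 2 / 24) = ennreal ((2 * r * fst N\<^sub>0) ^ 3 / 3 * (sqrt 2 / 24))"
    using r corner.future by (intro ennreal_mult[symmetric]) auto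
  finally show ?thesis using r corner.future by (simp add: hyp_vol_def measure_def)
qed

lemma hyp_vol_polytope: "hyp_vol (polytope_of b) = pi\<^sup>2 / 144"
proof -
  have half: "sqrt (1 / 2) = sqrt 2 / (2::real)" by (simp add: real_sqrt_divide field_simps)
  have "emeasure hyp_measure (polytope_of b) = ennreal (pi\<^sup>2 / 144)"
    unfolding emeasure_polytope using nn_integral_prism_ideal_corner[unfolded half] by simp
  then show ?thesis by (simp add: hyp_vol_def measure_def)
qed

lemma relative_density_N:
  "admissible_horoball b (proj N) r \<Longrightarrow> relative_density b (proj N) r = (2 * r * fst N) ^ 3 * (3 * sqrt 2 / pi\<^sup>2)"
  by (simp add: relative_density_def hyp_vol_horoball hyp_vol_polytope power2_eq_square)

lemma relative_density_N0:
  "admissible_horoball b (proj N\<^sub>0) r \<Longrightarrow> relative_density b (proj N\<^sub>0) r = (2 * r * fst N\<^sub>0) ^ 3 * (2 * sqrt 2 / pi\<^sup>2)"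
  by (simp add: relative_density_def hyp_vol_corner_horoball hyp_vol_polytope)

lemma proj_N0_ideal: "proj N\<^sub>0 \<in> ideal_vertices b"
proof -
  have n: "norm (proj N\<^sub>0) = 1" using corner.future by (simp add: proj_norm_1 corner.gram)
  have "\<forall>i\<le>5. lorentz N\<^sub>0 (b i) \<le> 0" unfolding all_le_5 by (simp add: lorentz_N0_b)
  then show ?thesis using n corner.future by (simp add: ideal_vertices_eq polytope_of_def lorentz_lift_proj divide_le_0_iff)
qed

lemma ideal_vertices_two_cusps: "ideal_vertices b = {proj N\<^sub>0, proj N}"
proof -
  have "v = proj N \<or> v = proj N\<^sub>0" if "v \<in> ideal_vertices b" for v
    using ideal_vertices_cases[OF that] by (simp add: N\<^sub>0_eq_point) blast?
  then show ?thesis using proj_N_ideal proj_N0_ideal by blast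
qed

lemma lift_eq_proj: "lift v = r *\<^sub>R x \<Longrightarrow> v = proj (x :: real \<times> (real^4))"
proof -
  assume l: "lift v = r *\<^sub>R x"
  then have "r \<noteq> 0" by (metis fst_conv fst_scaleR scaleR_zero_left zero_neq_one)
  then show ?thesis using l by (metis proj_lift proj_scaleR)
qed

lemma orthoscheme_vertex_3: "orthoscheme_vertex b 3 = proj N"
  unfolding orthoscheme_vertex_def
proof (rule the_equality)
  have "\<forall>i\<le>5. i \<noteq> 3 \<longrightarrow> lorentz N (b i) = 0" unfolding all_le_5 by (simp add: lorentz_N_b)
  then show "proj N \<in> cball 0 1 \<and> (\<forall>j\<le>DIM(real^4). j \<noteq> 3 \<longrightarrow> lorentz (lift (proj N)) (b j) = 0)"
    using proj_N_ideal future by (simp add: ideal_vertices_eq polytope_of_def lorentz_lift_proj)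
next
  fix v assume v: "v \<in> cball 0 1 \<and> (\<forall>j\<le>DIM(real^4). j \<noteq> 3 \<longrightarrow> lorentz (lift v) (b j) = 0)"
  obtain a x y z d where l: "lift v = vec_at (a, x, y, z, d)" using vec_at_exists by blast
  have "lorentz (lift v) (b 0) = 0" "lorentz (lift v) (b (Suc 0)) = 0" "lorentz (lift v) (b 2) = 0" "lorentz (lift v) (b 4) = 0"
    using v by simp_all
  then have e: "y = 0" "y - x = 0" "x - a / 2 = 0" "z - sqrt 2 / 2 * a = 0"
    unfolding l b_eq_vec_at lorentz_vec_at by (simp_all add: right_diff_distrib[symmetric] algebra_simps)
  then have "lift v = d *\<^sub>R N" unfolding l by (simp add: vec_at_def)
  then show "v = proj N" by (rule lift_eq_proj)
qed

lemma orthoscheme_vertex_0: "orthoscheme_vertex b 0 = proj N\<^sub>0"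
  unfolding orthoscheme_vertex_def
proof (rule the_equality)
  have "\<forall>i\<le>5. i \<noteq> 0 \<longrightarrow> i \<noteq> 5 \<longrightarrow> lorentz N\<^sub>0 (b i) = 0" unfolding all_le_5 by (simp add: lorentz_N0_b)
  then show "proj N\<^sub>0 \<in> cball 0 1 \<and> (\<forall>j\<le>DIM(real^4). j \<noteq> 0 \<longrightarrow> lorentz (lift (proj N\<^sub>0)) (b j) = 0)"
    using proj_N0_ideal corner.future by (simp add: ideal_vertices_eq polytope_of_def lorentz_lift_proj)
next
  fix v assume v: "v \<in> cball 0 1 \<and> (\<forall>j\<le>DIM(real^4). j \<noteq> 0 \<longrightarrow> lorentz (lift v) (b j) = 0)"
  obtain a x y z d where l: "lift v = vec_at (a, x, y, z, d)" using vec_at_exists by blast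
  have "lorentz (lift v) (b (Suc 0)) = 0" "lorentz (lift v) (b 2) = 0" "lorentz (lift v) (b 3) = 0" "lorentz (lift v) (b 4) = 0"
    using v by simp_all
  then have e: "y - x = 0" "x - a / 2 = 0" "a - d = 0" "z - sqrt 2 / 2 * a = 0"
    unfolding l b_eq_vec_at lorentz_vec_at by (simp_all add: right_diff_distrib[symmetric] algebra_simps)
  then have xyz: "x = a / 2" "y = a / 2" "z = a * (sqrt 2 / 2)" "d = a" by simp_all
  have "lift v = a *\<^sub>R N\<^sub>0" unfolding l N\<^sub>0_def vec_at_scale xyz by simp
  then show "v = proj N\<^sub>0" by (rule lift_eq_proj)
qed

lemma proj_N0_neq_N: "proj N\<^sub>0 \<noteq> proj N"
proof
  assume "proj N\<^sub>0 = proj N"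
  then have "lift (proj N\<^sub>0) = lift (proj N)" by simp
  then have "lorentz (lift (proj N\<^sub>0)) (b 0) = lorentz (lift (proj N)) (b 0)" by simp
  then show False using future corner.future by (simp add: lorentz_lift_proj lorentz_N_b lorentz_N0_b)
qed

lemma maximal_N: "maximal_horoball b (proj N) r \<longleftrightarrow> r = 1 / (2 * fst N)"
  by (rule maximal_horoball_iff[OF admissible_iff])

lemma maximal_N0: "maximal_horoball b (proj N\<^sub>0) r \<longleftrightarrow> r = 1 / (2 * fst N\<^sub>0)"
  by (rule corner.maximal_horoball_iff[OF corner_admissible_iff])

lemma optimal_configuration_iff:
  "optimal_configuration b s \<longleftrightarrow> dom s = {proj N\<^sub>0, proj N} \<and> s (proj N) = Some (1 / (2 * fst N)) \<and> s (proj N\<^sub>0) = Some (1 / (2 * fst N\<^sub>0))"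
proof -
  have *: "(\<forall>p r. s p = Some r \<longrightarrow> maximal_horoball b p r) \<longleftrightarrow>
     (\<forall>r. s (proj N) = Some r \<longrightarrow> maximal_horoball b (proj N) r) \<and> (\<forall>r. s (proj N\<^sub>0) = Some r \<longrightarrow> maximal_horoball b (proj N\<^sub>0) r)"
    if "dom s = {proj N\<^sub>0, proj N}"
  proof -
    have "p = proj N\<^sub>0 \<or> p = proj N" if "s p = Some r" for p r
      using domI[of s p r] that \<open>dom s = _\<close> by blast
    then show ?thesis by blast
  qed
  have "optimal_configuration b s \<longleftrightarrow> dom s = {proj N\<^sub>0, proj N} \<and>
     (\<forall>r. s (proj N) = Some r \<longrightarrow> r = 1 / (2 * fst N)) \<and> (\<forall>r. s (proj N\<^sub>0) = Some r \<longrightarrow> r = 1 / (2 * fst N\<^sub>0))"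
    unfolding optimal_configuration_def orthoscheme_vertex_0 orthoscheme_vertex_3 maximal_N[symmetric] maximal_N0[symmetric]
    using * by blast
  also have "\<dots> \<longleftrightarrow> dom s = {proj N\<^sub>0, proj N} \<and> s (proj N) = Some (1 / (2 * fst N)) \<and> s (proj N\<^sub>0) = Some (1 / (2 * fst N\<^sub>0))"
  proof -
    have val: "(\<forall>r. s q = Some r \<longrightarrow> r = w) \<longleftrightarrow> s q = Some w" if "q \<in> dom s" for q w using that by auto
    show ?thesis
    proof (cases "dom s = {proj N\<^sub>0, proj N}")
      case True
      then have "proj N \<in> dom s" "proj N\<^sub>0 \<in> dom s" by auto
      then show ?thesis by (simp only: val)
    qed simp
  qed
  finally show ?thesis .
qed

text \<open>
  Both maximal horoballs can be used simultaneously, so the bound is the sum of the two separate maxima, and equality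
  forces both horoballs to be present and maximal.
\<close>
lemma horoball_packing_density_le:
  assumes s: "horoball_packing b s"
  shows "horoball_packing_density b s \<le> 5 * sqrt 2 / pi\<^sup>2 \<and>
     (horoball_packing_density b s = 5 * sqrt 2 / pi\<^sup>2 \<longrightarrow> optimal_configuration b s)"
proof -
  have dom: "dom s \<subseteq> {proj N\<^sub>0, proj N}" and adm: "\<And>p r. s p = Some r \<Longrightarrow> admissible_horoball b p r"
    using s by (auto simp: horoball_packing_def ideal_vertices_two_cusps)
  define d where "d p = (if p \<in> dom s then relative_density b p (the (s p)) else 0)" for p
  have "horoball_packing_density b s = sum d (dom s)"
    unfolding horoball_packing_density_def by (rule sum.cong) (auto simp: d_def)
  also have "\<dots> = sum d {proj N\<^sub>0, proj N}" by (rule sum.mono_neutral_left) (use dom in \<open>auto simp: d_def\<close>)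
  also have "\<dots> = d (proj N\<^sub>0) + d (proj N)" using proj_N0_neq_N by simp
  finally have density: "horoball_packing_density b s = d (proj N\<^sub>0) + d (proj N)" .
  have K: "3 * sqrt 2 / pi\<^sup>2 > 0" "2 * sqrt 2 / pi\<^sup>2 > 0" by simp_all
  have cube: "w ^ 3 \<le> 1 \<and> (w ^ 3 = 1 \<longrightarrow> w = 1)" if "0 \<le> w" "w \<le> 1" for w :: real
    using power_le_one[OF that, of 3] power_eq_imp_eq_base[of w 3 1] that by auto
  have contribution: "d q \<le> w \<and> (d q = w \<longrightarrow> s q = Some (1 / (2 * f)))"
    if "f > 0" "w > 0" and iff: "\<And>r. admissible_horoball b q r \<longleftrightarrow> 0 < r \<and> r \<le> 1 / (2 * f)"
      and density: "\<And>r. admissible_horoball b q r \<Longrightarrow> relative_density b q r = (2 * r * f) ^ 3 * w" for q f w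
  proof (cases "s q")
    case None then show ?thesis using that by (simp add: d_def domIff)
  next
    case (Some r)
    have adm_q: "admissible_horoball b q r" using adm Some by blast
    then have r: "0 < r" "r \<le> 1 / (2 * f)" using iff by auto
    have c: "0 \<le> 2 * r * f" "2 * r * f \<le> 1" using r \<open>f > 0\<close> by (simp_all add: field_simps)
    have d: "d q = (2 * r * f) ^ 3 * w" using Some adm_q by (simp add: d_def dom_def density)
    have "r = 1 / (2 * f)" if "(2 * r * f) ^ 3 = 1" using cube[OF c] that \<open>f > 0\<close> by (simp add: field_simps)
    moreover have "(2 * r * f) ^ 3 * w \<le> 1 * w" using cube[OF c] \<open>w > 0\<close> by (intro mult_right_mono) auto
    ultimately show ?thesis unfolding d using Some \<open>w > 0\<close> by simp
  qed
  have dN: "d (proj N) \<le> 3 * sqrt 2 / pi\<^sup>2 \<and> (d (proj N) = 3 * sqrt 2 / pi\<^sup>2 \<longrightarrow> s (proj N) = Some (1 / (2 * fst N)))"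
    by (rule contribution[OF future K(1) admissible_iff relative_density_N])
  have dN0: "d (proj N\<^sub>0) \<le> 2 * sqrt 2 / pi\<^sup>2 \<and> (d (proj N\<^sub>0) = 2 * sqrt 2 / pi\<^sup>2 \<longrightarrow> s (proj N\<^sub>0) = Some (1 / (2 * fst N\<^sub>0)))"
    by (rule contribution[OF corner.future K(2) corner_admissible_iff relative_density_N0])
  have sum: "2 * sqrt 2 / pi\<^sup>2 + 3 * sqrt 2 / pi\<^sup>2 = 5 * sqrt 2 / pi\<^sup>2" by (simp add: add_divide_distrib[symmetric])
  show ?thesis
  proof (intro conjI impI)
    show "horoball_packing_density b s \<le> 5 * sqrt 2 / pi\<^sup>2" unfolding density sum[symmetric] using dN dN0 by (intro add_mono) auto
    assume "horoball_packing_density b s = 5 * sqrt 2 / pi\<^sup>2"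
    then have "d (proj N\<^sub>0) + d (proj N) = 2 * sqrt 2 / pi\<^sup>2 + 3 * sqrt 2 / pi\<^sup>2" unfolding density sum .
    then have "d (proj N\<^sub>0) = 2 * sqrt 2 / pi\<^sup>2" "d (proj N) = 3 * sqrt 2 / pi\<^sup>2" using dN dN0 by linarith+
    then have s: "s (proj N\<^sub>0) = Some (1 / (2 * fst N\<^sub>0))" "s (proj N) = Some (1 / (2 * fst N))" using dN dN0 by auto
    then have "dom s = {proj N\<^sub>0, proj N}" using dom by auto
    then show "optimal_configuration b s" using s by (simp only: optimal_configuration_iff simp_thms)
  qed
qed

lemma optimal_density:
  assumes "optimal_configuration b s"
  shows "horoball_packing_density b s = 5 * sqrt 2 / pi\<^sup>2"
proof -
  have s: "dom s = {proj N\<^sub>0, proj N}" "s (proj N) = Some (1 / (2 * fst N))" "s (proj N\<^sub>0) = Some (1 / (2 * fst N\<^sub>0))"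
    using assms optimal_configuration_iff by auto
  have "admissible_horoball b (proj N) (1 / (2 * fst N))" "admissible_horoball b (proj N\<^sub>0) (1 / (2 * fst N\<^sub>0))"
    using future corner.future by (simp_all add: admissible_iff corner_admissible_iff)
  then have "horoball_packing_density b s = 2 * sqrt 2 / pi\<^sup>2 + 3 * sqrt 2 / pi\<^sup>2"
    unfolding horoball_packing_density_def s(1) using s proj_N0_neq_N future corner.future
    by (simp add: relative_density_N relative_density_N0)
  also have "\<dots> = 5 * sqrt 2 / pi\<^sup>2" by (simp add: add_divide_distrib[symmetric])
  finally show ?thesis .
qed

end

section \<open>The images of the optimal horoballs do not overlap\<close>

lemma linear_lorentz_reflection: "linear (lorentz_reflection u)"
  by (rule linearI) (simp_all add: lorentz_reflection_def lorentz_linear algebra_simps)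

lemma reflection_group_linear: "g \<in> reflection_group b \<Longrightarrow> linear g"
proof (induction rule: reflection_group.induct)
  case id show ?case by (simp add: linear_id[unfolded id_def] id_def)
next
  case (step g i)
  then show ?case by (intro linear_compose linear_lorentz_reflection)
qed

context two_cusp_scheme begin

text \<open>
  The lengths for which all the numbers \<open>2 \<langle>e\<^sub>j, e\<^sub>i\<rangle> / \<langle>e\<^sub>j,
  e\<^sub>j\<rangle>\<close> are integers: across an edge labelled 4 the length changes by \<open>sqrt 2\<close>,
  across the edges labelled 3 and \<open>\<infinity>\<close> it stays the same.
\<close>
definition root_length :: "nat \<Rightarrow> real" where
  "root_length i = (if i = 0 \<or> i = 2 \<or> i = 3 then sqrt 2 else 1)"

definition root :: "nat \<Rightarrow> real \<times> (real^4)" where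
  "root i = root_length i *\<^sub>R b i"

text \<open>
  The dual of the root lattice is invariant under the reflections because they are crystallographic. Its elements have
  integral inner products with all the images of the roots.
\<close>
definition dual_lattice :: "(real \<times> (real^4)) set" where
  "dual_lattice = {x. \<forall>i\<le>5. lorentz x (root i) \<in> \<int>}"

lemma root_length_pos: "root_length i > 0"
  by (simp add: root_length_def)

lemma lorentz_roots:
  "lorentz (root 0) (root 0) = 2" "lorentz (root (Suc 0)) (root (Suc 0)) = 1" "lorentz (root 2) (root 2) = 2"
  "lorentz (root 3) (root 3) = 2" "lorentz (root 4) (root 4) = 1" "lorentz (root 5) (root 5) = 1"
  "lorentz (root 0) (root (Suc 0)) = - 1" "lorentz (root (Suc 0)) (root 2) = - 1" "lorentz (root 2) (root 3) = - 1"
  "lorentz (root 3) (root 4) = - 1" "lorentz (root 4) (root 5) = - 1"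
  "lorentz (root 0) (root 2) = 0" "lorentz (root 0) (root 3) = 0" "lorentz (root 0) (root 4) = 0" "lorentz (root 0) (root 5) = 0"
  "lorentz (root (Suc 0)) (root 3) = 0" "lorentz (root (Suc 0)) (root 4) = 0" "lorentz (root (Suc 0)) (root 5) = 0"
  "lorentz (root 2) (root 4) = 0" "lorentz (root 2) (root 5) = 0" "lorentz (root 3) (root 5) = 0"
  by (simp_all add: root_def root_length_def lorentz_linear gram_b)

lemmas lorentz_roots' = lorentz_roots lorentz_roots[THEN trans[OF lorentz_commute]]

lemma crystallographic:
  assumes "i \<le> 5" "j \<le> 5"
  shows "2 * lorentz (root j) (root i) / lorentz (root j) (root j) \<in> \<int>"
proof -
  have "\<forall>j\<le>5. \<forall>i\<le>5. 2 * lorentz (root j) (root i) / lorentz (root j) (root j) \<in> \<int>"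
    unfolding all_le_5 by (simp add: lorentz_roots')
  then show ?thesis using assms by blast
qed

lemma dual_lattice_reflection:
  assumes x: "x \<in> dual_lattice" and j: "j \<le> 5"
  shows "lorentz_reflection (b j) x \<in> dual_lattice"
proof -
  have "lorentz (lorentz_reflection (b j) x) (root i) \<in> \<int>" if i: "i \<le> 5" for i
  proof -
    have norm: "lorentz (root j) (root j) = (root_length j)\<^sup>2"
      using norm_b[OF j] by (simp add: root_def lorentz_linear power2_eq_square)
    have "lorentz (lorentz_reflection (b j) x) (root i) = lorentz x (root i) - lorentz x (root j) * (2 * lorentz (root j) (root i) / lorentz (root j) (root j))"
      unfolding norm using root_length_pos[of j]
      by (simp add: lorentz_reflection_def lorentz_linear root_def[of j] power2_eq_square)
    also have "\<dots> \<in> \<int>" using x i j crystallographic[OF i j] by (intro Ints_diff Ints_mult) (auto simp: dual_lattice_def)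
    finally show ?thesis .
  qed
  then show ?thesis by (simp add: dual_lattice_def)
qed

lemma dual_lattice_group: "g \<in> reflection_group b \<Longrightarrow> x \<in> dual_lattice \<Longrightarrow> g x \<in> dual_lattice"
proof (induction rule: reflection_group.induct)
  case (step g i)
  then show ?case using dual_lattice_reflection[of "g x" i] by simp
qed simp

lemma dual_lattice_pairing:
  "g \<in> reflection_group b \<Longrightarrow> x \<in> dual_lattice \<Longrightarrow> i \<le> 5 \<Longrightarrow> lorentz x (g (root i)) \<in> \<int>"
proof (induction arbitrary: x rule: reflection_group.induct)
  case id
  then show ?case by (simp add: dual_lattice_def)
next
  case (step g j)
  have "lorentz x ((lorentz_reflection (b j) \<circ> g) (root i)) = lorentz (lorentz_reflection (b j) x) (g (root i))"
    by (simp add: lorentz_reflection_adjoint)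
  also have "\<dots> \<in> \<int>" using step dual_lattice_reflection[of x j] by simp
  finally show ?case .
qed

text \<open>
  Null vectors in the root lattice that represent the ideal vertices \<open>A\<^sub>3\<close> (for
  \<open>True\<close>) and \<open>A\<^sub>0\<close> (for \<open>False\<close>); the maximal horoballs are those of
  \<open>sqrt 2\<close> times these vectors.
\<close>
definition cusp :: "bool \<Rightarrow> real \<times> (real^4)" where
  "cusp e = (if e then root 4 + root 5 else root (Suc 0) + root 2 + root 3 + root 4)"

lemma cusp_N: "2 *\<^sub>R N = sqrt 2 *\<^sub>R cusp True"
proof -
  have "2 *\<^sub>R N = (2 / sqrt 2) *\<^sub>R (b 4 + b 5)" by (simp add: N_def)
  also have "2 / sqrt 2 = sqrt (2::real)" by (simp add: real_div_sqrt)
  finally show ?thesis by (simp add: cusp_def root_def root_length_def)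
qed

lemma cusp_N0: "2 *\<^sub>R N\<^sub>0 = sqrt 2 *\<^sub>R cusp False"
  by (simp add: cusp_def root_def root_length_def b_eq_vec_at N\<^sub>0_def vec_at_scale vec_at_add field_simps)

lemma cusp_null: "lorentz (cusp e) (cusp e) = 0"
  by (simp add: cusp_def lorentz_linear lorentz_roots')

lemma cusp_future: "fst (cusp e) > 0"
proof -
  have "fst (2 *\<^sub>R N) > 0" "fst (2 *\<^sub>R N\<^sub>0) > 0" using future corner.future by simp_all
  then show ?thesis unfolding cusp_N cusp_N0 by (cases e) (simp_all add: zero_less_mult_iff)
qed

lemma cusp_dual: "cusp e \<in> dual_lattice"
proof -
  have "\<forall>i\<le>5. lorentz (cusp e) (root i) \<in> \<int>" unfolding all_le_5 by (simp add: cusp_def lorentz_linear lorentz_roots')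
  then show ?thesis by (simp add: dual_lattice_def)
qed

text \<open>
  A root that pairs to \<open>-1\<close> with the cusp shows that the cusp is not a proper multiple of another vector
  of the dual lattice.
\<close>
lemma cusp_primitive: "\<exists>i\<le>5. lorentz (cusp e) (root i) = - 1"
proof (cases e)
  case True then show ?thesis by (intro exI[of _ 3]) (simp add: cusp_def lorentz_linear lorentz_roots')
next
  case False then show ?thesis by (intro exI[of _ 0]) (simp add: cusp_def lorentz_linear lorentz_roots')
qed

lemma cusp_pairing:
  assumes "g \<in> reflection_group b" "x \<in> dual_lattice"
  shows "lorentz x (g (cusp e)) \<in> \<int>"
  using dual_lattice_pairing[OF assms] reflection_group_linear[OF assms(1)]
  by (simp add: cusp_def linear_add lorentz_linear)

text \<open>
  Orthogonal null vectors are parallel, and by primitivity the ratio \<open>r\<close> of two parallel images of cusps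
  is an integer that divides 1. Hence concentric images of the optimal horoballs coincide.
\<close>
lemma parallel_cusps_eq:
  assumes g: "g \<in> reflection_group b" and g': "g' \<in> reflection_group b"
    and orth: "lorentz (g (cusp e)) (g' (cusp e')) = 0"
  shows "g (cusp e) = g' (cusp e')"
proof -
  note iso = reflection_group_future_isometry[OF norm_b g, THEN conjunct1] reflection_group_future_isometry[OF norm_b g', THEN conjunct1]
  have null: "lorentz (g (cusp e)) (g (cusp e)) = 0" "lorentz (g' (cusp e')) (g' (cusp e')) = 0"
    by (simp_all add: future_isometryD(1)[OF iso(1)] future_isometryD(1)[OF iso(2)] cusp_null)
  have fut: "fst (g (cusp e)) > 0" "fst (g' (cusp e')) > 0"
    by (rule future_isometryD(3)[OF iso(1)] future_isometryD(3)[OF iso(2)]; simp add: cusp_null cusp_future)+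
  define r where "r = fst (g' (cusp e')) / fst (g (cusp e))"
  have r: "r > 0" using fut by (simp add: r_def)
  have par: "g' (cusp e') = r *\<^sub>R g (cusp e)"
    unfolding r_def by (rule orthogonal_null_vectors_parallel) (use null fut orth in auto)
  obtain i where i: "i \<le> 5" "lorentz (cusp e) (root i) = - 1" using cusp_primitive by blast
  obtain j where j: "j \<le> 5" "lorentz (cusp e') (root j) = - 1" using cusp_primitive by blast
  have "lorentz (g' (cusp e')) (g (root i)) = - r"
    unfolding par by (simp add: lorentz_linear future_isometryD(1)[OF iso(1)] i)
  moreover have "lorentz (g' (cusp e')) (g (root i)) \<in> \<int>"
    by (rule dual_lattice_pairing[OF g dual_lattice_group[OF g' cusp_dual] i(1)])
  ultimately have "- r \<in> \<int>" by simp
  then obtain n :: int where n: "r = of_int n" by (metis Ints_cases Ints_minus minus_minus)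
  have "r * lorentz (g (cusp e)) (g' (root j)) = - 1"
    using future_isometryD(1)[OF iso(2), of "cusp e'" "root j"] unfolding par by (simp add: lorentz_linear j)
  moreover have "lorentz (g (cusp e)) (g' (root j)) \<in> \<int>"
    by (rule dual_lattice_pairing[OF g' dual_lattice_group[OF g cusp_dual] j(1)])
  then obtain l :: int where "lorentz (g (cusp e)) (g' (root j)) = of_int l" by (metis Ints_cases)
  ultimately have "of_int (n * l) = (of_int (- 1) :: real)" by (simp add: n)
  then have "n * l = - 1" by (simp only: of_int_eq_iff)
  then have "n = 1" using r n by (metis minus_mult_right of_int_0_less_iff zmult_eq_1_iff mult_minus_right minus_minus less_asym neg_less_0_iff_less zero_less_one)
  then show ?thesis using par n by simp
qed

text \<open>
  The inner product of two images of cusps is a nonpositive integer; it is nonzero unless the images agree, so the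
  null vectors scaled by \<open>sqrt 2\<close> have inner product at most \<open>-2\<close>.
\<close>
lemma cusp_horoballs_disjoint:
  assumes g: "g \<in> reflection_group b" and g': "g' \<in> reflection_group b" and ne: "g (cusp e) \<noteq> g' (cusp e')"
  shows "interior (null_horoball (sqrt 2 *\<^sub>R g (cusp e))) \<inter> interior (null_horoball (sqrt 2 *\<^sub>R g' (cusp e'))) = {}"
proof (rule null_horoball_interior_disjoint)
  note iso = reflection_group_future_isometry[OF norm_b g, THEN conjunct1] reflection_group_future_isometry[OF norm_b g', THEN conjunct1]
  show null: "lorentz (sqrt 2 *\<^sub>R g (cusp e)) (sqrt 2 *\<^sub>R g (cusp e)) = 0" "lorentz (sqrt 2 *\<^sub>R g' (cusp e')) (sqrt 2 *\<^sub>R g' (cusp e')) = 0"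
    by (simp_all add: lorentz_linear future_isometryD(1)[OF iso(1)] future_isometryD(1)[OF iso(2)] cusp_null)
  have fut: "fst (g (cusp e)) > 0" "fst (g' (cusp e')) > 0"
    by (rule future_isometryD(3)[OF iso(1)] future_isometryD(3)[OF iso(2)]; simp add: cusp_null cusp_future)+
  then show "fst (sqrt 2 *\<^sub>R g (cusp e)) > 0" "fst (sqrt 2 *\<^sub>R g' (cusp e')) > 0" by simp_all
  have "lorentz (g (cusp e)) (g' (cusp e')) \<in> \<int>" by (rule cusp_pairing[OF g' dual_lattice_group[OF g cusp_dual]])
  then obtain n :: int where n: "lorentz (g (cusp e)) (g' (cusp e')) = of_int n" by (metis Ints_cases)
  have "lorentz (g (cusp e)) (g' (cusp e')) \<le> 0"
    by (rule lorentz_future_nonpos) (use fut in \<open>simp_all add: future_isometryD(1)[OF iso(1)] future_isometryD(1)[OF iso(2)] cusp_null\<close>)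
  moreover have "lorentz (g (cusp e)) (g' (cusp e')) \<noteq> 0" using parallel_cusps_eq[OF g g'] ne by blast
  ultimately have "n \<le> - 1" by (simp add: n)
  then have "of_int n \<le> (- 1 :: real)" by linarith
  then show "2 \<le> - lorentz (sqrt 2 *\<^sub>R g (cusp e)) (sqrt 2 *\<^sub>R g' (cusp e'))" by (simp add: lorentz_linear n mult.assoc[symmetric])
qed

lemma optimal_horoball:
  "horoball (proj N) (1 / (2 * fst N)) = null_horoball (sqrt 2 *\<^sub>R cusp True)"
  "horoball (proj N\<^sub>0) (1 / (2 * fst N\<^sub>0)) = null_horoball (sqrt 2 *\<^sub>R cusp False)"
  using horoball_eq_null_horoball[of "2 *\<^sub>R N"] horoball_eq_null_horoball[of "2 *\<^sub>R N\<^sub>0"] future corner.future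
  by (simp_all add: proj_scaleR cusp_N[symmetric] cusp_N0[symmetric])

lemma optimal_packing:
  assumes "optimal_configuration b s"
  shows "horoball_packing b s \<and> horoball_types b s \<le> 2"
proof
  have s: "dom s = {proj N\<^sub>0, proj N}" "s (proj N) = Some (1 / (2 * fst N))" "s (proj N\<^sub>0) = Some (1 / (2 * fst N\<^sub>0))"
    using assms optimal_configuration_iff by auto
  have image: "\<exists>g\<in>reflection_group b. \<exists>e. X = null_horoball (sqrt 2 *\<^sub>R g (cusp e))" if X: "X \<in> horoball_images b s" for X
  proof -
    obtain g p r where g: "X = klein_action g ` horoball p r" "g \<in> reflection_group b" "s p = Some r"
      using X by (auto simp: horoball_images_def)
    have "p = proj N\<^sub>0 \<or> p = proj N" using domI[of s p r] g(3) s(1) by blast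
    then have "\<exists>e. horoball p r = null_horoball (sqrt 2 *\<^sub>R cusp e)" using s g(3) optimal_horoball by (metis option.inject)
    then obtain e where "horoball p r = null_horoball (sqrt 2 *\<^sub>R cusp e)" by blast
    then have "X = null_horoball (g (sqrt 2 *\<^sub>R cusp e))"
      using g klein_action_null_horoball[OF norm_b g(2)] by simp
    then have "X = null_horoball (sqrt 2 *\<^sub>R g (cusp e))" using reflection_group_linear[OF g(2)] by (simp add: linear_scale)
    then show ?thesis using g(2) by blast
  qed
  have "interior X \<inter> interior Y = {}" if XY: "X \<in> horoball_images b s" "Y \<in> horoball_images b s" "X \<noteq> Y" for X Y
  proof -
    obtain g e where g: "g \<in> reflection_group b" "X = null_horoball (sqrt 2 *\<^sub>R g (cusp e))" using image[OF XY(1)] by blast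
    obtain g' e' where g': "g' \<in> reflection_group b" "Y = null_horoball (sqrt 2 *\<^sub>R g' (cusp e'))" using image[OF XY(2)] by blast
    have "g (cusp e) \<noteq> g' (cusp e')" using XY(3) g g' by metis
    then show ?thesis unfolding g(2) g'(2) by (rule cusp_horoballs_disjoint[OF g(1) g'(1)])
  qed
  then have "pairwise (\<lambda>X Y. interior X \<inter> interior Y = {}) (horoball_images b s)" by (auto simp: pairwise_def)
  moreover have "admissible_horoball b p r" if "s p = Some r" for p r
  proof -
    have "p = proj N\<^sub>0 \<or> p = proj N" using domI[of s p r] that s(1) by blast
    then show ?thesis using that s future corner.future by (auto simp: admissible_iff corner_admissible_iff)
  qed
  ultimately show "horoball_packing b s"
    unfolding horoball_packing_def s(1) ideal_vertices_two_cusps by blast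
  show "horoball_types b s \<le> 2"
    unfolding horoball_types_def s(1) by (rule order_trans[OF card_image_le]) (simp_all add: card_insert_if)
qed

lemma optimal_configuration_exists: "\<exists>s. optimal_configuration b s"
proof -
  have "optimal_configuration b [proj N\<^sub>0 \<mapsto> 1 / (2 * fst N\<^sub>0), proj N \<mapsto> 1 / (2 * fst N)]"
    unfolding optimal_configuration_iff using proj_N0_neq_N by auto
  then show ?thesis by blast
qed

end

section \<open>Numerical bounds and the densest packing\<close>

text \<open>
  The difference of the two sides has the derivative \<open>x\<^sup>1\<^sup>0 / (1 + x\<^sup>2)\<close>, by the
  geometric series; the next lemma is analogous.
\<close>
lemma arctan_upper: "0 \<le> x \<Longrightarrow> arctan x \<le> x - x ^ 3 / 3 + x ^ 5 / 5 - x ^ 7 / 7 + x ^ 9 / 9"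
proof -
  assume x: "0 \<le> x"
  have "(\<lambda>x. x - x ^ 3 / 3 + x ^ 5 / 5 - x ^ 7 / 7 + x ^ 9 / 9 - arctan x) 0 \<le> (\<lambda>x. x - x ^ 3 / 3 + x ^ 5 / 5 - x ^ 7 / 7 + x ^ 9 / 9 - arctan x) x"
  proof (rule DERIV_nonneg_imp_nondecreasing[OF x])
    fix u :: real
    have p: "1 + u\<^sup>2 > 0" by (simp add: add_pos_nonneg)
    have "((\<lambda>x. x - x ^ 3 / 3 + x ^ 5 / 5 - x ^ 7 / 7 + x ^ 9 / 9 - arctan x) has_real_derivative
        1 - u\<^sup>2 + u ^ 4 - u ^ 6 + u ^ 8 - inverse (1 + u\<^sup>2)) (at u)"
      by (auto intro!: derivative_eq_intros)
    moreover have "1 - u\<^sup>2 + u ^ 4 - u ^ 6 + u ^ 8 - inverse (1 + u\<^sup>2) = u ^ 10 / (1 + u\<^sup>2)"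
    proof -
      have eq: "(1 - u\<^sup>2 + u ^ 4 - u ^ 6 + u ^ 8) * (1 + u\<^sup>2) - 1 = u ^ 10" by (simp add: eval_nat_numeral algebra_simps)
      have gen: "v - inverse q = w / q" if "v * q - 1 = w" "q > 0" for v q w :: real
        using that by (simp add: field_simps)
      show ?thesis by (rule gen[OF eq p])
    qed
    ultimately show "\<exists>y. ((\<lambda>x. x - x ^ 3 / 3 + x ^ 5 / 5 - x ^ 7 / 7 + x ^ 9 / 9 - arctan x) has_real_derivative y) (at u) \<and> 0 \<le> y"
      using p by auto
  qed
  then show ?thesis by simp
qed

lemma arctan_lower: "0 \<le> x \<Longrightarrow> x - x ^ 3 / 3 + x ^ 5 / 5 - x ^ 7 / 7 \<le> arctan x"
proof -
  assume x: "0 \<le> x"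
  have "(\<lambda>x. arctan x - (x - x ^ 3 / 3 + x ^ 5 / 5 - x ^ 7 / 7)) 0 \<le> (\<lambda>x. arctan x - (x - x ^ 3 / 3 + x ^ 5 / 5 - x ^ 7 / 7)) x"
  proof (rule DERIV_nonneg_imp_nondecreasing[OF x])
    fix u :: real
    have p: "1 + u\<^sup>2 > 0" by (simp add: add_pos_nonneg)
    have "((\<lambda>x. arctan x - (x - x ^ 3 / 3 + x ^ 5 / 5 - x ^ 7 / 7)) has_real_derivative
        inverse (1 + u\<^sup>2) - (1 - u\<^sup>2 + u ^ 4 - u ^ 6)) (at u)"
      by (auto intro!: derivative_eq_intros)
    moreover have "inverse (1 + u\<^sup>2) - (1 - u\<^sup>2 + u ^ 4 - u ^ 6) = u ^ 8 / (1 + u\<^sup>2)"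
    proof -
      have eq: "1 - (1 - u\<^sup>2 + u ^ 4 - u ^ 6) * (1 + u\<^sup>2) = u ^ 8" by (simp add: eval_nat_numeral algebra_simps)
      have gen: "inverse q - v = w / q" if "1 - v * q = w" "q > 0" for v q w :: real
        using that by (simp add: field_simps)
      show ?thesis by (rule gen[OF eq p])
    qed
    ultimately show "\<exists>y. ((\<lambda>x. arctan x - (x - x ^ 3 / 3 + x ^ 5 / 5 - x ^ 7 / 7)) has_real_derivative y) (at u) \<and> 0 \<le> y"
      using p by auto
  qed
  then show ?thesis by simp
qed

text \<open>Machin's formula \<open>\<pi>/4 = 4 arctan (1/5) - arctan (1/239)\<close>.\<close>
lemma pi_bounds: "3.14158 \<le> pi" "pi \<le> 3.1416"
proof -
  note m = machin
  show "3.14158 \<le> pi" "pi \<le> 3.1416"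
    using m arctan_upper[of "1/5"] arctan_lower[of "1/5"] arctan_upper[of "1/239"] arctan_lower[of "1/239"]
    by (simp_all add: power_divide)
qed

lemma optimal_density_bounds: "0.71644 \<le> 5 * sqrt 2 / pi\<^sup>2" "5 * sqrt 2 / pi\<^sup>2 \<le> 0.71646"
proof -
  have s: "1.414213 \<le> sqrt 2" "sqrt 2 \<le> (1.414214::real)"
    by (rule real_le_rsqrt real_le_lsqrt; simp add: power2_eq_square)+
  have "3.14158\<^sup>2 \<le> pi\<^sup>2" "pi\<^sup>2 \<le> 3.1416\<^sup>2" using pi_bounds by (auto intro!: power_mono)
  then have p: "9.86952 \<le> pi\<^sup>2" "pi\<^sup>2 \<le> 9.86966" by (simp_all add: power2_eq_square)
  have "0.71644 * pi\<^sup>2 \<le> 5 * sqrt 2" "5 * sqrt 2 \<le> 0.71646 * pi\<^sup>2" using s p by simp_all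
  then show "0.71644 \<le> 5 * sqrt 2 / pi\<^sup>2" "5 * sqrt 2 / pi\<^sup>2 \<le> 0.71646" using p
    by (simp_all add: pos_le_divide_eq pos_divide_le_eq)
qed

lemma optimal_density_approx: "\<bar>5 * sqrt 2 / pi\<^sup>2 - 0.71645\<bar> \<le> 1 / 10 ^ 5"
proof -
  have "\<bar>d - 0.71645\<bar> \<le> 1 / 10 ^ 5" if "0.71644 \<le> d" "d \<le> 0.71646" for d :: real
    unfolding abs_le_iff using that by simp
  then show ?thesis using optimal_density_bounds by blast
qed

text \<open>
  The bound for balls and for horoballs at \<open>A\<^sub>3\<close> alone, about \<open>0.686\<close>, lies below the
  optimal density.
\<close>
lemma single_cusp_bound_less: "(7 / 9) powr (3 / 2) < 5 * sqrt 2 / pi\<^sup>2"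
proof -
  have "(7 / 9 :: real) powr (3 / 2) = (7 / 9) powr 1 * (7 / 9) powr (1 / 2)" by (subst powr_add[symmetric]) simp
  also have "\<dots> = 7 / 9 * sqrt (7 / 9)" by (simp add: powr_half_sqrt)
  also have "\<dots> \<le> 7 / 9 * 0.882"
    by (intro mult_left_mono real_le_lsqrt) (simp_all add: power2_eq_square)
  also have "\<dots> < 0.71644" by simp
  also note optimal_density_bounds(1)
  finally show ?thesis .
qed

lemma truncated_orthoscheme_iff:
  fixes b :: "nat \<Rightarrow> real \<times> (real^4)"
  assumes m: "m \<in> symbols4"
  shows "truncated_orthoscheme m b \<longleftrightarrow>
    truncated_scheme b (cos (pi / real (m ! 0))) (cos (pi / real (m ! 1))) (cos (pi / real (m ! 2))) (cos (pi / real (m ! 3)))"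
proof -
  have len: "length m = 4" using m by (auto simp: symbols4_def)
  have "{1..4::nat} = {1, 2, 3, 4}" by auto
  then have adj: "(\<forall>i\<in>{1..4}. lorentz (b (i - 1)) (b i) = - cos (pi / real (m ! (i - 1)))) \<longleftrightarrow>
     lorentz (b 0) (b (Suc 0)) = - cos (pi / real (m ! 0)) \<and> lorentz (b (Suc 0)) (b 2) = - cos (pi / real (m ! 1)) \<and>
     lorentz (b 2) (b 3) = - cos (pi / real (m ! 2)) \<and> lorentz (b 3) (b 4) = - cos (pi / real (m ! 3))"
    by simp
  have far: "(\<forall>i\<le>5. \<forall>j\<le>5. i + 2 \<le> j \<longrightarrow> lorentz (b i) (b j) = 0) \<longleftrightarrow>
     (\<forall>i j. j \<le> 5 \<longrightarrow> i + 2 \<le> j \<longrightarrow> lorentz (b i) (b j) = 0)"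
    by (meson add_leE order_trans)
  have *: "truncated_orthoscheme m b \<longleftrightarrow>
     (\<forall>i\<le>5. lorentz (b i) (b i) = 1) \<and>
     (\<forall>i\<in>{1..4}. lorentz (b (i - 1)) (b i) = - cos (pi / real (m ! (i - 1)))) \<and>
     lorentz (b 4) (b 5) = - 1 \<and>
     (\<forall>i\<le>5. \<forall>j\<le>5. i + 2 \<le> j \<longrightarrow> lorentz (b i) (b j) = 0) \<and>
     (\<exists>v\<in>ball 0 1. \<forall>i\<le>5. lorentz (lift v) (b i) < 0)"
    using len by (simp add: truncated_orthoscheme_def Let_def)
  show ?thesis
    unfolding * adj far truncated_scheme_def using symbols4_params[OF m] unfolding scheme_params_def by blast
qed

text \<open>
  The formulas for the normals in half-space coordinates define a realisation in any frame; its interior point is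
  taken at height \<open>sqrt 2\<close>, above the unit hemisphere.
\<close>
lemma scheme_exists:
  assumes p: "scheme_params C S c L"
  shows "\<exists>b. truncated_scheme b C S c L"
proof -
  define E where "E = (1 / 2 :: real, axis 4 (- 1 / 2) :: real^4)"
  define N where "N = (1 / 2 :: real, axis 4 (1 / 2) :: real^4)"
  interpret half_space_frame E "(0, axis 1 1)" "(0, axis 2 1)" "(0, axis 3 1)" N
    by unfold_locales (simp_all add: lorentz_def E_def N_def inner_axis_axis)
  define b where "b i = (if i = 0 then vec_at (0, 0, - 1, 0, 0) else if i = Suc 0 then vec_at (0, - S, C, 0, 0)
     else if i = 2 then vec_at (0, 1, 0, 0, 2 * c) else if i = 3 then vec_at (1, 0, 0, 0, - 1)
     else if i = 4 then vec_at (0, 0, 0, 1, 2 * L) else vec_at (0, 0, 0, - 1, 0))" for i :: nat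
  have P: "C\<^sup>2 + S\<^sup>2 = 1" "C > 0" "S > 0" "c > 0" "L > 0" "c\<^sup>2 + (c * (S / C))\<^sup>2 + L\<^sup>2 \<le> 1"
    using p by (auto simp: scheme_params_def)
  have b: "b 0 = vec_at (0, 0, - 1, 0, 0)" "b (Suc 0) = vec_at (0, - S, C, 0, 0)" "b 2 = vec_at (0, 1, 0, 0, 2 * c)"
    "b 3 = vec_at (1, 0, 0, 0, - 1)" "b 4 = vec_at (0, 0, 0, 1, 2 * L)" "b 5 = vec_at (0, 0, 0, - 1, 0)"
    by (simp_all add: b_def)
  have "truncated_scheme b C S c L"
  proof
    have "\<forall>i\<le>5. lorentz (b i) (b i) = 1" unfolding all_le_5
      using P(1) by (simp add: b lorentz_vec_at power2_eq_square)
    then show "lorentz (b i) (b i) = 1" if "i \<le> 5" for i using that by blast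
    have "\<forall>j\<le>5. \<forall>i\<le>5. i + 2 \<le> j \<longrightarrow> lorentz (b i) (b j) = 0" unfolding all_le_5
      by (simp add: b lorentz_vec_at)
    then show "lorentz (b i) (b j) = 0" if "j \<le> 5" "i + 2 \<le> j" for i j using that by simp
    \<comment> \<open>the midpoint of a segment across the triangle, half way between the parallel walls\<close>
    define X where "X = point (c / 2, S / C * c / 4, L / 2, 2)"
    have fX: "fst X > 0" unfolding X_def by (rule fst_point_pos) simp
    have "\<forall>i\<le>5. lorentz X (b i) < 0"
      unfolding all_le_5 X_def point_def split b lorentz_vec_at using P(2-5)
      by (simp add: field_simps add_pos_pos)
    then have "\<forall>i\<le>5. lorentz (lift (proj X)) (b i) < 0" using fX by (simp add: lorentz_lift_proj divide_less_0_iff)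
    moreover have "proj X \<in> ball 0 1" unfolding X_def by (rule point_in_ball) simp
    ultimately show "\<exists>v\<in>ball 0 1. \<forall>i\<le>5. lorentz (lift v) (b i) < 0" by blast
  qed (use P in \<open>simp_all add: b lorentz_vec_at\<close>)
  then show ?thesis by blast
qed

lemma corner_not_ideal:
  assumes "m \<in> symbols4" "m \<noteq> [4, 4, 3, 4]"
  shows "(cos (pi / real (m ! 2)))\<^sup>2 + (cos (pi / real (m ! 2)) * (cos (pi / real (m ! 1)) / cos (pi / real (m ! 0))))\<^sup>2
     + (cos (pi / real (m ! 3)))\<^sup>2 \<noteq> 1"
proof -
  have "((1 + sqrt 5) / 4)\<^sup>2 = ((3 + sqrt 5) / 8 :: real)" by (simp add: power_divide power2_eq_square algebra_simps)
  moreover have "sqrt 5 \<noteq> 7 / (3::real)" using sqrt_bounds(6) by auto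
  ultimately show ?thesis using assms
    by (auto simp: symbols4_def cos_45 cos_30 cos_60 cos_pi_fifth numeral_2_eq_2 numeral_3_eq_3 power_mult_distrib power_divide field_simps)
qed

theorem theorem4p4:
  shows
    "(\<forall>m\<in>symbols4. \<exists>b :: nat \<Rightarrow> real \<times> (real^4). truncated_orthoscheme m b) \<and>
     (\<forall>b :: nat \<Rightarrow> real \<times> (real^4). truncated_orthoscheme [4,4,3,4] b \<longrightarrow>
        orthoscheme_vertex b 0 \<noteq> orthoscheme_vertex b 3 \<and>
        ideal_vertices b = {orthoscheme_vertex b 0, orthoscheme_vertex b 3} \<and>
        (\<exists>s. optimal_configuration b s) \<and>
        (\<forall>s. optimal_configuration b s \<longrightarrow>
           horoball_packing b s \<and> horoball_types b s \<le> 2 \<and>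
           horoball_packing_density b s = 5 * sqrt 2 / pi\<^sup>2)) \<and>
     (\<forall>m\<in>symbols4. \<forall>b :: nat \<Rightarrow> real \<times> (real^4). truncated_orthoscheme m b \<longrightarrow>
        (\<forall>c r. ball_packing b c r \<longrightarrow> ball_packing_density b c r < 5 * sqrt 2 / pi\<^sup>2) \<and>
        (\<forall>s. horoball_packing b s \<and> horoball_types b s \<le> 2 \<longrightarrow>
           horoball_packing_density b s \<le> 5 * sqrt 2 / pi\<^sup>2 \<and>
           (horoball_packing_density b s = 5 * sqrt 2 / pi\<^sup>2 \<longrightarrow>
              m = [4,4,3,4] \<and> optimal_configuration b s))) \<and>
     \<bar>5 * sqrt 2 / pi\<^sup>2 - 0.71645\<bar> \<le> 1 / 10 ^ 5"
proof (intro conjI ballI allI impI)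
  fix m assume m: "m \<in> symbols4"
  show "\<exists>b :: nat \<Rightarrow> real \<times> (real^4). truncated_orthoscheme m b"
    using scheme_exists[OF symbols4_params[OF m]] truncated_orthoscheme_iff[OF m] by blast
next
  fix b :: "nat \<Rightarrow> real \<times> (real^4)" assume b: "truncated_orthoscheme [4,4,3,4] b"
  have "[4,4,3,4] \<in> symbols4" by (simp add: symbols4_def)
  from truncated_orthoscheme_iff[OF this, of b] b have "truncated_scheme b (sqrt 2 / 2) (sqrt 2 / 2) (1 / 2) (sqrt 2 / 2)"
    by (simp add: cos_45 cos_60 numeral_2_eq_2 numeral_3_eq_3)
  then interpret two_cusp_scheme b by (simp add: two_cusp_scheme_def)
  show "orthoscheme_vertex b 0 \<noteq> orthoscheme_vertex b 3"
    unfolding orthoscheme_vertex_0 orthoscheme_vertex_3 by (rule proj_N0_neq_N)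
  show "ideal_vertices b = {orthoscheme_vertex b 0, orthoscheme_vertex b 3}"
    unfolding orthoscheme_vertex_0 orthoscheme_vertex_3 by (rule ideal_vertices_two_cusps)
  show "\<exists>s. optimal_configuration b s" by (rule optimal_configuration_exists)
  fix s assume s: "optimal_configuration b s"
  show "horoball_packing b s" "horoball_types b s \<le> 2" using optimal_packing[OF s] by auto
  show "horoball_packing_density b s = 5 * sqrt 2 / pi\<^sup>2" by (rule optimal_density[OF s])
next
  fix m and b :: "nat \<Rightarrow> real \<times> (real^4)" assume m: "m \<in> symbols4" and b: "truncated_orthoscheme m b"
  define C S c L where CS: "C = cos (pi / real (m ! 0))" "S = cos (pi / real (m ! 1))" "c = cos (pi / real (m ! 2))" "L = cos (pi / real (m ! 3))"
  interpret truncated_scheme b C S c L using truncated_orthoscheme_iff[OF m] b by (simp add: CS)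
  have sp: "scheme_params C S c L" using symbols4_params[OF m] by (simp add: CS)
  have avg: "2 / 9 \<le> c\<^sup>2 / 2 + (c * (S / C))\<^sup>2 / 6 + L\<^sup>2 / 3" using sp by (simp add: scheme_params_def)
  show "ball_packing_density b v r < 5 * sqrt 2 / pi\<^sup>2" if ball: "ball_packing b v r" for v r
  proof -
    obtain K R where KR: "K > 0" "K ^ 3 \<le> c\<^sup>2 * (S / C) * L / 2" "R > 0" "c * (S / C) \<le> (1 + (1 + S) / C) * R"
        "(2 + ((1 + S) / C)\<^sup>2 + 4 / K\<^sup>2) * R\<^sup>2 \<le>
          1 - c\<^sup>2 - (c * (S / C))\<^sup>2 - L\<^sup>2 + (2 * c + 2 * (c * (S / C)) * ((1 + S) / C) + 2 * L) * R"
      using sp unfolding scheme_params_def by blast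
    have "ball_packing_density b v r \<le> (7 / 9) powr (3 / 2)"
      unfolding ball_packing_density_def by (rule relative_volume_bound[OF avg ball_volume_bound[OF KR ball]])
    then show ?thesis using single_cusp_bound_less by linarith
  qed
  fix s assume "horoball_packing b s \<and> horoball_types b s \<le> 2"
  then have s: "horoball_packing b s" by blast
  have "horoball_packing_density b s \<le> 5 * sqrt 2 / pi\<^sup>2 \<and>
           (horoball_packing_density b s = 5 * sqrt 2 / pi\<^sup>2 \<longrightarrow> m = [4,4,3,4] \<and> optimal_configuration b s)"
  proof (cases "m = [4, 4, 3, 4]")
    case True
    then have "truncated_scheme b (sqrt 2 / 2) (sqrt 2 / 2) (1 / 2) (sqrt 2 / 2)"
      using truncated_scheme_axioms by (simp add: CS cos_45 cos_60 numeral_2_eq_2 numeral_3_eq_3)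
    then interpret ideal: two_cusp_scheme b by (simp add: two_cusp_scheme_def)
    show ?thesis using ideal.horoball_packing_density_le[OF s] True by blast
  next
    case False
    then have "ideal_vertices b \<subseteq> {proj N}" using ideal_vertices_cases corner_not_ideal[OF m] by (auto simp: CS)
    then have dom: "dom s = {proj N}" using s unfolding horoball_packing_def by blast
    then obtain r where r: "s (proj N) = Some r" by blast
    then have "admissible_horoball b (proj N) r" using s by (simp add: horoball_packing_def)
    then have "relative_density b (proj N) r \<le> (7 / 9) powr (3 / 2)" by (rule relative_density_bound[OF avg])
    then have "horoball_packing_density b s < 5 * sqrt 2 / pi\<^sup>2"
      using single_cusp_bound_less by (simp add: horoball_packing_density_def dom r)
    then show ?thesis by simp
  qed
  then show "horoball_packing_density b s \<le> 5 * sqrt 2 / pi\<^sup>2"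
    "horoball_packing_density b s = 5 * sqrt 2 / pi\<^sup>2 \<Longrightarrow> m = [4,4,3,4]"
    "horoball_packing_density b s = 5 * sqrt 2 / pi\<^sup>2 \<Longrightarrow> optimal_configuration b s" by blast+
next
  show "\<bar>5 * sqrt 2 / pi\<^sup>2 - 0.71645\<bar> \<le> 1 / 10 ^ 5" by (rule optimal_density_approx)
qed

end
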